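(* Let $(\mathcal{M},g)$ be an initially expanding McVittie spacetime with a Big Bang background for which $K<0$, and let $(t_0,r_0)\in\Omega$ with $r_0>r_1(t_0)$. Let $s$ be an affine parameter along a radial null geodesic (RNG) $\gamma$ with $(t,r)|_{s=0}=(t_0,r_0)$. Then there exists $s_*\in(-\infty,0)$ such that $(t(s),r_{RNG}(s))\in\Omega$ for all $s\in(s_*,0)$ and $\lim_{s\to s_*^+}(t(s),r_{RNG}(s))\in\mathcal{O}\cup\partial\Omega_{\{\kappa=0\}}$, where $\mathcal{O}=\{(t,r):t=r=0\}$ and $\partial\Omega_{\{\kappa=0\}}=\{(t,r):r=r_1(t),\ 0<t<t_f\}$.
   Context: Setting: $M>0$, $\Lambda\in\mathbb{R}$, $K=-1$ (normalisation of $K<0$), $t_f\in(0,+\infty]$, scale factor $a:(0,t_f)\to\mathbb{R}_+$, $H=a'/a$, $\kappa(t,r)=1-\frac{2M}{r}+\frac{r^2}{a^2(t)}$; $r_1(t)$ is the unique positive zero of $\kappa(t,\cdot)$; $\Omega=\{(t,r):0<t<t_f,\ r>r_1(t)\}$. The spacetime is $\mathcal{M}=\Omega\times\mathbb{S}^2$ with $$ds^2=-\sigma^2(H^{-2}-r^2\kappa^{-1})dt^2-2\sigma r\kappa^{-1}dt\,dr+\kappa^{-1}dr^2+r^2d\omega^2,\qquad \sigma=\frac{H}{a^2}\kappa^{1/2}\int_r^\infty\bar r\,\kappa^{-3/2}(t,\bar r)\,d\bar r,$$ where $\sigma/H$ means $a^{-2}\kappa^{1/2}\int_r^\infty\bar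 r\kappa^{-3/2}d\bar r$ (also where $H=0$). "Initially expanding with a Big Bang background" means: (i) $a\in C^2((0,t_f),\mathbb{R}_+)$; (ii) $\lim_{t\to0^+}a=0$; (iii) $\mu_{FLRW}>0$, $\mu_{FLRW}+P_{FLRW}>0$, $\mu_{FLRW}+3P_{FLRW}>0$ on $(0,t_f)$, where $8\pi\mu_{FLRW}+\Lambda=3(H^2+Ka^{-2})$, $8\pi P_{FLRW}-\Lambda=-2H'-3H^2-Ka^{-2}$; (iv) if $t_f<\infty$ then $\lim_{t\to t_f^-}a=0$; (v) $aH\to+\infty$ as $a\to0^+$ at the Big Bang $t\to0^+$ (and $|aH|\to\infty$ as $t\to t_f^-$ if $t_f<\infty$), and $(aH)^2\sim-K+\frac\Lambda3a^2$ as $a\to+\infty$. $t$ increases to the future and is a global time function. RNGs are null geodesics with constant angular coordinates; in the $(t,r)$-plane they satisfy $\frac{dr}{dt}=\sigma(r\pm\kappa^{1/2}H^{-1})$ (outgoing: $+$; ingoing: $-$). Affine parameters are oriented so that $t$ increases with $s$. *)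

theory Defs
  imports "HOL-Analysis.Analysis" "HOL-Library.Landau_Symbols"
begin

section \<open>The FLRW background\<close>

definition time_domain :: "ereal \<Rightarrow> real set" where
  "time_domain tf = {t. 0 < t \<and> ereal t < tf}"

definition hubble :: "(real \<Rightarrow> real) \<Rightarrow> real \<Rightarrow> real" where
  "hubble a t = deriv a t / a t"

definition C2_on :: "(real \<Rightarrow> real) \<Rightarrow> real set \<Rightarrow> bool" where
  "C2_on f S \<longleftrightarrow>
     (\<forall>t\<in>S. f differentiable (at t)) \<and>
     (\<forall>t\<in>S. deriv f differentiable (at t)) \<and>
     continuous_on S (deriv (deriv f))"

text \<open>
  Throughout, the spatial curvature is normalised to \<open>K = -1\<close>. Density and pressure solve
  \<open>8 \<pi> \<mu> + \<Lambda> = 3 (H\<^sup>2 + K / a\<^sup>2)\<close> and \<open>8 \<pi> P - \<Lambda> = - 2 H' - 3 H\<^sup>2 - K / a\<^sup>2\<close>.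
\<close>

abbreviation (input) curvature_K :: real where
  "curvature_K \<equiv> -1"

definition mu_FLRW :: "real \<Rightarrow> (real \<Rightarrow> real) \<Rightarrow> real \<Rightarrow> real" where
  "mu_FLRW \<Lambda> a t =
     (3 * ((hubble a t)\<^sup>2 + curvature_K / (a t)\<^sup>2) - \<Lambda>) / (8 * pi)"

definition P_FLRW :: "real \<Rightarrow> (real \<Rightarrow> real) \<Rightarrow> real \<Rightarrow> real" where
  "P_FLRW \<Lambda> a t =
     (- 2 * deriv (hubble a) t - 3 * (hubble a t)\<^sup>2 - curvature_K / (a t)\<^sup>2 + \<Lambda>) / (8 * pi)"

text \<open>
  In the last clause the limit \<open>a \<rightarrow> +\<infinity>\<close> is taken along times in the domain with \<open>a t\<close> tending to
  infinity; the filter is trivial, and the clause vacuous, when \<open>a\<close> is bounded.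
\<close>

definition initially_expanding_big_bang :: "real \<Rightarrow> ereal \<Rightarrow> (real \<Rightarrow> real) \<Rightarrow> bool" where
  "initially_expanding_big_bang \<Lambda> tf a \<longleftrightarrow>
     C2_on a (time_domain tf) \<and> (\<forall>t\<in>time_domain tf. 0 < a t) \<and>
     (a \<longlongrightarrow> 0) (at_right 0) \<and>
     (\<forall>t\<in>time_domain tf.
        0 < mu_FLRW \<Lambda> a t \<and>
        0 < mu_FLRW \<Lambda> a t + P_FLRW \<Lambda> a t \<and>
        0 < mu_FLRW \<Lambda> a t + 3 * P_FLRW \<Lambda> a t) \<and>
     (\<forall>T. tf = ereal T \<longrightarrow> (a \<longlongrightarrow> 0) (at_left T)) \<and>
     filterlim (\<lambda>t. a t * hubble a t) at_top (at_right 0) \<and>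
     (\<forall>T. tf = ereal T \<longrightarrow> filterlim (\<lambda>t. \<bar>a t * hubble a t\<bar>) at_top (at_left T)) \<and>
     asymp_equiv (\<lambda>t. (a t * hubble a t)\<^sup>2)
       (inf (filtercomap a at_top) (principal (time_domain tf)))
       (\<lambda>t. - curvature_K + \<Lambda> / 3 * (a t)\<^sup>2)"


section \<open>The McVittie metric\<close>

definition kappa :: "real \<Rightarrow> (real \<Rightarrow> real) \<Rightarrow> real \<Rightarrow> real \<Rightarrow> real" where
  "kappa M a t r = 1 - 2 * M / r + r\<^sup>2 / (a t)\<^sup>2"

definition r1 :: "real \<Rightarrow> (real \<Rightarrow> real) \<Rightarrow> real \<Rightarrow> real" where
  "r1 M a t = (THE r. 0 < r \<and> kappa M a t r = 0)"

definition Omega :: "real \<Rightarrow> ereal \<Rightarrow> (real \<Rightarrow> real) \<Rightarrow> (real \<times> real) set" where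
  "Omega M tf a = {(t, r). t \<in> time_domain tf \<and> r1 M a t < r}"

definition boundary_kappa_zero :: "real \<Rightarrow> ereal \<Rightarrow> (real \<Rightarrow> real) \<Rightarrow> (real \<times> real) set" where
  "boundary_kappa_zero M tf a = {(t, r). r = r1 M a t \<and> t \<in> time_domain tf}"

definition origin_set :: "(real \<times> real) set" where
  "origin_set = {(t, r). t = 0 \<and> r = 0}"

text \<open>
  \<open>sigma_over_H\<close> is the quotient \<open>\<sigma> / H\<close>, which extends regularly to zeros of \<open>H\<close>; so the
  metric is written without dividing by \<open>H\<close>.
\<close>

definition sigma_over_H :: "real \<Rightarrow> (real \<Rightarrow> real) \<Rightarrow> real \<Rightarrow> real \<Rightarrow> real" where
  "sigma_over_H M a t r =
     sqrt (kappa M a t r) / (a t)\<^sup>2 *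
     integral {r..} (\<lambda>x. x * kappa M a t x powr (- 3 / 2))"

definition sigma :: "real \<Rightarrow> (real \<Rightarrow> real) \<Rightarrow> real \<Rightarrow> real \<Rightarrow> real" where
  "sigma M a t r = hubble a t * sigma_over_H M a t r"

text \<open>
  Coordinates \<open>1, 2, 3, 4\<close> are \<open>t, r, \<theta>, \<phi>\<close>, with \<open>d\<omega>\<^sup>2 = d\<theta>\<^sup>2 + sin\<^sup>2 \<theta> d\<phi>\<^sup>2\<close>. In the \<open>tt\<close> entry,
  \<open>\<sigma>\<^sup>2 (H\<^sup>-\<^sup>2 - r\<^sup>2 / \<kappa>)\<close> is expanded as \<open>(\<sigma> / H)\<^sup>2 - \<sigma>\<^sup>2 r\<^sup>2 / \<kappa>\<close>.
\<close>

definition mcvittie_metric :: "real \<Rightarrow> (real \<Rightarrow> real) \<Rightarrow> real^4 \<Rightarrow> real^4^4" where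
  "mcvittie_metric M a x =
     (let t = x $ 1; r = x $ 2; \<theta> = x $ 3;
          \<kappa> = kappa M a t r; \<sigma> = sigma M a t r
      in \<chi> i j.
        if i = 1 \<and> j = 1 then - ((sigma_over_H M a t r)\<^sup>2 - \<sigma>\<^sup>2 * r\<^sup>2 / \<kappa>)
        else if (i = 1 \<and> j = 2) \<or> (i = 2 \<and> j = 1) then - \<sigma> * r / \<kappa>
        else if i = 2 \<and> j = 2 then 1 / \<kappa>
        else if i = 3 \<and> j = 3 then r\<^sup>2
        else if i = 4 \<and> j = 4 then r\<^sup>2 * (sin \<theta>)\<^sup>2
        else 0)"


section \<open>Affinely parametrised geodesics\<close>

definition partial_deriv :: "'n::finite \<Rightarrow> (real^'n \<Rightarrow> real) \<Rightarrow> real^'n \<Rightarrow> real" where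
  "partial_deriv i f x = deriv (\<lambda>h. f (x + h *\<^sub>R axis i 1)) 0"

definition christoffel ::
  "(real^'n \<Rightarrow> real^'n^'n) \<Rightarrow> real^'n \<Rightarrow> 'n \<Rightarrow> 'n \<Rightarrow> 'n::finite \<Rightarrow> real" where
  "christoffel g x i j k =
     1 / 2 * (\<Sum>l\<in>UNIV. matrix_inv (g x) $ i $ l *
       (partial_deriv j (\<lambda>y. g y $ l $ k) x
        + partial_deriv k (\<lambda>y. g y $ l $ j) x
        - partial_deriv l (\<lambda>y. g y $ j $ k) x))"

definition affine_geodesic ::
  "(real^'n \<Rightarrow> real^'n^'n) \<Rightarrow> real set \<Rightarrow> (real \<Rightarrow> real^'n) \<Rightarrow> (real \<Rightarrow> real^'n::finite) \<Rightarrow> bool"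
  where
  "affine_geodesic g I \<gamma> v \<longleftrightarrow>
     (\<forall>s\<in>I.
        (\<gamma> has_vector_derivative v s) (at s) \<and>
        (v has_vector_derivative
           (\<chi> i. - (\<Sum>j\<in>UNIV. \<Sum>k\<in>UNIV. christoffel g (\<gamma> s) i j k * v s $ j * v s $ k))) (at s))"


section \<open>Radial null geodesics\<close>

abbreviation tr_part :: "real^4 \<Rightarrow> real \<times> real" where
  "tr_part x \<equiv> (x $ 1, x $ 2)"

text \<open>
  The constant point of the sphere is taken in the chart \<open>0 < \<theta> < \<pi>\<close>, which by spherical symmetry
  is no restriction. The condition \<open>v s $ 1 > 0\<close> says that \<open>t\<close> increases with the affine parameter.
\<close>

definition RNG :: "real \<Rightarrow> ereal \<Rightarrow> (real \<Rightarrow> real) \<Rightarrow> real set \<Rightarrow> (real \<Rightarrow> real^4) \<Rightarrow> bool" where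
  "RNG M tf a I \<gamma> \<longleftrightarrow>
     open I \<and> is_interval I \<and> I \<noteq> {} \<and>
     (\<forall>s\<in>I. tr_part (\<gamma> s) \<in> Omega M tf a) \<and>
     (\<exists>\<theta> \<phi>. 0 < \<theta> \<and> \<theta> < pi \<and> (\<forall>s\<in>I. \<gamma> s $ 3 = \<theta> \<and> \<gamma> s $ 4 = \<phi>)) \<and>
     (\<exists>v. affine_geodesic (mcvittie_metric M a) I \<gamma> v \<and>
          (\<forall>s\<in>I. v s \<bullet> (mcvittie_metric M a (\<gamma> s) *v v s) = 0 \<and> 0 < v s $ 1))"

definition maximal_RNG ::
  "real \<Rightarrow> ereal \<Rightarrow> (real \<Rightarrow> real) \<Rightarrow> real set \<Rightarrow> (real \<Rightarrow> real^4) \<Rightarrow> bool" where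
  "maximal_RNG M tf a I \<gamma> \<longleftrightarrow>
     RNG M tf a I \<gamma> \<and>
     \<not> (\<exists>J \<eta>. RNG M tf a J \<eta> \<and> I \<subset> J \<and> (\<forall>s\<in>I. \<eta> s = \<gamma> s))"

end

theory Submission
  imports Defs
begin

text \<open>
  With \<open>S = \<sigma> / H\<close> the radial part of the metric is
  \<open>- S\<^sup>2 dt\<^sup>2 + \<kappa>\<^sup>-\<^sup>1 (dr - r H S dt)\<^sup>2\<close>, so along a radial null geodesic with \<open>\<epsilon> = \<plusminus>1\<close> and
  \<open>E = S t'\<close> the geodesic equations reduce to
  \<open>t' = E / S\<close>, \<open>r' = E (r H + \<epsilon> \<surd>\<kappa>)\<close>, \<open>E' = - (H + \<epsilon> \<surd>\<kappa> \<partial>\<^sub>r ln S) E\<^sup>2\<close>.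
  Put \<open>h = r\<^sup>3 / (r\<^sup>3 + M a\<^sup>2)\<close>, the value of \<open>S\<close> on \<open>\<kappa> = 0\<close>. Then \<open>h \<le> S \<le> 1\<close>, and \<open>(S - h) / \<surd>\<kappa>\<close>
  stays bounded up to \<open>\<kappa> = 0\<close>. Since \<open>\<surd>\<kappa> \<partial>\<^sub>r S\<close> is half the product of this quotient with
  \<open>\<partial>\<^sub>r \<kappa>\<close>, it is nonnegative and bounded as well as long as \<open>t\<close> stays away from \<open>0\<close>.

  Hence \<open>E\<close> is bounded below towards the past: for outgoing rays because \<open>H\<close> is bounded below on
  \<open>(0, t\<^sub>0]\<close>, and for ingoing rays because they never get near \<open>t = 0\<close>. As \<open>t' \<ge> E\<close>, the affine parameter
  is finite. If \<open>t \<rightarrow> 0\<close>, then \<open>r = O(a\<^bsup>1/4\<^esup>)\<close> tends to \<open>0\<close>. Otherwise \<open>r\<close> and \<open>ln E\<close> are Lipschitz in \<open>t\<close> and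
  converge; a limit with \<open>\<kappa> > 0\<close> would contradict maximality, because the equations can be solved
  further back by Picard iteration.
\<close>

section \<open>Calculus on the real line\<close>

text \<open>\<open>E\<close> is the energy of the ray in the orthonormal frame of the displayed form
  of the metric. The obstacle is the degeneration at \<kappa> = 0: written out, the r-derivative of
  ln S carries a factor 1 / \<kappa>, and a ray might spend infinite affine parameter on its way
  there. Only its product with \<surd>\<kappa> is under control. The quotient (S - h) /
  \<surd>\<kappa> comes from an integration by parts: since r / a^2 is half of h times the
  r-derivative of \<kappa>, S / \<surd>\<kappa> equals h / \<surd>\<kappa> plus the integral of h' /
  \<surd>\<kappa> over [r, \<infinity>), where h' is the r-derivative of h. So the quotient is that
  integral; it is positive, and finite up to \<kappa> = 0 because \<kappa> has a simple zero there.
  For ingoing rays near t = 0 the same integral is bounded from below instead: it makes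
  \<surd>\<kappa> shrink so fast towards the past that the ray must leave \<Omega> at a positive
  time. The background is only C^2; the extension is therefore built with t as the independent
  variable, where continuity in t and Lipschitz dependence on r suffice.\<close>

lemma has_real_derivative_if_tendsto:
  fixes f f' :: "real \<Rightarrow> real"
  assumes "isCont f x"
    and "\<forall>\<^sub>F y in at x. (f has_real_derivative f' y) (at y)"
    and "(f' \<longlongrightarrow> l) (at x)"
  shows "(f has_real_derivative l) (at x)"
  unfolding has_field_derivative_iff
proof (rule lhopital[where f = "\<lambda>y. f y - f x" and g = "\<lambda>y. y - x" and f' = f' and g' = "\<lambda>_. 1"])
  show "((\<lambda>y. f y - f x) \<longlongrightarrow> 0) (at x)"
    using assms(1) by (simp add: isCont_def LIM_zero)
  show "((\<lambda>y. y - x) \<longlongrightarrow> 0) (at x)"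
    by (simp add: LIM_zero)
  show "\<forall>\<^sub>F y in at x. y - x \<noteq> 0" "\<forall>\<^sub>F y in at x. (1::real) \<noteq> 0"
    by (auto simp: eventually_at_filter)
  show "\<forall>\<^sub>F y in at x. ((\<lambda>y. f y - f x) has_real_derivative f' y) (at y)"
    using assms(2) by eventually_elim (auto intro!: derivative_eq_intros)
  show "\<forall>\<^sub>F y in at x. ((\<lambda>y. y - x) has_real_derivative 1) (at y)"
    by (intro always_eventually allI) (auto intro!: derivative_eq_intros)
  show "((\<lambda>y. f' y / 1) \<longlongrightarrow> l) (at x)"
    using assms(3) by simp
qed

text \<open>If \<open>f a > B\<close>, then before the first point \<open>Inf S\<close> at which
  \<open>f\<close> is at most \<open>B\<close> the function lies above the barrier, hence is
  nondecreasing, so \<open>f a \<le> f (Inf S) \<le> B\<close>. The sign of \<open>f'\<close> is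
  demanded only above the barrier, which is all that is known for \<open>ln Y\<close> along ingoing
  rays.\<close>

lemma backward_barrier:
  fixes f f' :: "real \<Rightarrow> real"
  assumes "a \<le> b"
    and der: "\<And>x. x \<in> {a..b} \<Longrightarrow> (f has_real_derivative f' x) (at x)"
    and nonneg: "\<And>x. x \<in> {a..b} \<Longrightarrow> B \<le> f x \<Longrightarrow> 0 \<le> f' x"
    and "f b \<le> B"
  shows "f a \<le> B"
proof (rule ccontr)
  assume fa: "\<not> f a \<le> B"
  have cont: "continuous_on {a..b} f"
    using der has_field_derivative_at_within by (intro DERIV_continuous_on[where D = f']) blast
  define S where "S = {a..b} \<inter> f -` {..B}"
  have "closed S"
    unfolding S_def by (intro continuous_closed_preimage cont) auto
  moreover have "S \<noteq> {}" "bdd_below S"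
    using assms by (auto simp: S_def)
  ultimately have c: "Inf S \<in> S"
    by (rule closed_contains_Inf[rotated 2])
  have above: "B \<le> f x" if "a < x" "x < Inf S" for x
  proof (rule ccontr)
    assume "\<not> B \<le> f x"
    then have "x \<in> S"
      using that c by (auto simp: S_def)
    then show False
      using cInf_lower[OF _ \<open>bdd_below S\<close>] that by fastforce
  qed
  have "f a \<le> f (Inf S)"
  proof (rule DERIV_nonneg_imp_increasing_open[where f = f])
    show "a \<le> Inf S"
      using c by (auto simp: S_def)
    show "continuous_on {a..Inf S} f"
      by (rule continuous_on_subset[OF cont]) (use c in \<open>auto simp: S_def\<close>)
    fix x assume x: "a < x" "x < Inf S"
    then have "x \<in> {a..b}"
      using c by (auto simp: S_def)
    then show "\<exists>y. DERIV f x :> y \<and> 0 \<le> y"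
      using der[of x] nonneg[of x] above[OF x] by blast
  qed
  then show False
    using c fa by (auto simp: S_def)
qed

lemma mono_tendsto_at_right:
  fixes f :: "real \<Rightarrow> real"
  assumes "l < b"
    and mono: "\<And>x y. l < x \<Longrightarrow> x \<le> y \<Longrightarrow> y \<le> b \<Longrightarrow> f x \<le> f y"
    and bdd: "\<And>x. l < x \<Longrightarrow> x \<le> b \<Longrightarrow> B \<le> f x"
  shows "(f \<longlongrightarrow> Inf (f ` {l<..b})) (at_right l)"
proof (rule decreasing_tendsto)
  have bb: "bdd_below (f ` {l<..b})"
    using bdd by (intro bdd_belowI[of _ B]) auto
  have ev: "\<forall>\<^sub>F x in at_right l. x \<in> {l<..c}" if "l < c" for c
    using eventually_at_right_field[of _ l] that by (auto intro!: exI[of _ c])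
  show "\<forall>\<^sub>F x in at_right l. Inf (f ` {l<..b}) \<le> f x"
    using ev[OF \<open>l < b\<close>] by eventually_elim (auto intro!: cInf_lower bb)
  fix x assume "Inf (f ` {l<..b}) < x"
  then obtain y where y: "l < y" "y \<le> b" "f y < x"
    using cInf_lessD[of "f ` {l<..b}" x] \<open>l < b\<close> by auto
  show "\<forall>\<^sub>F n in at_right l. f n < x"
    using ev[OF \<open>l < y\<close>]
  proof eventually_elim
    case (elim z)
    then show ?case using mono[of z y] y by auto
  qed
qed

lemma mono_from_derivative:
  fixes f f' :: "real \<Rightarrow> real"
  assumes "\<And>x. x \<in> A \<Longrightarrow> (f has_real_derivative f' x) (at x)"
    and "\<And>x. x \<in> A \<Longrightarrow> 0 \<le> f' x"
    and "is_interval A" "x \<in> A" "y \<in> A" "x \<le> y"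
  shows "f x \<le> f y"
proof -
  have "{x..y} \<subseteq> A"
    using mem_is_interval_1_I[OF assms(3-5)] by auto
  show ?thesis
  proof (rule DERIV_nonneg_imp_nondecreasing[of x y f])
    fix z assume "x \<le> z" "z \<le> y"
    then have "z \<in> A"
      using \<open>{x..y} \<subseteq> A\<close> by auto
    then show "\<exists>l. DERIV f z :> l \<and> 0 \<le> l"
      using assms(1,2) by blast
  qed fact
qed

text \<open>\<open>C * t + f\<close> and \<open>C * t - f\<close> are both nondecreasing, so a limit
  of \<open>f\<close> follows from that of \<open>t\<close> without integrating \<open>f'\<close>.
  It is used for r and ln E, which are Lipschitz in t although nothing is yet known about their
  derivatives at the end point.\<close>

lemma tendsto_if_dominated_derivative:
  fixes f f' t t' :: "real \<Rightarrow> real"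
  assumes "l < b"
    and f: "\<And>s. s \<in> {l<..b} \<Longrightarrow> (f has_real_derivative f' s) (at s)"
    and t: "\<And>s. s \<in> {l<..b} \<Longrightarrow> (t has_real_derivative t' s) (at s)"
    and le: "\<And>s. s \<in> {l<..b} \<Longrightarrow> \<bar>f' s\<bar> \<le> C * t' s"
    and lim: "(t \<longlongrightarrow> tlim) (at_right l)"
    and bdd: "\<And>s. s \<in> {l<..b} \<Longrightarrow> B \<le> t s"
    and C: "0 \<le> C"
  shows "\<exists>L. (f \<longlongrightarrow> L) (at_right l)"
proof -
  define F where "F = (\<lambda>s. f s + C * t s)"
  define G where "G = (\<lambda>s. C * t s - f s)"
  have F: "F x \<le> F y" if "l < x" "x \<le> y" "y \<le> b" for x y
  proof (rule mono_from_derivative[where A = "{l<..b}" and f = F and f' = "\<lambda>s. f' s + C * t' s"])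
    show "(F has_real_derivative f' s + C * t' s) (at s)" if "s \<in> {l<..b}" for s
      unfolding F_def using f[OF that] t[OF that] by (auto intro!: derivative_eq_intros)
    show "0 \<le> f' s + C * t' s" if "s \<in> {l<..b}" for s
      using le[OF that] by linarith
  qed (use that in \<open>auto simp: is_interval_1\<close>)
  have G: "G x \<le> G y" if "l < x" "x \<le> y" "y \<le> b" for x y
  proof (rule mono_from_derivative[where A = "{l<..b}" and f = G and f' = "\<lambda>s. C * t' s - f' s"])
    show "(G has_real_derivative C * t' s - f' s) (at s)" if "s \<in> {l<..b}" for s
      unfolding G_def using f[OF that] t[OF that] by (auto intro!: derivative_eq_intros)
    show "0 \<le> C * t' s - f' s" if "s \<in> {l<..b}" for s
      using le[OF that] by linarith
  qed (use that in \<open>auto simp: is_interval_1\<close>)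
  \<comment> \<open>\<open>F + G = 2 * C * t\<close>, so the upper bound \<open>G b\<close> of the
    nondecreasing \<open>G\<close> is a lower bound for \<open>F\<close>.\<close>
  have "2 * (C * B) - G b \<le> F x" if "l < x" "x \<le> b" for x
    using G[of x b] bdd[of x] mult_left_mono[OF bdd C, of x] that by (auto simp: G_def F_def)
  then have "(F \<longlongrightarrow> Inf (F ` {l<..b})) (at_right l)"
    by (intro mono_tendsto_at_right[OF \<open>l < b\<close> F]) auto
  from tendsto_diff[OF this tendsto_mult[OF tendsto_const[of C] lim]]
  show ?thesis
    by (auto simp: F_def)
qed

text \<open>Banach's fixed point theorem for the integral equation with the value prescribed at the
  right end \<open>d\<close>, since solutions are continued into the past. The Lipschitz condition
  is global in x; the application reaches it by clamping r.\<close>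

lemma picard_terminal_value:
  fixes F :: "real \<Rightarrow> real \<Rightarrow> real"
  assumes "c \<le> d"
    and cont: "continuous_on ({c..d} \<times> UNIV) (\<lambda>(t, x). F t x)"
    and lip: "\<And>t x y. t \<in> {c..d} \<Longrightarrow> \<bar>F t x - F t y\<bar> \<le> L * \<bar>x - y\<bar>"
    and L: "0 \<le> L" "L * (d - c) < 1"
  obtains R where "R d = x0"
    and "\<And>t. t \<in> {c..d} \<Longrightarrow> (R has_real_derivative F t (R t)) (at t within {c..d})"
proof -
  \<comment> \<open>The complete space at hand is that of bounded continuous functions on the whole
    line. Clamping the time makes every iterate constant outside \<open>{c..d}\<close>, hence
    bounded.\<close>
  define cl where "cl t = max c (min d t)" for t
  have cl: "cl t \<in> {c..d}" for t
    using \<open>c \<le> d\<close> by (auto simp: cl_def)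
  have Fg: "continuous_on {c..d} (\<lambda>\<tau>. F \<tau> (g \<tau>))" if "continuous_on {c..d} g" for g
  proof -
    have "continuous_on {c..d} (\<lambda>\<tau>. (\<tau>, g \<tau>))"
      using that by (intro continuous_intros)
    from continuous_on_compose2[OF cont this] show ?thesis
      by auto
  qed
  define T where "T g t = x0 - integral {cl t..d} (\<lambda>\<tau>. F \<tau> (g \<tau>))" for g t
  have contT: "continuous_on UNIV (T g)" if g: "continuous_on {c..d} g" for g
  proof -
    have "continuous_on {c..d} (\<lambda>s. integral {s..d} (\<lambda>\<tau>. F \<tau> (g \<tau>)))"
      by (intro indefinite_integral_continuous_1' integrable_continuous_real Fg g)
    then have "continuous_on UNIV (\<lambda>t. integral {cl t..d} (\<lambda>\<tau>. F \<tau> (g \<tau>)))"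
      
    proof (rule continuous_on_compose2)
      show "continuous_on UNIV cl"
        unfolding cl_def by (intro continuous_intros)
    qed (use cl in auto)
    then show ?thesis
      unfolding T_def by (intro continuous_intros)
  qed
  have "T (apply_bcontfun g) \<in> bcontfun" for g :: "real \<Rightarrow>\<^sub>C real"
  proof -
    have g: "continuous_on {c..d} (apply_bcontfun g)"
      by simp
    have "T (apply_bcontfun g) t = T (apply_bcontfun g) (cl t)" for t
      using \<open>c \<le> d\<close> by (simp add: T_def cl_def)
    then have "T (apply_bcontfun g) ` UNIV \<subseteq> T (apply_bcontfun g) ` {c..d}"
      using cl by blast
    moreover have "compact (T (apply_bcontfun g) ` {c..d})"
      by (intro compact_continuous_image continuous_on_subset[OF contT[OF g]]) auto
    ultimately have "bounded (range (T (apply_bcontfun g)))"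
      using bounded_subset compact_imp_bounded by blast
    then show ?thesis
      using contT[OF g] by (auto simp: bcontfun_def)
  qed
  then have app: "apply_bcontfun (Bcontfun (T (apply_bcontfun g))) = T (apply_bcontfun g)"
    for g :: "real \<Rightarrow>\<^sub>C real"
    by (simp add: Bcontfun_inverse)
  have "\<exists>!g. Bcontfun (T (apply_bcontfun g)) = g"
  proof (rule banach_fix_type)
    show "0 \<le> L * (d - c)" "L * (d - c) < 1"
      using L \<open>c \<le> d\<close> by auto
    show "\<forall>g h. dist (Bcontfun (T (apply_bcontfun g))) (Bcontfun (T (apply_bcontfun h)))
        \<le> L * (d - c) * dist g h"
    proof (intro allI dist_bound)
      fix g h :: "real \<Rightarrow>\<^sub>C real" and t
      have "dist (T g t) (T h t)
        = \<bar>integral {cl t..d} (\<lambda>\<tau>. F \<tau> (g \<tau>)) - integral {cl t..d} (\<lambda>\<tau>. F \<tau> (h \<tau>))\<bar>"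
        by (simp add: T_def dist_real_def)
      also have "\<dots> = \<bar>integral {cl t..d} (\<lambda>\<tau>. F \<tau> (g \<tau>) - F \<tau> (h \<tau>))\<bar>"
        by (subst integral_diff)
          (use cl[of t] in \<open>auto intro!: integrable_continuous_real continuous_on_subset[OF Fg]\<close>)
      also have "\<dots> \<le> (L * dist g h) * (d - cl t)"
      proof (rule integral_bound[where f = "\<lambda>\<tau>. F \<tau> (g \<tau>) - F \<tau> (h \<tau>)",
            unfolded real_norm_def])
        show "cl t \<le> d" using cl by auto
        show "continuous_on {cl t..d} (\<lambda>\<tau>. F \<tau> (g \<tau>) - F \<tau> (h \<tau>))"
          using cl[of t] by (intro continuous_intros continuous_on_subset[OF Fg]) auto
        fix \<tau> assume "\<tau> \<in> {cl t..d}"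
        then have "\<bar>F \<tau> (g \<tau>) - F \<tau> (h \<tau>)\<bar> \<le> L * \<bar>g \<tau> - h \<tau>\<bar>"
          using cl[of t] by (intro lip) auto
        also have "\<dots> \<le> L * dist g h"
          using dist_bounded[of g \<tau> h] L(1) by (intro mult_left_mono) (auto simp: dist_real_def)
        finally show "\<bar>F \<tau> (g \<tau>) - F \<tau> (h \<tau>)\<bar> \<le> L * dist g h" .
      qed
      also have "\<dots> \<le> (L * dist g h) * (d - c)"
        using cl[of t] L(1) by (intro mult_left_mono) auto
      finally show "dist (apply_bcontfun (Bcontfun (T g)) t) (apply_bcontfun (Bcontfun (T h)) t)
          \<le> L * (d - c) * dist g h"
        by (simp add: app algebra_simps)
    qed
  qed
  then obtain g :: "real \<Rightarrow>\<^sub>C real" where "Bcontfun (T g) = g"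
    by blast
  then have fix_g: "T g t = g t" for t
    using app by metis
  have g: "continuous_on {c..d} g"
    by simp
  have eq: "g t = x0 - integral {t..d} (\<lambda>\<tau>. F \<tau> (g \<tau>))" if "t \<in> {c..d}" for t
    using fix_g[of t] that by (auto simp: T_def cl_def max_def min_def split: if_splits)
  show ?thesis
  proof (rule that[of g])
    show "g d = x0"
      using eq[of d] \<open>c \<le> d\<close> by auto
    fix t assume t: "t \<in> {c..d}"
    have "((\<lambda>t. x0 - integral {t..d} (\<lambda>\<tau>. F \<tau> (g \<tau>))) has_real_derivative F t (g t))
        (at t within {c..d})"
      using integral_has_real_derivative'[OF Fg[OF g] t] by (auto intro!: derivative_eq_intros)
    then show "(g has_real_derivative F t (g t)) (at t within {c..d})"
      by (rule has_field_derivative_transform_within[OF _ zero_less_one t]) (simp add: eq)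
  qed
qed

text \<open>Turns the affine parameter as a function of t into t as a function of the affine
  parameter.\<close>

lemma increasing_inverse:
  fixes f f' :: "real \<Rightarrow> real"
  assumes "c < d"
    and f: "\<And>t. t \<in> {c..d} \<Longrightarrow> (f has_real_derivative f' t) (at t within {c..d})"
    and pos: "\<And>t. t \<in> {c..d} \<Longrightarrow> 0 < f' t"
  obtains g where "f c < f d" "g (f d) = d" "continuous_on {f c..f d} g"
    and "\<And>s. s \<in> {f c<..<f d} \<Longrightarrow> g s \<in> {c<..<d}"
    and "\<And>s. s \<in> {f c<..<f d} \<Longrightarrow> (g has_real_derivative 1 / f' (g s)) (at s)"
proof -
  have cont: "continuous_on {c..d} f"
    by (rule DERIV_continuous_on[OF f])
  have at: "(f has_real_derivative f' t) (at t)" if "t \<in> {c<..<d}" for t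
    using f[of t] that by (auto simp: at_within_Icc_at)
  have mono: "f x < f y" if "x \<in> {c..d}" "y \<in> {c..d}" "x < y" for x y
  proof (rule DERIV_pos_imp_increasing_open[OF \<open>x < y\<close>])
    show "\<exists>y. DERIV f z :> y \<and> 0 < y" if "x < z" "z < y" for z
      using \<open>x \<in> {c..d}\<close> \<open>y \<in> {c..d}\<close> that by (intro exI[of _ "f' z"] conjI at pos) auto
    show "continuous_on {x..y} f"
      using that by (intro continuous_on_subset[OF cont]) auto
  qed
  have inj: "inj_on f {c..d}"
    proof (rule inj_onI, rule ccontr)
    fix x y assume "x \<in> {c..d}" "y \<in> {c..d}" "f x = f y" "x \<noteq> y"
    then show False
      using mono[of x y] mono[of y x] by (cases "x < y") auto
  qed
  define g where "g = the_inv_into {c..d} f"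
  have img: "f ` {c..d} = {f c..f d}"
  proof
    show "f ` {c..d} \<subseteq> {f c..f d}"
      proof
      fix y assume "y \<in> f ` {c..d}"
      then obtain x where "x \<in> {c..d}" "y = f x"
        by auto
      then show "y \<in> {f c..f d}"
        using mono[of c x] mono[of x d] \<open>c < d\<close> by (cases "x = c"; cases "x = d") auto
    qed
    show "{f c..f d} \<subseteq> f ` {c..d}"
      proof
      fix y assume "y \<in> {f c..f d}"
      then obtain x where "c \<le> x" "x \<le> d" "f x = y"
        using IVT'[of f c y d] cont \<open>c < d\<close> by auto
      then show "y \<in> f ` {c..d}"
        by auto
    qed
  qed
  have gf: "g (f t) = t" if "t \<in> {c..d}" for t
    using that inj by (simp add: g_def the_inv_into_f_f)
  have fg: "f (g s) = s" "g s \<in> {c..d}" if "s \<in> {f c..f d}" for s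
    using that img f_the_inv_into_f[OF inj] the_inv_into_into[OF inj, of s "{c..d}"]
    by (auto simp: g_def)
  have contg: "continuous_on {f c..f d} g"
    using continuous_on_inv[OF cont, of g] gf by (auto simp: img)
  have int: "g s \<in> {c<..<d}" if "s \<in> {f c<..<f d}" for s
  proof -
    have "g s \<noteq> c" "g s \<noteq> d"
      using fg(1)[of s] that by auto
    then show ?thesis
      using fg(2)[of s] that by auto
  qed
  show ?thesis
  proof
    show "f c < f d" "g (f d) = d" using mono gf \<open>c < d\<close> by auto
    fix s assume s: "s \<in> {f c<..<f d}"
    have "(g has_real_derivative inverse (f' (g s))) (at s)"
    proof (rule DERIV_inverse_function[where f = f and a = "f c" and b = "f d"])
      show "(f has_real_derivative f' (g s)) (at (g s))"
        by (rule at[OF int[OF s]])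
      show "f' (g s) \<noteq> 0"
        using pos[of "g s"] int[OF s] by auto
      show "isCont g s"
        using continuous_on_interior[OF contg] s by auto
    qed (use s fg in auto)
    then show "(g has_real_derivative 1 / f' (g s)) (at s)"
      by (simp add: inverse_eq_divide)
  qed (use contg int in auto)
qed

section \<open>The radial profile of \<open>\<kappa>\<close> and \<open>\<sigma> / H\<close>\<close>

lemma kappa_has_derivative_r:
  assumes "0 < r"
  shows "(kappa M a t has_real_derivative 2 * M / r\<^sup>2 + 2 * r / (a t)\<^sup>2) (at r)"
proof -
  have "((\<lambda>r. 1 - 2 * M * inverse r + c * r\<^sup>2) has_real_derivative
      2 * M / r\<^sup>2 + 2 * r * c) (at r)" for c
    using assms
    by (auto intro!: derivative_eq_intros simp: power2_eq_square inverse_eq_divide)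
  from this[of "1 / (a t)\<^sup>2"] show ?thesis
    by (simp add: kappa_def[abs_def] inverse_eq_divide)
qed

lemma kappa_strict_mono:
  assumes "0 < M" "0 < x" "x < y"
  shows "kappa M a t x < kappa M a t y"
proof -
  have "2 * M / y < 2 * M / x"
    using assms by (simp add: divide_strict_left_mono)
  moreover have "x\<^sup>2 / (a t)\<^sup>2 \<le> y\<^sup>2 / (a t)\<^sup>2"
    using assms by (intro divide_right_mono power_mono) auto
  ultimately show ?thesis
    by (simp add: kappa_def)
qed

lemma r1_root:
  assumes "0 < M" "0 < a t"
  shows "0 < r1 M a t" "kappa M a t (r1 M a t) = 0"
proof -
  \<comment> \<open>At \<open>?x\<close> the three terms of \<kappa> give at most 1 - 2 + 1, and at
    \<open>2 * M\<close> the first two cancel.\<close>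
  let ?x = "min M (a t)"
  have "2 \<le> 2 * M / ?x"
    using assms by (simp add: field_simps)
  moreover have "?x\<^sup>2 / (a t)\<^sup>2 \<le> 1"
    using assms by (simp add: power_mono)
  ultimately have "kappa M a t ?x \<le> 0"
    by (simp add: kappa_def)
  moreover have "0 \<le> kappa M a t (2 * M)"
    using assms by (simp add: kappa_def)
  moreover have "continuous_on {?x..2 * M} (kappa M a t)"
  proof (rule DERIV_continuous_on)
    fix x assume "x \<in> {?x..2 * M}"
    then show "(kappa M a t has_real_derivative 2 * M / x\<^sup>2 + 2 * x / (a t)\<^sup>2)
        (at x within {?x..2 * M})"
      using assms by (intro has_field_derivative_at_within[OF kappa_has_derivative_r]) auto
  qed
  moreover have "?x \<le> 2 * M"
    using assms by simp
  ultimately obtain x where x: "?x \<le> x" "kappa M a t x = 0"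
    using IVT'[of "kappa M a t" ?x 0 "2 * M"] by blast
  have "0 < ?x"
    using assms by simp
  then have "0 < x"
    using x(1) by linarith
  have ex: "\<exists>!r. 0 < r \<and> kappa M a t r = 0"
  proof (rule ex1I)
    show "0 < x \<and> kappa M a t x = 0"
      using \<open>0 < x\<close> x by blast
    fix y assume y: "0 < y \<and> kappa M a t y = 0"
    show "y = x"
      using kappa_strict_mono[OF \<open>0 < M\<close>, of y x a t] kappa_strict_mono[OF \<open>0 < M\<close>, of x y a t]
        x(2) y \<open>0 < x\<close> by (cases y x rule: linorder_cases) auto
  qed
  show "0 < r1 M a t" "kappa M a t (r1 M a t) = 0"
    unfolding r1_def using theI'[OF ex] by blast+
qed

lemma kappa_sign:
  assumes "0 < M" "0 < a t" "0 < r"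
  shows "0 < kappa M a t r \<longleftrightarrow> r1 M a t < r" "kappa M a t r = 0 \<longleftrightarrow> r = r1 M a t"
proof -
  have "kappa M a t r < 0" if "r < r1 M a t"
    using kappa_strict_mono[OF \<open>0 < M\<close> \<open>0 < r\<close> that, of a t] r1_root(2)[of M a t] assms by simp
  moreover have "0 < kappa M a t r" if "r1 M a t < r"
    using kappa_strict_mono[OF \<open>0 < M\<close> r1_root(1) that, of a t] r1_root(2)[of M a t] assms by simp
  ultimately show "0 < kappa M a t r \<longleftrightarrow> r1 M a t < r" "kappa M a t r = 0 \<longleftrightarrow> r = r1 M a t"
    using r1_root(2)[of M a t] assms by (metis less_asym less_irrefl linorder_neqE)+
qed

text \<open>Eliminates the definite description \<open>r1\<close>: from here on the domain is
  described by the sign of \<kappa>.\<close>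

lemma Omega_iff:
  assumes "0 < M" "\<And>t. t \<in> time_domain tf \<Longrightarrow> 0 < a t"
  shows "(t, r) \<in> Omega M tf a \<longleftrightarrow> t \<in> time_domain tf \<and> 0 < r \<and> 0 < kappa M a t r"
proof -
  have "r1 M a t < r \<longleftrightarrow> 0 < r \<and> 0 < kappa M a t r" if "t \<in> time_domain tf"
    using kappa_sign(1)[of M a t r] r1_root(1)[of M a t] assms(1) assms(2)[OF that]
    by (metis less_trans)
  then show ?thesis
    by (auto simp: Omega_def)
qed

section \<open>The integral in \<sigma> as an integral over a compact interval\<close>

text \<open>
  Substituting \<open>x = 1 / w\<close>, with \<open>\<kappa> = rad / w\<^sup>2\<close>, turns the improper integral in \<open>\<sigma>\<close> into one over the
  compact interval \<open>[0, 1 / r]\<close> with a smooth integrand.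
\<close>

definition rad :: "real \<Rightarrow> real \<Rightarrow> real \<Rightarrow> real" where
  "rad M b w = w\<^sup>2 - 2 * M * w ^ 3 + b"

definition radint :: "real \<Rightarrow> real \<Rightarrow> real \<Rightarrow> real" where
  "radint M b w = integral {0..w} (\<lambda>x. 1 / (rad M b x * sqrt (rad M b x)))"

text \<open>For \<open>2 * M * x \<le> 1\<close> the cubic part is nonnegative and
  \<open>rad\<close> is at least \<open>b\<close>; beyond that \<open>rad\<close> is decreasing. So
  \<kappa> > 0 at r = 1 / w keeps the integrand of \<open>radint\<close> regular on all of
  \<open>{0..w}\<close>.\<close>

lemma rad_pos:
  assumes "0 < M" "0 < b" "0 < rad M b w" "0 \<le> x" "x \<le> w"
  shows "0 < rad M b x"
proof (cases "2 * M * x \<le> 1")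
  case True
  then have "0 \<le> x\<^sup>2 * (1 - 2 * M * x)"
    by simp
  then show ?thesis
    using \<open>0 < b\<close> by (simp add: rad_def power2_eq_square power3_eq_cube algebra_simps)
next
  case False
  have "x\<^sup>2 * (2 * M * x - 1) \<le> w\<^sup>2 * (2 * M * w - 1)"
    using False assms by (intro mult_mono power_mono) auto
  then show ?thesis
    using \<open>0 < rad M b w\<close> by (simp add: rad_def power2_eq_square power3_eq_cube algebra_simps)
qed

lemma kappa_eq_rad:
  assumes "0 < r"
  shows "kappa M a t r = r\<^sup>2 * rad M (1 / (a t)\<^sup>2) (1 / r)"
proof -
  have "r\<^sup>2 * (1 / r)\<^sup>2 = 1" "r\<^sup>2 * (2 * M * (1 / r) ^ 3) = 2 * M / r"
    using assms by (simp_all add: power2_eq_square power3_eq_cube)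
  then show ?thesis
    by (simp add: kappa_def rad_def distrib_left right_diff_distrib)
qed

lemma continuous_on_radint_integrand:
  assumes "0 < M" "0 < b" "0 < rad M b w"
  shows "continuous_on {0..w} (\<lambda>x. 1 / (rad M b x * sqrt (rad M b x)))"
proof -
  have "rad M b x \<noteq> 0" if "x \<in> {0..w}" for x
    using rad_pos[OF assms, of x] that by auto
  then show ?thesis
    unfolding rad_def by (intro continuous_intros) auto
qed

lemma rad_pos_right:
  assumes "0 < rad M b w"
  obtains w' where "w < w'" "0 < rad M b w'"
proof -
  have "isCont (rad M b) w"
    unfolding rad_def by (intro continuous_intros)
  then have "\<forall>\<^sub>F x in at_right w. 0 < rad M b x"
    using assms by (auto simp: isCont_def order_tendsto_iff eventually_at_split)
  then show ?thesis
    using that eventually_happens'[of "at_right w", OF _ eventually_conj[OF _ eventually_at_right_less]]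
    by auto
qed

lemma radint_has_derivative:
  assumes "0 < M" "0 < b" "0 < rad M b w" "0 < w"
  shows "(radint M b has_real_derivative 1 / (rad M b w * sqrt (rad M b w))) (at w)"
proof -
  obtain w' where w': "w < w'" "0 < rad M b w'"
    using rad_pos_right assms(3) .
  have "(radint M b has_real_derivative 1 / (rad M b w * sqrt (rad M b w))) (at w within {0..w'})"
    unfolding radint_def
    using w' assms
    by (intro integral_has_real_derivative continuous_on_radint_integrand) auto
  then show ?thesis
    using w' assms by (simp add: at_within_Icc_at)
qed

text \<open>r = \<infinity> is the regular point w = 0, where \<open>rad\<close> equals
  \<open>b > 0\<close>.\<close>

lemma radint_tendsto_0:
  assumes "0 < M" "0 < b"
  shows "((\<lambda>r. radint M b (1 / r)) \<longlongrightarrow> 0) at_top"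
proof -
  obtain w where w: "0 < w" "0 < rad M b w"
    using rad_pos_right[of M b 0] assms by (auto simp: rad_def)
  have "continuous_on {0..w} (radint M b)"
    unfolding radint_def
    by (intro indefinite_integral_continuous_1 integrable_continuous_real
        continuous_on_radint_integrand assms w)
  then have "(radint M b \<longlongrightarrow> radint M b 0) (at 0 within {0..w})"
    using w by (auto simp: continuous_on_def)
  then have "(radint M b \<longlongrightarrow> 0) (at_right 0)"
    using w by (simp add: radint_def at_within_Icc_at_right)
  moreover have "filterlim (\<lambda>r::real. 1 / r) (at_right 0) at_top"
    using filterlim_inverse_at_right_top by (simp add: inverse_eq_divide)
  ultimately show ?thesis
    by (rule filterlim_compose)
qed

lemma powr_minus_3_2:
  assumes "0 < (x::real)"
  shows "x powr (- 3 / 2) = 1 / (x * sqrt x)"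
proof -
  have "x powr (- 3 / 2) = x powr (- 1 + - (1 / 2))"
    by simp
  also have "\<dots> = 1 / (x * sqrt x)"
    using assms unfolding powr_add by (simp add: powr_minus powr_half_sqrt divide_simps)
  finally show ?thesis .
qed

lemma radint_inverse_has_derivative:
  assumes "0 < M" "0 < a t" "0 < r" "0 < kappa M a t r"
  shows "((\<lambda>r. radint M (1 / (a t)\<^sup>2) (1 / r)) has_real_derivative
    - (r / (kappa M a t r * sqrt (kappa M a t r)))) (at r)"
proof -
  define b where "b = 1 / (a t)\<^sup>2"
  have "0 < b"
    using assms by (simp add: b_def)
  have k: "kappa M a t r = r\<^sup>2 * rad M b (1 / r)"
    using kappa_eq_rad assms by (simp add: b_def)
  then have pos: "0 < rad M b (1 / r)"
    using assms by (simp add: zero_less_mult_iff)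
  have "((\<lambda>r. radint M b (1 / r)) has_real_derivative
    1 / (rad M b (1 / r) * sqrt (rad M b (1 / r))) * - (1 / r\<^sup>2)) (at r)"
    by (rule DERIV_chain2[OF radint_has_derivative])
      (use assms pos \<open>0 < b\<close> in \<open>auto intro!: derivative_eq_intros simp: power2_eq_square\<close>)
  moreover have "1 / (rad M b (1 / r) * sqrt (rad M b (1 / r))) * - (1 / r\<^sup>2) =
      - (r / (kappa M a t r * sqrt (kappa M a t r)))"
    using assms pos unfolding k by (simp add: real_sqrt_mult field_simps power2_eq_square)
  ultimately show ?thesis
    by (simp add: b_def)
qed

text \<open>\<open>integral\<close> has the default value 0 where no integral exists, so existence
  has to be shown. The integrand is nonnegative with antiderivative \<open>- ?J\<close> vanishing at
  infinity; the fundamental theorem for nonnegative Lebesgue integrals gives the value and is then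
  transferred to \<open>has_integral\<close>.\<close>

lemma sigma_over_H_eq:
  assumes "0 < M" "0 < a t" "0 < r" "0 < kappa M a t r"
  shows "sigma_over_H M a t r =
    sqrt (kappa M a t r) / (a t)\<^sup>2 * radint M (1 / (a t)\<^sup>2) (1 / r)"
proof -
  let ?f = "\<lambda>x. x / (kappa M a t x * sqrt (kappa M a t x))"
  let ?J = "\<lambda>r. radint M (1 / (a t)\<^sup>2) (1 / r)"
  have pos: "0 < kappa M a t x" if "r \<le> x" for x
    using kappa_strict_mono[of M r x a t] assms that by (cases "r = x") auto
  have J: "((\<lambda>r. - ?J r) has_real_derivative ?f x) (at x)" if "r \<le> x" for x
    using radint_inverse_has_derivative[of M a t x] assms pos[OF that] that
    by (auto intro!: derivative_eq_intros)
  have "((\<lambda>r. - ?J r) \<longlongrightarrow> - 0) at_top"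
    by (intro tendsto_minus radint_tendsto_0) (use assms in auto)
  then have lim: "((\<lambda>r. - ?J r) \<longlongrightarrow> 0) at_top"
    by simp
  have meas: "?f \<in> borel_measurable borel"
    unfolding kappa_def by measurable
  have nn: "(\<integral>\<^sup>+x. ennreal (?f x) * indicator {r..} x \<partial>lborel) = ennreal (0 - - ?J r)"
    by (rule nn_integral_FTC_atLeast[OF meas J _ lim]) (use pos assms in \<open>auto simp: less_imp_le\<close>)
  have "((\<lambda>x. ?f x * indicator {r..} x) has_integral ?J r) UNIV"
  proof (rule nn_integral_has_integral)
    show "0 \<le> ?f x * indicator {r..} x" for x
      using pos[of x] assms by (auto simp: indicator_def intro!: divide_nonneg_nonneg)
    show "(\<integral>\<^sup>+x. ennreal (?f x * indicator {r..} x) \<partial>lborel) = ennreal (?J r)"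
      unfolding nn[simplified, symmetric] by (intro nn_integral_cong) (auto simp: indicator_def)
    show "0 \<le> ?J r"
      unfolding radint_def
    proof (rule integral_nonneg)
      have p: "0 < rad M (1 / (a t)\<^sup>2) (1 / r)"
        using assms kappa_eq_rad[of r M a t] by (simp add: zero_less_mult_iff)
      show "(\<lambda>x. 1 / (rad M (1 / (a t)\<^sup>2) x * sqrt (rad M (1 / (a t)\<^sup>2) x)))
          integrable_on {0..1 / r}"
        using assms p by (intro integrable_continuous_real continuous_on_radint_integrand) auto
      show "0 \<le> 1 / (rad M (1 / (a t)\<^sup>2) x * sqrt (rad M (1 / (a t)\<^sup>2) x))"
        if "x \<in> {0..1 / r}" for x
        using rad_pos[OF _ _ p, of x] that assms by auto
    qed
  qed (use meas in measurable)
  then have "(?f has_integral ?J r) {r..}"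
    by (subst has_integral_restrict_UNIV[symmetric])
      (auto elim!: has_integral_eq_rhs[rotated] has_integral_eq[rotated] simp: indicator_def)
  then have "((\<lambda>x. x * kappa M a t x powr (- 3 / 2)) has_integral ?J r) {r..}"
  proof (rule has_integral_eq[rotated])
    fix x assume "x \<in> {r..}"
    then have "0 < kappa M a t x"
      using pos by auto
    from powr_minus_3_2[OF this]
    show "x / (kappa M a t x * sqrt (kappa M a t x)) = x * kappa M a t x powr (- 3 / 2)"
      by simp
  qed
  then show ?thesis
    unfolding sigma_over_H_def by (simp add: integral_unique)
qed

section \<open>The quotient (S - h) / \<surd>\<kappa> and its bounds\<close>

definition dkappa :: "real \<Rightarrow> (real \<Rightarrow> real) \<Rightarrow> real \<Rightarrow> real \<Rightarrow> real" where
  "dkappa M a t r = 2 * M / r\<^sup>2 + 2 * r / (a t)\<^sup>2"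

text \<open>\<open>hor\<close> is \<open>2 r / (a\<^sup>2 \<partial>\<^sub>r \<kappa>)\<close>, the limit of \<open>\<sigma> / H\<close> at a zero of \<open>\<kappa>\<close>.\<close>

definition hor :: "real \<Rightarrow> (real \<Rightarrow> real) \<Rightarrow> real \<Rightarrow> real \<Rightarrow> real" where
  "hor M a t r = r ^ 3 / (r ^ 3 + M * (a t)\<^sup>2)"

definition dhor :: "real \<Rightarrow> (real \<Rightarrow> real) \<Rightarrow> real \<Rightarrow> real \<Rightarrow> real" where
  "dhor M a t r = 3 * M * (a t)\<^sup>2 * r\<^sup>2 / (r ^ 3 + M * (a t)\<^sup>2)\<^sup>2"

definition gap :: "real \<Rightarrow> (real \<Rightarrow> real) \<Rightarrow> real \<Rightarrow> real \<Rightarrow> real" where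
  "gap M a t r = (sigma_over_H M a t r - hor M a t r) / sqrt (kappa M a t r)"

text \<open>The logarithmic r-derivative of \<open>sigma_over_H\<close>, with the integral
  re-expressed through \<open>sigma_over_H\<close> itself. The numerator contains a hidden factor
  \<surd>\<kappa>, made explicit in \<open>sqrt_kappa_dlnS\<close>.\<close>

definition dlnS :: "real \<Rightarrow> (real \<Rightarrow> real) \<Rightarrow> real \<Rightarrow> real \<Rightarrow> real" where
  "dlnS M a t r =
    (dkappa M a t r / 2 - r / ((a t)\<^sup>2 * sigma_over_H M a t r)) / kappa M a t r"

lemma nonneg_if_antimono_tendsto_0:
  fixes f f' :: "real \<Rightarrow> real"
  assumes "\<And>x. r \<le> x \<Longrightarrow> (f has_real_derivative f' x) (at x)"
    and "\<And>x. r \<le> x \<Longrightarrow> f' x \<le> 0"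
    and "(f \<longlongrightarrow> 0) at_top"
  shows "0 \<le> f r"
proof (rule tendsto_upperbound[OF assms(3)])
  have "f x \<le> f r" if "r \<le> x" for x
    using that by (rule DERIV_nonpos_imp_nonincreasing) (use assms in blast)
  then show "\<forall>\<^sub>F x in at_top. f x \<le> f r"
    using eventually_ge_at_top[of r] by (rule eventually_mono[rotated])
qed simp

context
  fixes M :: real and a :: "real \<Rightarrow> real" and t :: real
  assumes M: "0 < M" and a: "0 < a t"
begin

lemma kappa_pos_above: "0 < r \<Longrightarrow> 0 < kappa M a t r \<Longrightarrow> r \<le> x \<Longrightarrow> 0 < kappa M a t x"
  using kappa_strict_mono[OF M, of r x a t] by (cases "r = x") auto

lemma dkappa_pos: "0 < r \<Longrightarrow> 0 < dkappa M a t r"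
  using M a by (simp add: dkappa_def add_pos_pos)

lemma hor_denominator_pos: "0 < r \<Longrightarrow> 0 < r ^ 3 + M * (a t)\<^sup>2"
  using M a by (simp add: add_pos_pos)

lemma hor_pos: "0 < r \<Longrightarrow> 0 < hor M a t r"
  using hor_denominator_pos[of r] by (simp add: hor_def)

lemma hor_le_1: "0 < r \<Longrightarrow> hor M a t r \<le> 1"
  using hor_denominator_pos[of r] M by (simp add: hor_def)

lemma dhor_pos: "0 < r \<Longrightarrow> 0 < dhor M a t r"
  using hor_denominator_pos[of r] M a by (simp add: dhor_def)

text \<open>The identity that singles out \<open>hor\<close>: it is what cancels the terms of order
  \<kappa>^(-3/2) in the derivative of \<open>gap\<close>.\<close>

lemma hor_mult_dkappa: "0 < r \<Longrightarrow> hor M a t r * dkappa M a t r = 2 * r / (a t)\<^sup>2"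
proof -
  assume r: "0 < r"
  have "dkappa M a t r = 2 * (r ^ 3 + M * (a t)\<^sup>2) / (r\<^sup>2 * (a t)\<^sup>2)"
    using r a by (simp add: dkappa_def field_simps power2_eq_square power3_eq_cube)
  moreover have "r ^ 3 / q * (2 * q / (r\<^sup>2 * (a t)\<^sup>2)) = 2 * r / (a t)\<^sup>2" if "0 < q" for q
    using that r a by (simp add: power2_eq_square power3_eq_cube)
  ultimately show ?thesis
    using hor_denominator_pos[OF r] unfolding hor_def by metis
qed

lemma hor_has_derivative:
  assumes "0 < r"
  shows "(hor M a t has_real_derivative dhor M a t r) (at r)"
proof -
  have pos: "0 < r ^ 3 + M * (a t)\<^sup>2"
    by (rule hor_denominator_pos) fact
  have "((\<lambda>r. r ^ 3 / (r ^ 3 + M * (a t)\<^sup>2)) has_real_derivative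
    (3 * r\<^sup>2 * (r ^ 3 + M * (a t)\<^sup>2) - r ^ 3 * (3 * r\<^sup>2)) / (r ^ 3 + M * (a t)\<^sup>2)\<^sup>2) (at r)"
    using pos by (auto intro!: derivative_eq_intros simp: power2_eq_square)
  moreover have "3 * r\<^sup>2 * (r ^ 3 + M * (a t)\<^sup>2) - r ^ 3 * (3 * r\<^sup>2) = 3 * M * (a t)\<^sup>2 * r\<^sup>2"
    by (simp add: algebra_simps)
  ultimately show ?thesis
    by (simp add: hor_def[abs_def] dhor_def)
qed

lemma kappa_has_derivative: "0 < r \<Longrightarrow> (kappa M a t has_real_derivative dkappa M a t r) (at r)"
  unfolding dkappa_def by (rule kappa_has_derivative_r)

lemma eventually_kappa_pos:
  assumes "0 < r" "0 < kappa M a t r"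
  shows "\<forall>\<^sub>F x in nhds r. 0 < x \<and> 0 < kappa M a t x"
proof (rule eventually_conj)
  show "\<forall>\<^sub>F x in nhds r. 0 < x"
    using eventually_nhds_in_open[of "{0<..}" r] assms by simp
  have "(kappa M a t \<longlongrightarrow> kappa M a t r) (nhds r)"
    using kappa_has_derivative[OF assms(1), THEN DERIV_isCont]
    by (simp add: isCont_def tendsto_at_iff_tendsto_nhds)
  then show "\<forall>\<^sub>F x in nhds r. 0 < kappa M a t x"
    by (rule order_tendstoD(1)) fact
qed

lemma sqrt_kappa_has_derivative:
  assumes "0 < r" "0 < kappa M a t r"
  shows "((\<lambda>r. sqrt (kappa M a t r)) has_real_derivative
    dkappa M a t r / (2 * sqrt (kappa M a t r))) (at r)"
  using kappa_has_derivative[OF assms(1)] assms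
  by (auto intro!: derivative_eq_intros simp: field_simps)

definition Jr :: "real \<Rightarrow> real" where
  "Jr r = radint M (1 / (a t)\<^sup>2) (1 / r) / (a t)\<^sup>2"

lemma S_eq_Jr: "0 < r \<Longrightarrow> 0 < kappa M a t r \<Longrightarrow> sigma_over_H M a t r = sqrt (kappa M a t r) * Jr r"
  using sigma_over_H_eq[of M a t r, OF M a] by (simp add: Jr_def)

lemma Jr_has_derivative:
  assumes "0 < r" "0 < kappa M a t r"
  shows "(Jr has_real_derivative - (r / ((a t)\<^sup>2 * kappa M a t r * sqrt (kappa M a t r)))) (at r)"
  unfolding Jr_def[abs_def]
  using radint_inverse_has_derivative[OF M a assms] assms a
  by (auto intro!: derivative_eq_intros simp: field_simps)

lemma Jr_tendsto_0: "(Jr \<longlongrightarrow> 0) at_top"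
proof -
  have "((\<lambda>r. radint M (1 / (a t)\<^sup>2) (1 / r) / (a t)\<^sup>2) \<longlongrightarrow> 0 / (a t)\<^sup>2) at_top"
    by (intro tendsto_divide tendsto_const radint_tendsto_0) (use M a in auto)
  then show ?thesis
    by (simp add: Jr_def[abs_def])
qed

lemma sqrt_kappa_ge:
  assumes "2 * M \<le> r"
  shows "r / a t \<le> sqrt (kappa M a t r)"
proof (rule real_le_rsqrt)
  have "0 < r"
    using assms M by linarith
  then show "(r / a t)\<^sup>2 \<le> kappa M a t r"
    using assms by (simp add: kappa_def power_divide)
qed

lemma inverse_sqrt_kappa_tendsto_0: "((\<lambda>r. 1 / sqrt (kappa M a t r)) \<longlongrightarrow> 0) at_top"
proof (rule tendsto_sandwich[OF _ _ tendsto_const])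
  have "1 / sqrt (kappa M a t r) \<le> a t / r \<and> 0 \<le> 1 / sqrt (kappa M a t r)" if "2 * M \<le> r" for r
  proof -
    have "0 < r / a t"
      using that M a by simp
    then have "1 / sqrt (kappa M a t r) \<le> 1 / (r / a t)"
      using sqrt_kappa_ge[OF that] by (intro frac_le) auto
    moreover have "0 \<le> 1 / sqrt (kappa M a t r)"
      using less_le_trans[OF \<open>0 < r / a t\<close> sqrt_kappa_ge[OF that]] by simp
    ultimately show ?thesis
      by simp
  qed
  then show "\<forall>\<^sub>F r in at_top. 1 / sqrt (kappa M a t r) \<le> a t / r"
    "\<forall>\<^sub>F r in at_top. 0 \<le> 1 / sqrt (kappa M a t r)"
    by - (rule eventually_mono[OF eventually_ge_at_top[of "2 * M"]], blast)+
  show "((\<lambda>r. a t / r) \<longlongrightarrow> 0) at_top"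
    by (intro tendsto_divide_0[OF tendsto_const] filterlim_at_top_imp_at_infinity filterlim_ident)
qed

lemma gap_eq_Jr:
  assumes "0 < r" "0 < kappa M a t r"
  shows "gap M a t r = Jr r - hor M a t r / sqrt (kappa M a t r)"
  using assms by (simp add: gap_def S_eq_Jr diff_divide_distrib)

text \<open>The derivative of \<open>Jr\<close> and the one of 1 / \<surd>\<kappa> are both of order
  \<kappa>^(-3/2), and they cancel by \<open>hor_mult_dkappa\<close>. Together with
  \<open>gap_tendsto_0\<close> this says that \<open>gap\<close> is the integral of
  \<open>dhor\<close> / \<surd>\<kappa> from r to infinity.\<close>

lemma gap_has_derivative:
  assumes r: "0 < r" and k: "0 < kappa M a t r"
  shows "(gap M a t has_real_derivative - (dhor M a t r / sqrt (kappa M a t r))) (at r)"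
proof -
  let ?k = "kappa M a t r" and ?h = "hor M a t r"
  have "((\<lambda>r. Jr r - hor M a t r / sqrt (kappa M a t r)) has_real_derivative
    - (r / ((a t)\<^sup>2 * ?k * sqrt ?k))
    - (dhor M a t r * sqrt ?k - ?h * (dkappa M a t r / (2 * sqrt ?k))) / (sqrt ?k * sqrt ?k)) (at r)"
    using k by (intro derivative_intros Jr_has_derivative hor_has_derivative r
        sqrt_kappa_has_derivative) auto
  moreover have "?h * (dkappa M a t r / (2 * sqrt ?k)) = r / (a t)\<^sup>2 / sqrt ?k"
    using hor_mult_dkappa[OF r] by (simp add: mult.commute)
  then have "- (r / ((a t)\<^sup>2 * ?k * sqrt ?k))
    - (dhor M a t r * sqrt ?k - ?h * (dkappa M a t r / (2 * sqrt ?k))) / (sqrt ?k * sqrt ?k)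
    = - (dhor M a t r / sqrt ?k)"
    using k a by (simp add: field_simps)
  ultimately have "((\<lambda>r. Jr r - hor M a t r / sqrt (kappa M a t r)) has_real_derivative
    - (dhor M a t r / sqrt ?k)) (at r)"
    by simp
  moreover have "\<forall>\<^sub>F x in nhds r. gap M a t x = Jr x - hor M a t x / sqrt (kappa M a t x)"
    using eventually_kappa_pos[OF r k] by (rule eventually_mono) (simp add: gap_eq_Jr)
  ultimately show ?thesis
    by (simp add: DERIV_cong_ev[OF refl _ refl])
qed

lemma gap_tendsto_0: "(gap M a t \<longlongrightarrow> 0) at_top"
proof -
  have ev: "\<forall>\<^sub>F r in at_top. 2 * M \<le> r \<and> 0 < r"
    by (intro eventually_conj eventually_ge_at_top eventually_gt_at_top)
  have "((\<lambda>r. hor M a t r / sqrt (kappa M a t r)) \<longlongrightarrow> 0) at_top"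
  proof (rule tendsto_sandwich[OF _ _ tendsto_const inverse_sqrt_kappa_tendsto_0])
    show "\<forall>\<^sub>F r in at_top. 0 \<le> hor M a t r / sqrt (kappa M a t r)"
      "\<forall>\<^sub>F r in at_top. hor M a t r / sqrt (kappa M a t r) \<le> 1 / sqrt (kappa M a t r)"
      using ev by (auto elim!: eventually_mono simp: kappa_def
          intro!: divide_nonneg_nonneg divide_right_mono hor_le_1 less_imp_le[OF hor_pos])
  qed
  from tendsto_diff[OF Jr_tendsto_0 this]
  have "((\<lambda>r. Jr r - hor M a t r / sqrt (kappa M a t r)) \<longlongrightarrow> 0) at_top"
    by simp
  then show ?thesis
  proof (rule Lim_transform_eventually)
    show "\<forall>\<^sub>F r in at_top. Jr r - hor M a t r / sqrt (kappa M a t r) = gap M a t r"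
      using ev
    proof eventually_elim
      case (elim r)
      then have "0 < (r / a t)\<^sup>2" "2 * M / r \<le> 1"
        using a by auto
      then have "0 < kappa M a t r"
        by (simp add: kappa_def power_divide)
      then show ?case
        using elim gap_eq_Jr by simp
    qed
  qed
qed

lemma gap_nonneg:
  assumes "0 < r" "0 < kappa M a t r"
  shows "0 \<le> gap M a t r"
proof (rule nonneg_if_antimono_tendsto_0[where f = "gap M a t" and
      f' = "\<lambda>x. - (dhor M a t x / sqrt (kappa M a t x))", OF _ _ gap_tendsto_0])
  fix x assume "r \<le> x"
  then have x: "0 < x" "0 < kappa M a t x"
    using assms kappa_pos_above by auto
  show "(gap M a t has_real_derivative - (dhor M a t x / sqrt (kappa M a t x))) (at x)"
    by (rule gap_has_derivative[OF x])
  show "- (dhor M a t x / sqrt (kappa M a t x)) \<le> 0"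
    using dhor_pos[OF x(1)] x(2) by simp
qed

lemma hor_le_sigma_over_H:
  assumes "0 < r" "0 < kappa M a t r"
  shows "hor M a t r \<le> sigma_over_H M a t r"
  using gap_nonneg[OF assms] assms by (simp add: gap_def zero_le_divide_iff)

lemma sigma_over_H_pos:
  assumes "0 < r" "0 < kappa M a t r"
  shows "0 < sigma_over_H M a t r"
  using hor_le_sigma_over_H[OF assms] hor_pos[OF assms(1)] by linarith

text \<open>For vanishing mass the integrand would be an exact derivative and S would equal 1. With
  mass, the derivative of 1 / \<surd>\<kappa> - \<open>Jr\<close> retains only the mass term of
  \<open>dkappa\<close>, which has a sign.\<close>

lemma sigma_over_H_le_1:
  assumes "0 < r" "0 < kappa M a t r"
  shows "sigma_over_H M a t r \<le> 1"
proof -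
  let ?f = "\<lambda>r. 1 / sqrt (kappa M a t r) - Jr r"
  have "0 \<le> ?f r"
  proof (rule nonneg_if_antimono_tendsto_0[where f = ?f and
        f' = "\<lambda>x. - (M / x\<^sup>2) / (kappa M a t x * sqrt (kappa M a t x))"])
    show "(?f \<longlongrightarrow> 0) at_top"
      using tendsto_diff[OF inverse_sqrt_kappa_tendsto_0 Jr_tendsto_0] by simp
    fix x assume "r \<le> x"
    then have x: "0 < x" "0 < kappa M a t x"
      using assms kappa_pos_above by auto
    let ?k = "kappa M a t x"
    have "(?f has_real_derivative
        (0 * sqrt ?k - 1 * (dkappa M a t x / (2 * sqrt ?k))) / (sqrt ?k * sqrt ?k)
        - - (x / ((a t)\<^sup>2 * ?k * sqrt ?k))) (at x)"
      using x by (intro derivative_intros Jr_has_derivative sqrt_kappa_has_derivative) auto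
    moreover have "(0 * sqrt ?k - 1 * (dkappa M a t x / (2 * sqrt ?k))) / (sqrt ?k * sqrt ?k)
        - - (x / ((a t)\<^sup>2 * ?k * sqrt ?k)) = - (M / x\<^sup>2) / (?k * sqrt ?k)"
      using x a by (simp add: dkappa_def field_simps)
    ultimately show "(?f has_real_derivative - (M / x\<^sup>2) / (?k * sqrt ?k)) (at x)"
      by simp
    show "- (M / x\<^sup>2) / (?k * sqrt ?k) \<le> 0"
      using x M by (intro divide_nonpos_nonneg) auto
  qed
  then have "Jr r \<le> 1 / sqrt (kappa M a t r)"
    by simp
  then show ?thesis
    using assms by (simp add: S_eq_Jr field_simps)
qed

lemma sigma_over_H_has_derivative_r:
  assumes r: "0 < r" and k: "0 < kappa M a t r"
  shows "(sigma_over_H M a t has_real_derivative sigma_over_H M a t r * dlnS M a t r) (at r)"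
proof -
  let ?k = "kappa M a t r" and ?S = "sigma_over_H M a t r"
  have "((\<lambda>r. sqrt (kappa M a t r) * Jr r) has_real_derivative
      dkappa M a t r / (2 * sqrt ?k) * Jr r + - (r / ((a t)\<^sup>2 * ?k * sqrt ?k)) * sqrt ?k) (at r)"
    by (intro DERIV_mult Jr_has_derivative sqrt_kappa_has_derivative r k)
  moreover have "Jr r = ?S / sqrt ?k"
    using S_eq_Jr[OF r k] k by simp
  moreover have "0 < ?S"
    using sigma_over_H_pos r k .
  then have "dkappa M a t r / (2 * sqrt ?k) * (?S / sqrt ?k) + - (r / ((a t)\<^sup>2 * ?k * sqrt ?k)) * sqrt ?k
      = ?S * dlnS M a t r"
    using k a by (simp add: dlnS_def field_simps)
  ultimately have "((\<lambda>r. sqrt (kappa M a t r) * Jr r) has_real_derivative ?S * dlnS M a t r) (at r)"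
    by simp
  moreover have "\<forall>\<^sub>F x in nhds r. sigma_over_H M a t x = sqrt (kappa M a t x) * Jr x"
    using eventually_kappa_pos[OF r k] by (rule eventually_mono) (simp add: S_eq_Jr)
  ultimately show ?thesis
    by (simp add: DERIV_cong_ev[OF refl _ refl])
qed

text \<open>The combination that enters the energy equation: its apparent singularity at \<kappa> =
  0 is absorbed in \<open>gap\<close>.\<close>

lemma sqrt_kappa_dlnS:
  assumes r: "0 < r" and k: "0 < kappa M a t r"
  shows "sqrt (kappa M a t r) * dlnS M a t r * sigma_over_H M a t r
    = gap M a t r * dkappa M a t r / 2"
proof -
  let ?k = "kappa M a t r" and ?S = "sigma_over_H M a t r"
  have S: "0 < ?S"
    using sigma_over_H_pos r k .
  have "dlnS M a t r * ?S = (?S * dkappa M a t r / 2 - r / (a t)\<^sup>2) / ?k"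
    using S k a by (simp add: dlnS_def field_simps)
  also have "\<dots> = (?S - hor M a t r) * dkappa M a t r / 2 / ?k"
    using hor_mult_dkappa[OF r] by (simp add: left_diff_distrib diff_divide_distrib)
  also have "\<dots> = gap M a t r * dkappa M a t r / 2 / sqrt ?k"
    using k by (simp add: gap_def field_simps)
  finally show ?thesis
    using k by (simp add: mult.assoc)
qed

text \<open>The integrand \<open>dhor\<close> / \<surd>\<kappa> is dominated by \<open>c\<close>
  times the derivative of \<surd>\<kappa>. Hence \<open>gap + c * \<surd>\<kappa>\<close> is
  nondecreasing, and its value at the far radius \<open>X\<close> is easy to bound. The result does
  not deteriorate as \<kappa> tends to 0 at r.\<close>

lemma gap_upper:
  assumes \<rho>: "0 < \<rho>" "\<rho> \<le> r" "r \<le> X" "2 * M \<le> X" and k: "0 < kappa M a t r"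
  shows "gap M a t r \<le> a t / X + 3 * M * (a t) ^ 4 / \<rho> ^ 5 * sqrt (kappa M a t X)"
proof -
  \<comment> \<open>\<open>dhor\<close> is at most 3 M a^2 / x^4, which is 3 M a^4 / x^5 times x /
    a^2, and x / a^2 is at most half of \<open>dkappa\<close>. \<open>c\<close> is the first factor
    at the smallest radius \<open>\<rho>\<close>.\<close>
  define c where "c = 3 * M * (a t) ^ 4 / \<rho> ^ 5"
  have c: "0 \<le> c"
    using \<rho> M a by (simp add: c_def)
  let ?f = "\<lambda>r. gap M a t r + c * sqrt (kappa M a t r)"
  have "?f r \<le> ?f X"
  proof (rule DERIV_nonneg_imp_nondecreasing[OF \<open>r \<le> X\<close>])
    fix x assume x: "r \<le> x" "x \<le> X"
    then have pos: "0 < x" "0 < kappa M a t x"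
      using \<rho> kappa_pos_above[OF _ k] by auto
    let ?k = "kappa M a t x"
    have "dhor M a t x \<le> 3 * M * (a t)\<^sup>2 * x\<^sup>2 / (x ^ 3)\<^sup>2"
      unfolding dhor_def using pos M a hor_denominator_pos[OF pos(1)]
      by (intro divide_left_mono power_mono mult_pos_pos) auto
    also have "\<dots> = 3 * M * (a t) ^ 4 / x ^ 5 * (x / (a t)\<^sup>2)"
      using pos a by (simp add: field_simps eval_nat_numeral)
    also have "\<dots> \<le> c * (x / (a t)\<^sup>2)"
      unfolding c_def using pos M a \<rho> x
      by (intro mult_right_mono divide_left_mono power_mono) auto
    also have "\<dots> \<le> c * (dkappa M a t x / 2)"
      using pos M by (intro mult_left_mono c) (simp add: dkappa_def field_simps)
    finally have le: "dhor M a t x \<le> c * (dkappa M a t x / 2)" .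
    have "(?f has_real_derivative - (dhor M a t x / sqrt ?k) + c * (dkappa M a t x / (2 * sqrt ?k))) (at x)"
      by (intro DERIV_add DERIV_cmult gap_has_derivative sqrt_kappa_has_derivative pos)
    moreover have "- (dhor M a t x / sqrt ?k) + c * (dkappa M a t x / (2 * sqrt ?k))
        = (c * (dkappa M a t x / 2) - dhor M a t x) / sqrt ?k"
      by (simp add: diff_divide_distrib)
    moreover have "0 \<le> (c * (dkappa M a t x / 2) - dhor M a t x) / sqrt ?k"
      using le pos by simp
    ultimately show "\<exists>y. (?f has_real_derivative y) (at x) \<and> 0 \<le> y"
      by metis
  qed
  moreover have "gap M a t X \<le> a t / X"
  proof -
    have X: "0 < X" "0 < kappa M a t X"
      using \<rho> kappa_pos_above[OF _ k] by auto
    have "gap M a t X \<le> 1 / sqrt (kappa M a t X)"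
      unfolding gap_def using sigma_over_H_le_1[OF X] hor_pos[OF X(1)] X
      by (intro divide_right_mono) auto
    also have "\<dots> \<le> 1 / (X / a t)"
      using sqrt_kappa_ge[OF \<open>2 * M \<le> X\<close>] X a by (intro divide_left_mono) auto
    finally show ?thesis
      by simp
  qed
  moreover have "0 \<le> c * sqrt (kappa M a t r)"
    using c k by simp
  ultimately show ?thesis
    unfolding c_def by linarith
qed

text \<open>\<kappa> > 0 reads r + r^3 / a^2 > 2 M. If a < M, then r \<le> a would make both terms
  smaller than M; and r^3 / a^2 \<le> M would force r > M, hence r^3 > M a^2. The second bound means
  \<open>hor > 1 / 2\<close>.\<close>

lemma near_singularity:
  assumes "a t < M" "0 < r" "0 < kappa M a t r"
  shows "a t < r" "M * (a t)\<^sup>2 < r ^ 3"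
proof -
  have *: "2 * M < r + r ^ 3 / (a t)\<^sup>2"
  proof -
    have "r * kappa M a t r = r - 2 * M + r ^ 3 / (a t)\<^sup>2"
      using assms by (simp add: kappa_def distrib_left right_diff_distrib power2_eq_square power3_eq_cube)
    moreover have "0 < r * kappa M a t r"
      using assms by simp
    ultimately show ?thesis
      by simp
  qed
  show "a t < r"
  proof (rule ccontr)
    assume "\<not> a t < r"
    then have "r ^ 3 \<le> (a t) ^ 3"
      using assms by (intro power_mono) auto
    then have "r ^ 3 / (a t)\<^sup>2 \<le> a t"
      using a by (simp add: field_simps power2_eq_square power3_eq_cube)
    then show False
      using * \<open>\<not> a t < r\<close> \<open>a t < M\<close> by linarith
  qed
  show "M * (a t)\<^sup>2 < r ^ 3"
  proof (rule ccontr)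
    assume n: "\<not> M * (a t)\<^sup>2 < r ^ 3"
    then have "r ^ 3 / (a t)\<^sup>2 \<le> M"
      using a by (simp add: field_simps)
    then have "M < r"
      using * by linarith
    then have "M * M\<^sup>2 < r ^ 3"
      using M power_strict_mono[of M r 3] by (simp add: power2_eq_square power3_eq_cube)
    moreover have "M * (a t)\<^sup>2 \<le> M * M\<^sup>2"
      using M a assms by (intro mult_left_mono power_mono) auto
    ultimately show False
      using n by linarith
  qed
qed

lemma sqrt_kappa_le_near_singularity:
  assumes "a t < M" "0 < r" "0 < kappa M a t r"
  shows "sqrt (kappa M a t r) \<le> 2 * r / a t"
proof (rule real_le_lsqrt)
  have "1 \<le> (r / a t)\<^sup>2"
    using near_singularity(1)[OF assms] a by (simp add: one_le_power)
  moreover have "kappa M a t r \<le> 1 + (r / a t)\<^sup>2"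
    using assms M by (simp add: kappa_def power_divide)
  moreover have "(2 * r / a t)\<^sup>2 = 4 * (r / a t)\<^sup>2"
    by (simp add: power_divide power_mult_distrib)
  ultimately show "kappa M a t r \<le> (2 * r / a t)\<^sup>2"
    by linarith
qed (use assms a in auto)

text \<open>Only the part of the integral over [r, 2 r] is kept, in the form of the mean value
  theorem. There z^3 + M a^2 is at most (8 + 1) r^3 and \<surd>\<kappa> at most 4 r / a, so
  \<open>dhor\<close> is at least M a^2 / (27 r^4); 108 is 27 times 4.\<close>

lemma gap_lower:
  assumes "a t < M" and r: "0 < r" and k: "0 < kappa M a t r"
  shows "M * (a t) ^ 3 / (108 * r ^ 4) \<le> gap M a t r"
proof -
  have pos: "0 < x" "0 < kappa M a t x" if "r \<le> x" for x
    using that r kappa_pos_above[OF r k] by auto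
  have "\<exists>z>r. z < 2 * r \<and>
      gap M a t (2 * r) - gap M a t r = (2 * r - r) * - (dhor M a t z / sqrt (kappa M a t z))"
    by (intro MVT2 gap_has_derivative pos) (use r in auto)
  then obtain z where z: "r < z" "z < 2 * r"
    and eq: "gap M a t r = gap M a t (2 * r) + r * (dhor M a t z / sqrt (kappa M a t z))"
    by auto
  have z3: "z ^ 3 + M * (a t)\<^sup>2 \<le> 9 * r ^ 3"
    using near_singularity(2)[OF assms] power_mono[of z "2 * r" 3] z r
    by (simp add: power_mult_distrib)
  have "M * (a t)\<^sup>2 / (27 * r ^ 4) = 3 * M * (a t)\<^sup>2 * r\<^sup>2 / (9 * r ^ 3)\<^sup>2"
    using r by (simp add: field_simps eval_nat_numeral)
  also have "\<dots> \<le> dhor M a t z"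
    unfolding dhor_def using M a r z z3 hor_denominator_pos[of z]
    by (intro frac_le mult_left_mono power_mono) auto
  finally have h: "M * (a t)\<^sup>2 / (27 * r ^ 4) \<le> dhor M a t z" .
  have s: "sqrt (kappa M a t z) \<le> 4 * r / a t"
  proof -
    have "sqrt (kappa M a t z) \<le> 2 * z / a t"
      using z by (intro sqrt_kappa_le_near_singularity assms pos) auto
    also have "\<dots> \<le> 4 * r / a t"
      using z a by (intro divide_right_mono) auto
    finally show ?thesis .
  qed
  have "M * (a t) ^ 3 / (108 * r ^ 4) = r * ((M * (a t)\<^sup>2 / (27 * r ^ 4)) / (4 * r / a t))"
    using r a by (simp add: field_simps eval_nat_numeral)
  also have "\<dots> \<le> r * (dhor M a t z / sqrt (kappa M a t z))"
    using h s pos[of z] z r a M dhor_pos[of z]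
    by (intro mult_left_mono frac_le) auto
  also have "\<dots> \<le> gap M a t r"
    using eq gap_nonneg[OF pos[of "2 * r"]] r by simp
  finally show ?thesis .
qed

end

section \<open>Regularity in both coordinates\<close>

lemma radint_has_derivative_b:
  assumes M: "0 < M" and X: "convex X" "b \<in> X" "\<And>b. b \<in> X \<Longrightarrow> 0 < b \<and> 0 < rad M b w"
  shows "((\<lambda>b. radint M b w) has_real_derivative
    integral {0..w} (\<lambda>x. - (3 / 2) / ((rad M b x)\<^sup>2 * sqrt (rad M b x)))) (at b within X)"
proof -
  have pos: "0 < rad M b' x" if "b' \<in> X" "x \<in> {0..w}" for b' x
    using rad_pos[OF M, of b' w x] X(3)[OF that(1)] that(2) by auto
  show ?thesis
    unfolding radint_def interval_cbox
  proof (rule leibniz_rule_field_derivative[OF _ _ _ X(2,1)])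
    fix b' x assume "b' \<in> X" "x \<in> cbox 0 w"
    then have p: "0 < rad M b' x"
      using pos by simp
    have d: "((\<lambda>b. rad M b x) has_real_derivative 1) (at b' within X)"
      unfolding rad_def by (auto intro!: derivative_eq_intros)
    have "((\<lambda>y. 1 / (y * sqrt y)) has_real_derivative - (3 / 2) / (y\<^sup>2 * sqrt y)) (at y)"
      if "0 < y" for y :: real
      using that by (auto intro!: derivative_eq_intros simp: field_simps power2_eq_square)
    from DERIV_chain2[OF this[OF p] d]
    show "((\<lambda>b. 1 / (rad M b x * sqrt (rad M b x))) has_real_derivative
        - (3 / 2) / ((rad M b' x)\<^sup>2 * sqrt (rad M b' x))) (at b' within X)"
      by simp
  next
    fix b' assume "b' \<in> X"
    then show "(\<lambda>x. 1 / (rad M b' x * sqrt (rad M b' x))) integrable_on cbox 0 w"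
      unfolding interval_cbox[symmetric] using X(3) M
      by (intro integrable_continuous_real continuous_on_radint_integrand) auto
  next
    have "rad M (fst z) (snd z) \<noteq> 0" if "z \<in> X \<times> {0..w}" for z
      using pos[of "fst z" "snd z"] that unfolding mem_Times_iff by (metis less_irrefl)
    then show "continuous_on (X \<times> cbox 0 w)
        (\<lambda>(b, x). - (3 / 2) / ((rad M b x)\<^sup>2 * sqrt (rad M b x)))"
      unfolding split_beta interval_cbox[symmetric] rad_def
      by (intro continuous_intros) auto
  qed
qed

text \<open>Joint differentiability from partial derivatives: the one in w is explicit and jointly
  continuous, while the one in b, a derivative under the integral sign, is used only at the point
  itself. A product of balls supplies convex neighbourhoods on which \<open>rad\<close> stays
  positive.\<close>

lemma radint_differentiable:
  assumes M: "0 < M" and b: "0 < b" and w: "0 < w" and p: "0 < rad M b w"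
  shows "(\<lambda>z. radint M (fst z) (snd z)) differentiable (at (b, w))"
proof -
  let ?U = "{z. 0 < fst z \<and> 0 < snd z \<and> 0 < rad M (fst z) (snd z)}"
  have "open ?U"
    unfolding rad_def by (intro open_Collect_conj open_Collect_less continuous_intros)
  then obtain A B where AB: "open A" "open B" "(b, w) \<in> A \<times> B" "A \<times> B \<subseteq> ?U"
    using open_prod_elim[of ?U "(b, w)"] assms by auto
  obtain e1 where e1: "0 < e1" "ball b e1 \<subseteq> A"
    using AB openE by blast
  obtain e2 where e2: "0 < e2" "ball w e2 \<subseteq> B"
    using AB openE by blast
  define X where "X = ball b e1"
  define Y where "Y = ball w e2"
  have XY: "0 < x \<and> 0 < y \<and> 0 < rad M x y" if "x \<in> X" "y \<in> Y" for x y
  proof -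
    have "(x, y) \<in> A \<times> B"
      using e1(2) e2(2) that by (auto simp: X_def Y_def)
    then show ?thesis
      using AB(4) by auto
  qed
  have bw: "b \<in> X" "w \<in> Y"
    using e1 e2 by (auto simp: X_def Y_def)
  define fy where "fy x y = 1 / (rad M x y * sqrt (rad M x y))" for x y
  have "((\<lambda>(x, y). radint M x y) has_derivative
      (\<lambda>(tx, ty). integral {0..w} (\<lambda>x. - (3 / 2) / ((rad M b x)\<^sup>2 * sqrt (rad M b x))) * tx
        + blinfun_mult_right (fy b w) ty)) (at (b, w) within X \<times> Y)"
  proof (rule has_derivative_partialsI)
    show "((\<lambda>x. radint M x w) has_derivative
        (\<lambda>tx. integral {0..w} (\<lambda>x. - (3 / 2) / ((rad M b x)\<^sup>2 * sqrt (rad M b x))) * tx))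
        (at b within X)"
    proof (rule radint_has_derivative_b[OF M _ bw(1), unfolded has_field_derivative_def])
      show "convex X"
        by (simp add: X_def)
      show "0 < x \<and> 0 < rad M x w" if "x \<in> X" for x
        using XY[OF that bw(2)] by blast
    qed
    show "(radint M x has_derivative blinfun_apply (blinfun_mult_right (fy x y))) (at y within Y)"
      if "x \<in> X" "y \<in> Y" for x y
      using has_field_derivative_at_within[OF radint_has_derivative[OF M, of x y], of Y] XY[OF that]
      unfolding blinfun_mult_right.rep_eq fy_def has_field_derivative_def by blast
    have "((\<lambda>z. blinfun_mult_right (fy (fst z) (snd z))) \<longlongrightarrow> blinfun_mult_right (fy b w))
        (at (b, w) within X \<times> Y)"
    proof (rule bounded_linear.tendsto[OF bounded_linear_blinfun_mult_right])
      have "isCont (\<lambda>z. fy (fst z) (snd z)) (b, w)"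
        unfolding fy_def rad_def using p by (intro continuous_intros) (auto simp: rad_def)
      then show "((\<lambda>z. fy (fst z) (snd z)) \<longlongrightarrow> fy b w) (at (b, w) within X \<times> Y)"
        by (auto simp: isCont_def intro: tendsto_within_subset)
    qed
    then show "continuous (at (b, w) within X \<times> Y) (\<lambda>(x, y). blinfun_mult_right (fy x y))"
      unfolding continuous_within
      by (simp only: case_prod_unfold fst_conv snd_conv)
  qed (use bw in \<open>auto simp: Y_def\<close>)
  moreover have "at (b, w) within X \<times> Y = at (b, w)"
    using bw by (intro at_within_open) (auto simp: X_def Y_def open_Times)
  ultimately show ?thesis
    unfolding differentiable_def case_prod_unfold by metis
qed

section \<open>Differentiability of \<kappa>, S and the metric on \<Omega>\<close>

locale mcvittie =
  fixes M :: real and tf :: ereal and a :: "real \<Rightarrow> real"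
  assumes M: "0 < M"
    and a_pos: "\<And>t. t \<in> time_domain tf \<Longrightarrow> 0 < a t"
    and a_diff: "\<And>t. t \<in> time_domain tf \<Longrightarrow> a differentiable (at t)"
    and da_diff: "\<And>t. t \<in> time_domain tf \<Longrightarrow> deriv a differentiable (at t)"
begin

abbreviation \<kappa> :: "real \<Rightarrow> real \<Rightarrow> real" where "\<kappa> \<equiv> kappa M a"
abbreviation S :: "real \<Rightarrow> real \<Rightarrow> real" where "S \<equiv> sigma_over_H M a"
abbreviation H :: "real \<Rightarrow> real" where "H \<equiv> hubble a"
abbreviation dom :: "real set" where "dom \<equiv> time_domain tf"

definition \<Omega> :: "(real \<times> real) set" where
  "\<Omega> = {z. fst z \<in> dom \<and> 0 < snd z \<and> 0 < \<kappa> (fst z) (snd z)}"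

lemma Omega_eq: "Omega M tf a = \<Omega>"
proof (rule set_eqI)
  fix z
  show "z \<in> Omega M tf a \<longleftrightarrow> z \<in> \<Omega>"
    using Omega_iff[OF M a_pos, where t = "fst z" and r = "snd z"] by (simp add: \<Omega>_def)
qed

lemma \<Omega>_D:
  assumes "(t, r) \<in> \<Omega>"
  shows "t \<in> dom" "0 < t" "0 < a t" "0 < r" "0 < \<kappa> t r"
proof -
  show "t \<in> dom"
    using assms by (simp add: \<Omega>_def)
  then show "0 < t" "0 < a t"
    using a_pos by (simp_all add: time_domain_def)
qed (use assms in \<open>simp_all add: \<Omega>_def\<close>)

lemma open_dom: "open dom"
proof -
  have "dom = (case tf of ereal T \<Rightarrow> {0<..<T} | PInfty \<Rightarrow> {0<..} | MInfty \<Rightarrow> {})"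
    by (cases tf) (auto simp: time_domain_def)
  then show ?thesis
    by (simp split: ereal.split)
qed

lemma a_has_derivative: "t \<in> dom \<Longrightarrow> (a has_real_derivative deriv a t) (at t)"
  by (simp add: a_diff DERIV_deriv_iff_real_differentiable)

lemma deriv_a_eq: "t \<in> dom \<Longrightarrow> deriv a t = H t * a t"
  using a_pos[of t] by (simp add: hubble_def)

lemma H_differentiable: "t \<in> dom \<Longrightarrow> H differentiable (at t)"
  unfolding hubble_def[abs_def] using a_pos[of t] by (intro differentiable_divide a_diff da_diff) auto

lemma fst_differentiable:
  fixes f :: "real \<Rightarrow> real"
  assumes "f differentiable (at (fst z))"
  shows "(\<lambda>z :: real \<times> real. f (fst z)) differentiable (at z)"
proof -
  have "fst differentiable (at z)"
    by (auto simp: differentiable_def intro!: derivative_intros)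
  then show ?thesis
    using assms by (rule differentiable_chain_at[unfolded o_def])
qed

lemma snd_differentiable: "(snd :: real \<times> real \<Rightarrow> real) differentiable (at z)"
  by (auto simp: differentiable_def intro!: derivative_intros)

lemma real_differentiable_compose:
  fixes f :: "real \<Rightarrow> real" and g :: "'b::real_normed_vector \<Rightarrow> real"
  assumes "(f has_real_derivative D) (at (g z))" "g differentiable (at z)"
  shows "(\<lambda>z. f (g z)) differentiable (at z)"
  using differentiable_chain_at[OF assms(2), of f] assms(1)
  by (auto simp: o_def differentiable_def has_field_derivative_def)

lemma kappa_differentiable:
  assumes "t \<in> dom" "0 < r"
  shows "(\<lambda>z. \<kappa> (fst z) (snd z)) differentiable (at (t, r))"
  unfolding kappa_def using assms a_pos[of t]
  by (intro differentiable_add differentiable_diff differentiable_divide differentiable_power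
      differentiable_const fst_differentiable snd_differentiable a_diff) auto

lemma open_\<Omega>: "open \<Omega>"
proof -
  have "continuous_on (dom \<times> {0<..}) (\<lambda>z. \<kappa> (fst z) (snd z))"
    by (intro differentiable_imp_continuous_on differentiable_at_imp_differentiable_on)
      (auto intro: kappa_differentiable)
  from continuous_open_preimage[OF this, of "{0<..}"] have
    "open ((dom \<times> {0<..}) \<inter> (\<lambda>z. \<kappa> (fst z) (snd z)) -` {0<..})"
    by (simp add: open_Times open_dom)
  moreover have "(dom \<times> {0<..}) \<inter> (\<lambda>z. \<kappa> (fst z) (snd z)) -` {0<..} = \<Omega>"
    by (auto simp: \<Omega>_def)
  ultimately show ?thesis
    by simp
qed

lemma sqrt_kappa_differentiable:
  assumes "(t, r) \<in> \<Omega>"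
  shows "(\<lambda>z. sqrt (\<kappa> (fst z) (snd z))) differentiable (at (t, r))"
  by (rule real_differentiable_compose[OF DERIV_real_sqrt kappa_differentiable])
    (use \<Omega>_D[OF assms] in auto)

text \<open>S factors through the smooth coordinates (1 / a^2, 1 / r) of \<open>radint\<close>; the
  factorisation holds only on \<Omega>, which is open.\<close>

lemma S_differentiable:
  assumes "(t, r) \<in> \<Omega>"
  shows "(\<lambda>z. S (fst z) (snd z)) differentiable (at (t, r))"
proof -
  note tr = \<Omega>_D[OF assms]
  have "0 < rad M (1 / (a t)\<^sup>2) (1 / r)"
    using kappa_eq_rad[of r M a t] tr by (simp add: zero_less_mult_iff)
  then have "(\<lambda>z. radint M (fst z) (snd z)) differentiable (at (1 / (a t)\<^sup>2, 1 / r))"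
    using tr M by (intro radint_differentiable) auto
  moreover have "(\<lambda>z :: real \<times> real. (1 / (a (fst z))\<^sup>2, 1 / snd z)) differentiable (at (t, r))"
    using tr by (intro differentiable_Pair differentiable_divide differentiable_power
        differentiable_const fst_differentiable snd_differentiable a_diff) auto
  ultimately have "(\<lambda>z. radint M (1 / (a (fst z))\<^sup>2) (1 / snd z)) differentiable (at (t, r))"
    using differentiable_chain_at[where f = "\<lambda>z :: real \<times> real. (1 / (a (fst z))\<^sup>2, 1 / snd z)"
        and g = "\<lambda>z. radint M (fst z) (snd z)" and x = "(t, r)"]
    by (simp add: o_def)
  then have "(\<lambda>z. sqrt (\<kappa> (fst z) (snd z)) / (a (fst z))\<^sup>2 * radint M (1 / (a (fst z))\<^sup>2) (1 / snd z))
      differentiable (at (t, r))"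
    using tr by (intro differentiable_mult differentiable_divide differentiable_power
        fst_differentiable sqrt_kappa_differentiable assms a_diff) auto
  then obtain D where D: "((\<lambda>z. sqrt (\<kappa> (fst z) (snd z)) / (a (fst z))\<^sup>2 *
      radint M (1 / (a (fst z))\<^sup>2) (1 / snd z)) has_derivative D) (at (t, r))"
    by (auto simp: differentiable_def)
  have "((\<lambda>z. S (fst z) (snd z)) has_derivative D) (at (t, r))"
  proof (rule has_derivative_transform_within_open[OF D open_\<Omega> assms])
    fix z assume "z \<in> \<Omega>"
    then have "(fst z, snd z) \<in> \<Omega>"
      by simp
    from \<Omega>_D[OF this]
    show "sqrt (\<kappa> (fst z) (snd z)) / (a (fst z))\<^sup>2 * radint M (1 / (a (fst z))\<^sup>2) (1 / snd z) =
        S (fst z) (snd z)"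
      by (simp add: sigma_over_H_eq[OF M])
  qed
  then show ?thesis
    by (auto simp: differentiable_def)
qed

definition gtt :: "real \<Rightarrow> real \<Rightarrow> real" where
  "gtt t r = - ((S t r)\<^sup>2 - (sigma M a t r)\<^sup>2 * r\<^sup>2 / \<kappa> t r)"

definition gtr :: "real \<Rightarrow> real \<Rightarrow> real" where
  "gtr t r = - sigma M a t r * r / \<kappa> t r"

definition grr :: "real \<Rightarrow> real \<Rightarrow> real" where
  "grr t r = 1 / \<kappa> t r"

lemma metric_differentiable:
  assumes "(t, r) \<in> \<Omega>"
  shows "(\<lambda>z. gtt (fst z) (snd z)) differentiable (at (t, r))"
    and "(\<lambda>z. gtr (fst z) (snd z)) differentiable (at (t, r))"
    and "(\<lambda>z. grr (fst z) (snd z)) differentiable (at (t, r))"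
  unfolding gtt_def gtr_def grr_def sigma_def using \<Omega>_D[OF assms]
  by (intro differentiable_mult differentiable_divide differentiable_minus differentiable_diff
      differentiable_power differentiable_const fst_differentiable snd_differentiable
      kappa_differentiable S_differentiable H_differentiable assms; simp)+

lemma S_continuous: "continuous_on \<Omega> (\<lambda>z. S (fst z) (snd z))"
  by (intro differentiable_imp_continuous_on differentiable_at_imp_differentiable_on)
    (auto intro: S_differentiable)

lemma sqrt_kappa_continuous: "continuous_on \<Omega> (\<lambda>z. sqrt (\<kappa> (fst z) (snd z)))"
  by (intro differentiable_imp_continuous_on differentiable_at_imp_differentiable_on)
    (auto intro: sqrt_kappa_differentiable)

lemma H_continuous: "continuous_on dom H"
  by (intro differentiable_imp_continuous_on differentiable_at_imp_differentiable_on H_differentiable)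

lemma a_continuous: "continuous_on dom a"
  by (intro differentiable_imp_continuous_on differentiable_at_imp_differentiable_on a_diff)

end

section \<open>The geodesic equation\<close>

abbreviation geodesic_acc :: "(real^'n \<Rightarrow> real^'n^'n) \<Rightarrow> real^'n \<Rightarrow> real^'n \<Rightarrow> real^'n::finite" where
  "geodesic_acc g x v \<equiv>
    (\<chi> i. - (\<Sum>j\<in>UNIV. \<Sum>k\<in>UNIV. christoffel g x i j k * v $ j * v $ k))"

text \<open>Multiplication by the metric removes \<open>matrix_inv\<close>, so no inverse metric or
  Christoffel symbol has to be computed.\<close>

lemma geodesic_lower_index:
  fixes g :: "real^'n \<Rightarrow> real^'n^'n" and x v acc :: "real^'n"
  assumes "invertible (g x)"
  shows "acc = geodesic_acc g x v \<longleftrightarrow>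
    (\<forall>l. (g x *v acc) $ l = - (1 / 2 * (\<Sum>j\<in>UNIV. \<Sum>k\<in>UNIV.
      (partial_deriv j (\<lambda>y. g y $ l $ k) x + partial_deriv k (\<lambda>y. g y $ l $ j) x
        - partial_deriv l (\<lambda>y. g y $ j $ k) x) * v $ j * v $ k)))"
proof -
  define X where "X l j k = partial_deriv j (\<lambda>y. g y $ l $ k) x + partial_deriv k (\<lambda>y. g y $ l $ j) x
        - partial_deriv l (\<lambda>y. g y $ j $ k) x" for l j k
  define w :: "real^'n" where
    "w = (\<chi> l. - (1 / 2 * (\<Sum>j\<in>UNIV. \<Sum>k\<in>UNIV. X l j k * v $ j * v $ k)))"
  have swap: "(\<Sum>j\<in>UNIV. \<Sum>k\<in>UNIV. \<Sum>l\<in>UNIV. f l j k) = (\<Sum>l\<in>UNIV. \<Sum>j\<in>UNIV. \<Sum>k\<in>UNIV. f l j k)"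
    for f :: "'n \<Rightarrow> 'n \<Rightarrow> 'n \<Rightarrow> real"
  proof -
    have "(\<Sum>j\<in>UNIV. \<Sum>k\<in>UNIV. \<Sum>l\<in>UNIV. f l j k) = (\<Sum>j\<in>UNIV. \<Sum>l\<in>UNIV. \<Sum>k\<in>UNIV. f l j k)"
      by (intro sum.cong refl sum.swap)
    also have "\<dots> = (\<Sum>l\<in>UNIV. \<Sum>j\<in>UNIV. \<Sum>k\<in>UNIV. f l j k)"
      by (rule sum.swap)
    finally show ?thesis .
  qed
  have "geodesic_acc g x v = matrix_inv (g x) *v w"
  proof (rule vec_eq_iff[THEN iffD2], rule allI)
    fix i
    have "(\<Sum>j\<in>UNIV. \<Sum>k\<in>UNIV. christoffel g x i j k * v $ j * v $ k) =
        (\<Sum>j\<in>UNIV. \<Sum>k\<in>UNIV. \<Sum>l\<in>UNIV. matrix_inv (g x) $ i $ l * (1 / 2 * (X l j k * v $ j * v $ k)))"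
      unfolding christoffel_def X_def[symmetric]
      by (intro sum.cong refl) (simp add: sum_distrib_left sum_distrib_right mult_ac)
    also have "\<dots> = (\<Sum>l\<in>UNIV. \<Sum>j\<in>UNIV. \<Sum>k\<in>UNIV. matrix_inv (g x) $ i $ l * (1 / 2 * (X l j k * v $ j * v $ k)))"
      by (rule swap)
    also have "\<dots> = (\<Sum>l\<in>UNIV. matrix_inv (g x) $ i $ l * (1 / 2 * (\<Sum>j\<in>UNIV. \<Sum>k\<in>UNIV. X l j k * v $ j * v $ k)))"
      by (simp add: sum_distrib_left)
    also have "\<dots> = - (matrix_inv (g x) *v w) $ i"
      by (simp add: matrix_vector_mult_def w_def sum_negf)
    finally show "geodesic_acc g x v $ i =
        (matrix_inv (g x) *v w) $ i"
      by simp
  qed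
  moreover have "acc = matrix_inv (g x) *v w \<longleftrightarrow> g x *v acc = w"
    using someI_ex[OF assms[unfolded invertible_def], folded matrix_inv_def]
    by (metis matrix_vector_mul_assoc matrix_vector_mul_lid)
  moreover have "g x *v acc = w \<longleftrightarrow> (\<forall>l. (g x *v acc) $ l = w $ l)"
    by (rule vec_eq_iff)
  ultimately show ?thesis
    by (simp add: w_def X_def)
qed

lemma partial_deriv_12:
  fixes x :: "real^4"
  assumes "((\<lambda>z. G (fst z) (snd z)) has_derivative D) (at (x $ 1, x $ 2))"
  shows "partial_deriv 1 (\<lambda>y. G (y $ 1) (y $ 2)) x = D (1, 0)"
    and "partial_deriv 2 (\<lambda>y. G (y $ 1) (y $ 2)) x = D (0, 1)"
    and "partial_deriv 3 (\<lambda>y. G (y $ 1) (y $ 2)) x = 0"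
    and "partial_deriv 4 (\<lambda>y. G (y $ 1) (y $ 2)) x = 0"
proof -
  have lin: "D (h *\<^sub>R z) = D z * h" for h z
    using linear_cmul[OF has_derivative_linear[OF assms]] by simp
  have "((\<lambda>h. (x $ 1 + h * p, x $ 2 + h * q)) has_derivative (\<lambda>h. h *\<^sub>R (p, q))) (at 0)"
    for p q :: real
    by (auto intro!: derivative_eq_intros)
  from has_derivative_compose[OF this, where g = "\<lambda>z. G (fst z) (snd z)" and g' = D] assms lin
  have "((\<lambda>h. G (x $ 1 + h * p) (x $ 2 + h * q)) has_derivative (\<lambda>h. D (p, q) * h)) (at 0)" for p q
    by (simp del: scaleR_Pair)
  then have d: "deriv (\<lambda>h. G (x $ 1 + h * p) (x $ 2 + h * q)) 0 = D (p, q)" for p q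
    unfolding has_field_derivative_def[symmetric] by (intro DERIV_imp_deriv)
  show "partial_deriv 1 (\<lambda>y. G (y $ 1) (y $ 2)) x = D (1, 0)"
    "partial_deriv 2 (\<lambda>y. G (y $ 1) (y $ 2)) x = D (0, 1)"
    using d[of 1 0] d[of 0 1] by (simp_all add: partial_deriv_def axis_def)
  show "partial_deriv 3 (\<lambda>y. G (y $ 1) (y $ 2)) x = 0"
    "partial_deriv 4 (\<lambda>y. G (y $ 1) (y $ 2)) x = 0"
    by (simp_all add: partial_deriv_def axis_def)
qed

lemma partial_deriv_const: "partial_deriv i (\<lambda>y. c) x = 0"
  by (simp add: partial_deriv_def)

section \<open>The entries and the invertibility of the McVittie metric\<close>

context mcvittie
begin

lemma metric_entries:
  "mcvittie_metric M a y $ 1 $ 1 = gtt (y $ 1) (y $ 2)"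
  "mcvittie_metric M a y $ 1 $ 2 = gtr (y $ 1) (y $ 2)"
  "mcvittie_metric M a y $ 2 $ 1 = gtr (y $ 1) (y $ 2)"
  "mcvittie_metric M a y $ 2 $ 2 = grr (y $ 1) (y $ 2)"
  "mcvittie_metric M a y $ 3 $ 3 = (y $ 2)\<^sup>2"
  "mcvittie_metric M a y $ 4 $ 4 = (y $ 2)\<^sup>2 * (sin (y $ 3))\<^sup>2"
  "mcvittie_metric M a y $ 1 $ 3 = 0" "mcvittie_metric M a y $ 1 $ 4 = 0"
  "mcvittie_metric M a y $ 2 $ 3 = 0" "mcvittie_metric M a y $ 2 $ 4 = 0"
  "mcvittie_metric M a y $ 3 $ 1 = 0" "mcvittie_metric M a y $ 3 $ 2 = 0"
  "mcvittie_metric M a y $ 3 $ 4 = 0" "mcvittie_metric M a y $ 4 $ 1 = 0"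
  "mcvittie_metric M a y $ 4 $ 2 = 0" "mcvittie_metric M a y $ 4 $ 3 = 0"
  by (simp_all add: mcvittie_metric_def Let_def gtt_def gtr_def grr_def)

lemma metric_det:
  assumes "(t, r) \<in> \<Omega>"
  shows "gtt t r * grr t r - (gtr t r)\<^sup>2 < 0"
proof -
  note tr = \<Omega>_D[OF assms]
  have "gtt t r * grr t r - (gtr t r)\<^sup>2 = - (S t r)\<^sup>2 / \<kappa> t r"
    using tr by (simp add: gtt_def gtr_def grr_def field_simps power2_eq_square)
  then show ?thesis
    using tr sigma_over_H_pos[OF M tr(3) tr(4) tr(5)] by simp
qed

text \<open>The metric is a (t, r) block of nonzero determinant, solved by Cramer's rule, and two
  diagonal angular entries, nonzero because r > 0 and the chart avoids the poles.\<close>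

lemma metric_invertible:
  assumes x: "(x $ 1, x $ 2) \<in> \<Omega>" "0 < x $ 3" "x $ 3 < pi"
  shows "invertible (mcvittie_metric M a x)"
  unfolding invertible_left_inverse matrix_left_invertible_ker
proof (intro allI impI)
  fix y :: "real^4" assume "mcvittie_metric M a x *v y = 0"
  then have "\<forall>i. (mcvittie_metric M a x *v y) $ i = 0"
    by simp
  then have e: "gtt (x $ 1) (x $ 2) * y $ 1 + gtr (x $ 1) (x $ 2) * y $ 2 = 0"
    "gtr (x $ 1) (x $ 2) * y $ 1 + grr (x $ 1) (x $ 2) * y $ 2 = 0"
    "(x $ 2)\<^sup>2 * y $ 3 = 0" "(x $ 2)\<^sup>2 * (sin (x $ 3))\<^sup>2 * y $ 4 = 0"
    unfolding forall_4 by (simp_all add: matrix_vector_mult_def sum_4 metric_entries)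
  define A B C where "A = gtt (x $ 1) (x $ 2)" "B = gtr (x $ 1) (x $ 2)" "C = grr (x $ 1) (x $ 2)"
  have det: "A * C - B\<^sup>2 \<noteq> 0"
    using metric_det[OF x(1)] by (simp add: A_B_C_def)
  have "(A * C - B\<^sup>2) * y $ 1 = C * (A * y $ 1 + B * y $ 2) - B * (B * y $ 1 + C * y $ 2)"
    "(A * C - B\<^sup>2) * y $ 2 = A * (B * y $ 1 + C * y $ 2) - B * (A * y $ 1 + B * y $ 2)"
    by (simp_all add: algebra_simps power2_eq_square)
  then have "(A * C - B\<^sup>2) * y $ 1 = 0" "(A * C - B\<^sup>2) * y $ 2 = 0"
    unfolding e(1,2)[folded A_B_C_def] by simp_all
  then have "y $ 1 = 0" "y $ 2 = 0"
    using det by simp_all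
  moreover have "y $ 3 = 0" "y $ 4 = 0"
    using e \<Omega>_D(4)[OF x(1)] sin_gt_zero[OF x(2,3)] by simp_all
  ultimately show "y = 0"
    by (simp add: vec_eq_iff forall_4)
qed

end

text \<open>Differential identities in \<open>null_geodesic_iff\<close> are obtained by
  differentiating one function in two forms that agree near the point.\<close>

lemma DERIV_unique_eventually:
  fixes f g :: "real \<Rightarrow> real"
  assumes "(f has_real_derivative D) (at x)" "(g has_real_derivative E) (at x)"
    and "\<forall>\<^sub>F x in nhds x. f x = g x"
  shows "D = E"
proof -
  have "(f has_real_derivative E) (at x)"
    using assms(2) DERIV_cong_ev[OF refl assms(3) refl] by simp
  then show ?thesis
    using assms(1) DERIV_unique by blast
qed

section \<open>Null curves: the geodesic equation as an equation for E\<close>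

context mcvittie
begin

abbreviation rate_r :: "real \<Rightarrow> real \<Rightarrow> real \<Rightarrow> real \<Rightarrow> real" where
  "rate_r \<epsilon> t r e \<equiv> e * (r * H t + \<epsilon> * sqrt (\<kappa> t r))"

abbreviation rate_E :: "real \<Rightarrow> real \<Rightarrow> real \<Rightarrow> real \<Rightarrow> real" where
  "rate_E \<epsilon> t r e \<equiv> - (H t + \<epsilon> * sqrt (\<kappa> t r) * dlnS M a t r) * e\<^sup>2"

text \<open>The chain rule leaves a factor 1 / \<surd>\<kappa>. Solving the definition of
  \<open>dlnS\<close> for r / a^2 shows that the contribution of the time dependence of a cancels
  the r H part of r' up to a multiple of \<kappa>, so the result is again of order \<kappa>^0
  explicitly.\<close>

lemma sqrt_kappa_along_null_curve:
  assumes der: "(\<tau> has_real_derivative p) (at s)" "(\<rho> has_real_derivative q) (at s)"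
    and tr_def: "t = \<tau> s" "r = \<rho> s"
    and tr: "(t, r) \<in> \<Omega>" and q_eq: "q = p * S t r * (r * H t + \<epsilon> * sqrt (\<kappa> t r))"
  shows "((\<lambda>s. sqrt (\<kappa> (\<tau> s) (\<rho> s))) has_real_derivative
    S t r * p * (r * H t * dlnS M a t r * sqrt (\<kappa> t r) + \<epsilon> * dkappa M a t r / 2)) (at s)"
proof -
  note D = \<Omega>_D[OF tr]
  have S0: "0 < S t r"
    by (rule sigma_over_H_pos[OF M D(3-5)])
  define u where "u = sqrt (\<kappa> t r)"
  have u: "0 < u" "\<kappa> t r = u\<^sup>2"
    using D(5) by (simp_all add: u_def)
  define E where "E = S t r * p"
  define \<alpha> where "\<alpha> = dlnS M a t r"
  define k where "k = dkappa M a t r"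
  have "((\<lambda>s. 1 - 2 * M / \<rho> s + (\<rho> s)\<^sup>2 / (a (\<tau> s))\<^sup>2) has_real_derivative
      k * q - 2 * r\<^sup>2 * H t / (a t)\<^sup>2 * p) (at s)"
    using D
    by (auto intro!: derivative_eq_intros der DERIV_chain2[OF a_has_derivative der(1)]
        simp: tr_def[symmetric] k_def dkappa_def deriv_a_eq field_simps power2_eq_square)
  from DERIV_chain2[OF DERIV_real_sqrt this[folded kappa_def]] 
  have "((\<lambda>s. sqrt (\<kappa> (\<tau> s) (\<rho> s))) has_real_derivative
      inverse u / 2 * (k * q - 2 * r\<^sup>2 * H t / (a t)\<^sup>2 * p)) (at s)"
    using D(5) by (simp add: tr_def u_def)
  moreover have "inverse u / 2 * (k * q - 2 * r\<^sup>2 * H t / (a t)\<^sup>2 * p) = E * (r * H t * \<alpha> * u + \<epsilon> * k / 2)"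
  proof -
    have "r / (a t)\<^sup>2 = S t r * (k / 2 - \<alpha> * u\<^sup>2)"
      using S0 u D(3) by (simp add: \<alpha>_def k_def dlnS_def)
    moreover have "2 * r\<^sup>2 * H t / (a t)\<^sup>2 = 2 * r * H t * (r / (a t)\<^sup>2)"
      by (simp add: power2_eq_square)
    ultimately have *: "2 * r\<^sup>2 * H t / (a t)\<^sup>2 = 2 * r * H t * (S t r * (k / 2 - \<alpha> * u\<^sup>2))"
      by simp
    show ?thesis
      unfolding q_eq E_def u_def[symmetric] * using u(1)
      by (simp add: field_simps power2_eq_square)
  qed
  ultimately show ?thesis
    by (simp add: E_def \<alpha>_def k_def u_def)
qed

text \<open>
  The \<open>r\<close> equation is the Euler--Lagrange equation for \<open>g\<^sub>t\<^sub>r t' + g\<^sub>r\<^sub>r r' = \<epsilon> E / \<surd>\<kappa>\<close>;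
  the \<open>t\<close> equation follows from it because the curve is null and \<open>t' \<noteq> 0\<close>.
\<close>
lemma null_geodesic_iff:
  fixes \<tau> \<rho> vt vr :: "real \<Rightarrow> real" and x :: "real^4"
  assumes ev: "\<forall>\<^sub>F s' in nhds s. (\<tau> has_real_derivative vt s') (at s') \<and>
      (\<rho> has_real_derivative vr s') (at s') \<and> (\<tau> s', \<rho> s') \<in> \<Omega> \<and>
      vr s' = vt s' * S (\<tau> s') (\<rho> s') * (\<rho> s' * H (\<tau> s') + \<epsilon> * sqrt (\<kappa> (\<tau> s') (\<rho> s')))"
    and eps: "\<epsilon>\<^sup>2 = 1"
    and vt: "0 < vt s" "(vt has_real_derivative tdd) (at s)" "(vr has_real_derivative rdd) (at s)"
    and x: "x $ 1 = \<tau> s" "x $ 2 = \<rho> s" "0 < x $ 3" "x $ 3 < pi"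
    and v: "v $ 1 = vt s" "v $ 2 = vr s" "v $ 3 = 0" "v $ 4 = 0"
    and acc: "acc $ 1 = tdd" "acc $ 2 = rdd" "acc $ 3 = 0" "acc $ 4 = 0"
  shows "acc = geodesic_acc (mcvittie_metric M a) x v \<longleftrightarrow>
    ((\<lambda>s. S (\<tau> s) (\<rho> s) * vt s) has_real_derivative
      rate_E \<epsilon> (\<tau> s) (\<rho> s) (S (\<tau> s) (\<rho> s) * vt s)) (at s)"
proof -
  define t r where tr_def: "t = \<tau> s" "r = \<rho> s"
  define p q where pq_def: "p = vt s" "q = vr s"
  have tr: "(t, r) \<in> \<Omega>" and der: "(\<tau> has_real_derivative p) (at s)" "(\<rho> has_real_derivative q) (at s)"
    and q_eq: "q = p * S t r * (r * H t + \<epsilon> * sqrt (\<kappa> t r))"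
    using eventually_nhds_x_imp_x[OF ev] unfolding tr_def pq_def by blast+
  note D = \<Omega>_D[OF tr]
  have ee: "\<epsilon> * (\<epsilon> * x) = x" for x
    using eps by (simp add: power2_eq_square mult.assoc[symmetric])
  have eps0: "\<epsilon> \<noteq> 0"
    using eps by auto
  have S0: "0 < S t r"
    by (rule sigma_over_H_pos[OF M D(3-5)])
  define u where "u = sqrt (\<kappa> t r)"
  have u: "0 < u" "\<kappa> t r = u\<^sup>2"
    using D(5) by (simp_all add: u_def)
  obtain Dtt Dtr Drr where
    Dtt: "((\<lambda>z. gtt (fst z) (snd z)) has_derivative Dtt) (at (t, r))" and
    Dtr: "((\<lambda>z. gtr (fst z) (snd z)) has_derivative Dtr) (at (t, r))" and
    Drr: "((\<lambda>z. grr (fst z) (snd z)) has_derivative Drr) (at (t, r))"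
    using metric_differentiable[OF tr] by (auto simp: differentiable_def)
  obtain DS where DS: "((\<lambda>z. S (fst z) (snd z)) has_derivative DS) (at (t, r))"
    using S_differentiable[OF tr] by (auto simp: differentiable_def)
  define A1 A2 B1 B2 C1 C2 where ABC_def: "A1 = Dtt (1, 0)" "A2 = Dtt (0, 1)"
    "B1 = Dtr (1, 0)" "B2 = Dtr (0, 1)" "C1 = Drr (1, 0)" "C2 = Drr (0, 1)"
  have lin: "D' (y, z) = D' (1, 0) * y + D' (0, 1) * z"
    if "((\<lambda>z. G (fst z) (snd z)) has_derivative D') (at (t, r))" for G :: "real \<Rightarrow> real \<Rightarrow> real" and D' y z
  proof -
    have "D' (y, z) = D' (y *\<^sub>R (1, 0) + z *\<^sub>R (0, 1))"
      by simp
    also have "\<dots> = y * D' (1, 0) + z * D' (0, 1)"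
      using linear_add[OF has_derivative_linear[OF that]] linear_cmul[OF has_derivative_linear[OF that]]
      by (metis real_scaleR_def)
    finally show ?thesis
      by (simp add: mult.commute)
  qed
  have chain: "((\<lambda>s. G (\<tau> s) (\<rho> s)) has_real_derivative D' (1, 0) * p + D' (0, 1) * q) (at s)"
    if "((\<lambda>z. G (fst z) (snd z)) has_derivative D') (at (t, r))" for G D'
  proof -
    have "((\<lambda>s. (\<tau> s, \<rho> s)) has_derivative (\<lambda>h. (p * h, q * h))) (at s)"
      using der unfolding has_field_derivative_def by (rule has_derivative_Pair)
    from has_derivative_compose[OF this, where g = "\<lambda>z. G (fst z) (snd z)" and g' = D'] that
    have "((\<lambda>s. G (\<tau> s) (\<rho> s)) has_derivative (\<lambda>h. D' (p * h, q * h))) (at s)"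
      by (simp add: tr_def)
    moreover have "(\<lambda>h. D' (p * h, q * h)) = (*) (D' (1, 0) * p + D' (0, 1) * q)"
      by (rule ext, subst lin[OF that]) (simp add: algebra_simps)
    ultimately show ?thesis
      by (simp add: has_field_derivative_def)
  qed
  have rslice: "(G t has_real_derivative D' (0, 1)) (at r)"
    if "((\<lambda>z. G (fst z) (snd z)) has_derivative D') (at (t, r))" for G D'
  proof -
    have "((\<lambda>r. (t, r)) has_derivative (\<lambda>h. (0, h))) (at r)"
      by (auto intro!: derivative_eq_intros)
    from has_derivative_compose[OF this, where g = "\<lambda>z. G (fst z) (snd z)" and g' = D'] that
    have "(G t has_derivative (\<lambda>h. D' (0, h))) (at r)"
      by simp
    moreover have "(\<lambda>h. D' (0, h)) = (*) (D' (0, 1))"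
      by (rule ext, subst lin[OF that]) simp
    ultimately show ?thesis
      by (simp add: has_field_derivative_def)
  qed
  \<comment> \<open>The t and r components of the geodesic equation with lowered index. A, B, C
    belong to \<open>gtt\<close>, \<open>gtr\<close>, \<open>grr\<close>, and 1, 2 to derivatives in
    t and r. The angular components are trivial because velocity and acceleration have no angular
    part and the (t, r) block does not depend on the angles.\<close>
  define ELt where "ELt = gtt t r * tdd + gtr t r * rdd +
    1 / 2 * (A1 * p\<^sup>2 + 2 * A2 * p * q + (2 * B2 - C1) * q\<^sup>2)"
  define ELr where "ELr = gtr t r * tdd + grr t r * rdd +
    1 / 2 * ((2 * B1 - A2) * p\<^sup>2 + 2 * C1 * p * q + C2 * q\<^sup>2)"
  have geo: "acc = geodesic_acc (mcvittie_metric M a) x v \<longleftrightarrow> ELt = 0 \<and> ELr = 0"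
  proof -
    have inv: "invertible (mcvittie_metric M a x)"
      by (rule metric_invertible) (use tr x in \<open>simp_all add: tr_def\<close>)
    have x12: "(x $ 1, x $ 2) = (t, r)"
      using x by (simp add: tr_def)
    note pd = partial_deriv_12[of gtt Dtt x, unfolded x12, OF Dtt]
      partial_deriv_12[of gtr Dtr x, unfolded x12, OF Dtr]
      partial_deriv_12[of grr Drr x, unfolded x12, OF Drr]
    show ?thesis
      unfolding geodesic_lower_index[of "mcvittie_metric M a", OF inv]
      unfolding forall_4 matrix_vector_mult_def sum_4 metric_entries
      by (auto simp: x12[simplified] pd partial_deriv_const v acc metric_entries ABC_def[symmetric] pq_def[symmetric]
          ELt_def ELr_def power2_eq_square algebra_simps)
  qed
  \<comment> \<open>The momentum conjugate to r, and the null condition, both expressed by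
    \<open>\<epsilon>\<close>; they hold at all nearby points of the curve and may therefore be
    differentiated.\<close>
  have P_eq: "gtr t r * p + grr t r * q = \<epsilon> * (S t r * p) / sqrt (\<kappa> t r)" 
    and N_eq: "gtt t r * p\<^sup>2 + 2 * gtr t r * p * q + grr t r * q\<^sup>2 = 0"
    if "(t, r) \<in> \<Omega>" "q = p * S t r * (r * H t + \<epsilon> * sqrt (\<kappa> t r))" for t r p q
  proof -
    note D = \<Omega>_D[OF that(1)]
    define u where "u = sqrt (\<kappa> t r)"
    have u: "0 < u" "\<kappa> t r = u\<^sup>2"
      using D(5) by (simp_all add: u_def)
    have d: "q - H t * S t r * r * p = \<epsilon> * (S t r * p) * u"
      unfolding that(2) by (simp add: u_def algebra_simps)
    have "gtr t r * p + grr t r * q = (q - H t * S t r * r * p) / u\<^sup>2"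
      using u by (simp add: gtr_def grr_def sigma_def field_simps)
    also have "\<dots> = \<epsilon> * (S t r * p) / u"
      unfolding d using u by (simp add: power2_eq_square)
    finally show "gtr t r * p + grr t r * q = \<epsilon> * (S t r * p) / sqrt (\<kappa> t r)"
      by (simp add: u_def)
    have "gtt t r * p\<^sup>2 + 2 * gtr t r * p * q + grr t r * q\<^sup>2 =
        (q - H t * S t r * r * p)\<^sup>2 / u\<^sup>2 - (S t r * p)\<^sup>2"
      using u by (simp add: gtt_def gtr_def grr_def sigma_def field_simps power2_eq_square)
    also have "\<dots> = 0"
      unfolding d using u eps by (simp add: power_mult_distrib)
    finally show "gtt t r * p\<^sup>2 + 2 * gtr t r * p * q + grr t r * q\<^sup>2 = 0" .
  qed
  \<comment> \<open>Half the derivative of g(v, v) along the curve is the contraction of the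
    velocity with the lowered equation.\<close>
  have N: "p * ELt + q * ELr = 0"
  proof -
    have "((\<lambda>s. gtt (\<tau> s) (\<rho> s) * (vt s)\<^sup>2 + 2 * gtr (\<tau> s) (\<rho> s) * vt s * vr s + grr (\<tau> s) (\<rho> s) * (vr s)\<^sup>2)
      has_real_derivative 2 * (p * ELt + q * ELr)) (at s)"
      by (rule derivative_eq_intros chain[OF Dtt] chain[OF Dtr] chain[OF Drr] vt refl)+
        (simp add: ELt_def ELr_def ABC_def[symmetric] tr_def[symmetric] pq_def[symmetric] power2_eq_square algebra_simps)
    moreover have "\<forall>\<^sub>F s in nhds s. gtt (\<tau> s) (\<rho> s) * (vt s)\<^sup>2 + 2 * gtr (\<tau> s) (\<rho> s) * vt s * vr s + grr (\<tau> s) (\<rho> s) * (vr s)\<^sup>2 = 0"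
      using ev by eventually_elim (simp add: N_eq)
    ultimately have "2 * (p * ELt + q * ELr) = 0"
      using DERIV_const by (intro DERIV_unique_eventually[where g = "\<lambda>_. 0"])
    then show ?thesis
      by simp
  qed
  define E where "E = S t r * p"
  define E' where "E' = (DS (1, 0) * p + DS (0, 1) * q) * p + tdd * S t r"
  have E': "((\<lambda>s. S (\<tau> s) (\<rho> s) * vt s) has_real_derivative E') (at s)"
    unfolding E'_def using DERIV_mult[OF chain[OF DS] vt(2)] by (simp add: tr_def pq_def)
  define \<alpha> where "\<alpha> = dlnS M a t r"
  define k where "k = dkappa M a t r"
  have us: "((\<lambda>s. sqrt (\<kappa> (\<tau> s) (\<rho> s))) has_real_derivative E * (r * H t * \<alpha> * u + \<epsilon> * k / 2)) (at s)"
    using sqrt_kappa_along_null_curve[OF der tr_def tr q_eq] by (simp add: E_def \<alpha>_def k_def u_def)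
  have ELr: "ELr = \<epsilon> / u * (E' + (H t + \<epsilon> * u * \<alpha>) * E\<^sup>2)"
  proof -
    have d: "q - H t * S t r * r * p = \<epsilon> * E * u"
      unfolding q_eq by (simp add: u_def E_def algebra_simps)
    \<comment> \<open>The r-derivative of the Lagrangian with the velocities \<open>p\<close> and
      \<open>q\<close> frozen, once through the metric entries and once after completing the square.
      The null condition may be inserted only after differentiating, since it fails at neighbouring
      r.\<close>
    have "((\<lambda>r. 1 / 2 * (gtt t r * p\<^sup>2 + 2 * gtr t r * p * q + grr t r * q\<^sup>2)) has_real_derivative
        1 / 2 * (A2 * p\<^sup>2 + 2 * B2 * p * q + C2 * q\<^sup>2)) (at r)"
      unfolding ABC_def
      by (rule derivative_eq_intros rslice[OF Dtt] rslice[OF Dtr] rslice[OF Drr] refl)+ simp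
    moreover have "((\<lambda>r. 1 / 2 * ((q - H t * S t r * r * p)\<^sup>2 / \<kappa> t r - (S t r * p)\<^sup>2)) has_real_derivative
        1 / 2 * ((2 * (q - H t * S t r * r * p) * (- H t * p * (S t r * \<alpha> * r + S t r)) * \<kappa> t r -
          (q - H t * S t r * r * p)\<^sup>2 * k) / (\<kappa> t r * \<kappa> t r) - 2 * (S t r * p) * (S t r * \<alpha> * p))) (at r)"
    proof -
      have dS: "(S t has_real_derivative S t r * \<alpha>) (at r)"
        unfolding \<alpha>_def by (rule sigma_over_H_has_derivative_r[OF M D(3-5)])
      have dk: "(\<kappa> t has_real_derivative k) (at r)"
        unfolding k_def by (rule kappa_has_derivative[of M a t r, OF M D(3,4)])
      have d0: "((\<lambda>r. q - H t * S t r * r * p) has_real_derivative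
          - H t * p * (S t r * \<alpha> * r + S t r)) (at r)"
        by (auto intro!: derivative_eq_intros dS simp: algebra_simps)
      have d1: "((\<lambda>r. (q - H t * S t r * r * p)\<^sup>2) has_real_derivative
          2 * (q - H t * S t r * r * p) * (- H t * p * (S t r * \<alpha> * r + S t r))) (at r)"
        by (rule DERIV_cong[OF DERIV_power[OF d0, of 2]]) simp
      have d2: "((\<lambda>r. (S t r * p)\<^sup>2) has_real_derivative 2 * (S t r * p) * (S t r * \<alpha> * p)) (at r)"
        by (rule DERIV_cong[OF DERIV_power[OF DERIV_cmult_right[OF dS, of p], of 2]]) simp
      show ?thesis
        using D(5) by (intro DERIV_cmult[OF DERIV_diff[OF DERIV_divide[OF d1 dk] d2]]) simp
    qed
    moreover have "\<forall>\<^sub>F r in nhds r. 1 / 2 * (gtt t r * p\<^sup>2 + 2 * gtr t r * p * q + grr t r * q\<^sup>2) =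
        1 / 2 * ((q - H t * S t r * r * p)\<^sup>2 / \<kappa> t r - (S t r * p)\<^sup>2)"
      using eventually_kappa_pos[OF M D(3-5)]
      by (rule eventually_mono)
        (simp add: gtt_def gtr_def grr_def sigma_def field_simps power2_eq_square)
    ultimately have X: "1 / 2 * (A2 * p\<^sup>2 + 2 * B2 * p * q + C2 * q\<^sup>2) =
        1 / 2 * ((2 * (q - H t * S t r * r * p) * (- H t * p * (S t r * \<alpha> * r + S t r)) * \<kappa> t r -
          (q - H t * S t r * r * p)\<^sup>2 * k) / (\<kappa> t r * \<kappa> t r) - 2 * (S t r * p) * (S t r * \<alpha> * p))"
      by (rule DERIV_unique_eventually)
    have X': "1 / 2 * (A2 * p\<^sup>2 + 2 * B2 * p * q + C2 * q\<^sup>2) =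
        - (\<epsilon> * H t * (\<alpha> * r + 1) * E\<^sup>2 / u) - E\<^sup>2 * k / (2 * u\<^sup>2) - \<alpha> * E\<^sup>2"
      unfolding X d u(2) using u(1) eps
      by (simp add: E_def field_simps power2_eq_square)
    \<comment> \<open>The conjugate momentum differentiated in two ways: directly, which brings in
      \<open>ELr\<close>, and in the form given by \<open>P_eq\<close>, which brings in
      \<open>E'\<close>.\<close>
    have "((\<lambda>s. gtr (\<tau> s) (\<rho> s) * vt s + grr (\<tau> s) (\<rho> s) * vr s) has_real_derivative
        ELr + 1 / 2 * (A2 * p\<^sup>2 + 2 * B2 * p * q + C2 * q\<^sup>2)) (at s)"
      by (rule derivative_eq_intros chain[OF Dtr] chain[OF Drr] vt refl)+
        (simp add: ELr_def ABC_def[symmetric] tr_def[symmetric] pq_def[symmetric] power2_eq_square algebra_simps)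
    moreover have "((\<lambda>s. \<epsilon> * (S (\<tau> s) (\<rho> s) * vt s) / sqrt (\<kappa> (\<tau> s) (\<rho> s))) has_real_derivative
        (\<epsilon> * E' * u - \<epsilon> * E * (E * (r * H t * \<alpha> * u + \<epsilon> * k / 2))) / (u * u)) (at s)"
      using DERIV_divide[OF DERIV_cmult[OF E', of \<epsilon>] us] u
      by (simp add: tr_def[symmetric] pq_def[symmetric] u_def[symmetric] E_def)
    moreover have "\<forall>\<^sub>F s in nhds s. gtr (\<tau> s) (\<rho> s) * vt s + grr (\<tau> s) (\<rho> s) * vr s =
        \<epsilon> * (S (\<tau> s) (\<rho> s) * vt s) / sqrt (\<kappa> (\<tau> s) (\<rho> s))"
      using ev by eventually_elim (simp add: P_eq)
    ultimately have "ELr + 1 / 2 * (A2 * p\<^sup>2 + 2 * B2 * p * q + C2 * q\<^sup>2) =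
        (\<epsilon> * E' * u - \<epsilon> * E * (E * (r * H t * \<alpha> * u + \<epsilon> * k / 2))) / (u * u)"
      by (rule DERIV_unique_eventually)
    then have "ELr = (\<epsilon> * E' * u - \<epsilon> * E * (E * (r * H t * \<alpha> * u + \<epsilon> * k / 2))) / (u * u) -
        (- (\<epsilon> * H t * (\<alpha> * r + 1) * E\<^sup>2 / u) - E\<^sup>2 * k / (2 * u\<^sup>2) - \<alpha> * E\<^sup>2)"
      unfolding X' by simp
    also have "\<dots> = \<epsilon> / u * (E' + (H t + \<epsilon> * u * \<alpha>) * E\<^sup>2)"
      using u(1) by (simp add: ee field_simps power2_eq_square)
    finally show ?thesis .
  qed
  have "ELt = 0 \<and> ELr = 0 \<longleftrightarrow> ELr = 0"
    using N vt(1) by (auto simp: pq_def)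
  also have "\<dots> \<longleftrightarrow> E' = - (H t + \<epsilon> * u * \<alpha>) * E\<^sup>2"
    unfolding ELr using u(1) eps0 by (simp add: add_eq_0_iff2 del: minus_add_distrib)
  also have "\<dots> \<longleftrightarrow> ((\<lambda>s. S (\<tau> s) (\<rho> s) * vt s) has_real_derivative
      - (H t + \<epsilon> * u * \<alpha>) * E\<^sup>2) (at s)"
    using E' DERIV_unique by blast
  finally show ?thesis
    unfolding geo by (simp add: tr_def u_def \<alpha>_def E_def pq_def)
qed

end

section \<open>Behaviour of radial null geodesics towards the past\<close>

lemma eventually_pos_if_isCont:
  fixes f :: "'a::t2_space \<Rightarrow> real"
  assumes "isCont f x" "0 < f x"
  shows "\<forall>\<^sub>F y in nhds x. 0 < f y"
  using order_tendstoD(1)[OF assms(1)[unfolded isCont_def tendsto_at_iff_tendsto_nhds] assms(2)] .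

text \<open>A radial null geodesic in first-order form. \<open>\<epsilon>\<close> is 1 for outgoing
  and -1 for ingoing rays; \<open>da_lim\<close> is the Big Bang condition on a H, which equals the
  derivative of a.\<close>

locale null_curve = mcvittie +
  fixes I :: "real set" and \<tau> \<rho> E :: "real \<Rightarrow> real" and \<epsilon> :: real
  assumes interval: "is_interval I" and zero: "0 \<in> I"
    and eps: "\<epsilon> = 1 \<or> \<epsilon> = -1"
    and inside: "\<And>s. s \<in> I \<Longrightarrow> (\<tau> s, \<rho> s) \<in> \<Omega>"
    and E_pos: "\<And>s. s \<in> I \<Longrightarrow> 0 < E s"
    and d\<tau>: "\<And>s. s \<in> I \<Longrightarrow> (\<tau> has_real_derivative E s / S (\<tau> s) (\<rho> s)) (at s)"
    and d\<rho>: "\<And>s. s \<in> I \<Longrightarrow> (\<rho> has_real_derivative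
      rate_r \<epsilon> (\<tau> s) (\<rho> s) (E s)) (at s)"
    and dE: "\<And>s. s \<in> I \<Longrightarrow> (E has_real_derivative
      rate_E \<epsilon> (\<tau> s) (\<rho> s) (E s)) (at s)"
    and a_lim: "(a \<longlongrightarrow> 0) (at_right 0)"
    and da_lim: "filterlim (deriv a) at_top (at_right 0)"
begin

definition past :: "real set" where
  "past = I \<inter> {..0}"

abbreviation u :: "real \<Rightarrow> real" where "u s \<equiv> sqrt (\<kappa> (\<tau> s) (\<rho> s))"
abbreviation \<sigma> :: "real \<Rightarrow> real" where "\<sigma> s \<equiv> S (\<tau> s) (\<rho> s)"
abbreviation dt :: "real \<Rightarrow> real" where "dt s \<equiv> E s / S (\<tau> s) (\<rho> s)"
abbreviation dk :: "real \<Rightarrow> real" where "dk s \<equiv> dkappa M a (\<tau> s) (\<rho> s)"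
abbreviation gp :: "real \<Rightarrow> real" where "gp s \<equiv> gap M a (\<tau> s) (\<rho> s)"
abbreviation lna :: "real \<Rightarrow> real" where "lna s \<equiv> ln (a (\<tau> s))"
text \<open>\<surd>\<kappa> times the r-derivative of S along the ray (see \<open>drift_eq\<close>),
  in a form that can be bounded up to \<kappa> = 0.\<close>

abbreviation drift :: "real \<Rightarrow> real" where
  "drift s \<equiv> gp s * dk s / 2"

lemma pastD: "s \<in> past \<Longrightarrow> s \<in> I" "s \<in> past \<Longrightarrow> s \<le> 0"
  by (auto simp: past_def)

lemma past_interval: "is_interval past"
  unfolding past_def by (intro is_interval_Int interval is_interval_ic)

lemma zero_past: "0 \<in> past"
  by (simp add: past_def zero)

lemma past_downward: "s \<in> past \<Longrightarrow> is_interval (past \<inter> {..s})"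
  by (intro is_interval_Int past_interval is_interval_ic)

lemmas D = \<Omega>_D[OF inside]

lemma \<sigma>_bounds:
  assumes "s \<in> I"
  shows "0 < \<sigma> s" "\<sigma> s \<le> 1" "hor M a (\<tau> s) (\<rho> s) \<le> \<sigma> s" "0 < u s"
  using sigma_over_H_pos[OF M D(3-5)[OF assms]] sigma_over_H_le_1[OF M D(3-5)[OF assms]]
    hor_le_sigma_over_H[OF M D(3-5)[OF assms]] D(5)[OF assms] by simp_all

lemma dt_ge: "s \<in> I \<Longrightarrow> E s \<le> dt s" "s \<in> I \<Longrightarrow> 0 < dt s"
  using \<sigma>_bounds[of s] E_pos[of s] by (simp_all add: le_divide_eq mult_left_le)

lemma \<tau>_mono: "s \<in> I \<Longrightarrow> s' \<in> I \<Longrightarrow> s \<le> s' \<Longrightarrow> \<tau> s \<le> \<tau> s'"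
  by (rule mono_from_derivative[OF d\<tau> _ interval]) (simp_all add: dt_ge(2) less_imp_le)

lemma \<tau>_pos: "s \<in> I \<Longrightarrow> 0 < \<tau> s"
  by (rule D(2))

lemma drift_eq: "s \<in> I \<Longrightarrow> u s * dlnS M a (\<tau> s) (\<rho> s) * \<sigma> s = drift s"
  by (rule sqrt_kappa_dlnS[OF M D(3-5)])

lemma drift_nonneg: "s \<in> I \<Longrightarrow> 0 \<le> drift s"
  using gap_nonneg[of M a "\<tau> s" "\<rho> s", OF M D(3-5)]
    dkappa_pos[of M a "\<tau> s" "\<rho> s", OF M D(3,4)] by simp

lemma dlnE:
  assumes "s \<in> I"
  shows "((\<lambda>s. ln (E s)) has_real_derivative - (H (\<tau> s) * \<sigma> s + \<epsilon> * drift s) * dt s) (at s)"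
proof -
  have "((\<lambda>s. ln (E s)) has_real_derivative inverse (E s) *
      (- (H (\<tau> s) + \<epsilon> * u s * dlnS M a (\<tau> s) (\<rho> s)) * (E s)\<^sup>2)) (at s)"
    by (rule DERIV_chain2[OF DERIV_ln dE]) (use assms E_pos in auto)
  moreover have "inverse (E s) * (- (H (\<tau> s) + \<epsilon> * u s * dlnS M a (\<tau> s) (\<rho> s)) * (E s)\<^sup>2) =
      - (H (\<tau> s) * \<sigma> s + \<epsilon> * drift s) * dt s"
    unfolding drift_eq[OF assms, symmetric] using \<sigma>_bounds(1)[OF assms] E_pos[OF assms]
    by (simp add: field_simps power2_eq_square)
  ultimately show ?thesis
    by simp
qed

text \<open>Two effects compete: where H > 0, the expansion term makes \<surd>\<kappa> decrease
  towards the past, while for \<open>\<epsilon> = -1\<close> the other term makes it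
  increase.\<close>

lemma du:
  assumes "s \<in> I"
  shows "(u has_real_derivative dk s / 2 *
    (\<rho> s * H (\<tau> s) * gp s + \<epsilon> * \<sigma> s) * dt s) (at s)"
proof -
  have "(u has_real_derivative \<sigma> s * dt s *
      (\<rho> s * H (\<tau> s) * dlnS M a (\<tau> s) (\<rho> s) * u s + \<epsilon> * dk s / 2)) (at s)"
    by (rule sqrt_kappa_along_null_curve[OF d\<tau> d\<rho> refl refl])
      (use assms inside \<sigma>_bounds(1)[OF assms] in auto)
  moreover have "\<sigma> s * dt s *
      (\<rho> s * H (\<tau> s) * dlnS M a (\<tau> s) (\<rho> s) * u s + \<epsilon> * dk s / 2) =
      dt s * (\<rho> s * H (\<tau> s) * (u s * dlnS M a (\<tau> s) (\<rho> s) * \<sigma> s) + \<epsilon> * dk s / 2 * \<sigma> s)"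
    by (simp add: algebra_simps)
  moreover have "\<dots> = dk s / 2 *
    (\<rho> s * H (\<tau> s) * gp s + \<epsilon> * \<sigma> s) * dt s"
    unfolding drift_eq[OF assms] by (simp add: algebra_simps)
  ultimately show ?thesis
    by simp
qed

lemma da\<tau>:
  assumes "s \<in> I"
  shows "((\<lambda>s. lna s) has_real_derivative H (\<tau> s) * dt s) (at s)"
proof -
  have "((\<lambda>s. a (\<tau> s)) has_real_derivative deriv a (\<tau> s) * dt s) (at s)"
    by (rule DERIV_chain2[OF a_has_derivative d\<tau>]) (use D(1) assms in auto)
  from DERIV_chain2[OF DERIV_ln this] show ?thesis
    using D(1,3)[OF assms] by (simp add: hubble_def field_simps)
qed

lemma dln\<rho>:
  assumes "s \<in> I"
  shows "((\<lambda>s. ln (\<rho> s)) has_real_derivative (H (\<tau> s) + \<epsilon> * u s / \<rho> s) * \<sigma> s * dt s) (at s)"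
proof -
  have "((\<lambda>s. ln (\<rho> s)) has_real_derivative
      inverse (\<rho> s) * (E s * (\<rho> s * H (\<tau> s) + \<epsilon> * u s))) (at s)"
    by (rule DERIV_chain2[OF DERIV_ln d\<rho>]) (use D(4) assms in auto)
  moreover have "inverse (\<rho> s) * (E s * (\<rho> s * H (\<tau> s) + \<epsilon> * u s)) =
      (H (\<tau> s) + \<epsilon> * u s / \<rho> s) * \<sigma> s * dt s"
    using D(4)[OF assms] \<sigma>_bounds(1)[OF assms] by (simp add: field_simps)
  ultimately show ?thesis
    by simp
qed

section \<open>Finite affine length towards the past\<close>

lemma early_times:
  assumes "0 < \<delta>"
  obtains \<eta> where "0 < \<eta>" "\<And>t. 0 < t \<Longrightarrow> t < \<eta> \<Longrightarrow> a t < \<delta>" "\<And>t. 0 < t \<Longrightarrow> t < \<eta> \<Longrightarrow> B < deriv a t"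
proof -
  have "\<forall>\<^sub>F t in at_right 0. a t < \<delta>" "\<forall>\<^sub>F t in at_right 0. B < deriv a t"
    using order_tendstoD(2)[OF a_lim assms] da_lim by (auto simp: filterlim_at_top_dense)
  from eventually_conj[OF this] show ?thesis
    using that unfolding eventually_at_right_field by blast
qed

lemma dom_downward: "0 < t \<Longrightarrow> t \<le> \<tau> 0 \<Longrightarrow> t \<in> dom"
  using D(1)[OF zero] by (auto simp: time_domain_def intro: le_less_trans[of _ "ereal (\<tau> 0)"])

lemma compact_bounds:
  assumes "0 < T"
  obtains C where "0 < C"
    "\<And>t. T \<le> t \<Longrightarrow> t \<le> \<tau> 0 \<Longrightarrow> \<bar>H t\<bar> \<le> C \<and> a t \<le> C \<and> 1 / a t \<le> C"
proof -
  have sub: "{T..\<tau> 0} \<subseteq> dom"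
    using dom_downward assms by auto
  have bdd: "\<exists>B. \<forall>t\<in>{T..\<tau> 0}. \<bar>f t\<bar> \<le> B" if "continuous_on dom f" for f :: "real \<Rightarrow> real"
    using compact_imp_bounded[OF compact_continuous_image[OF continuous_on_subset[OF that sub]]]
    by (auto simp: bounded_iff)
  have "continuous_on dom (\<lambda>t. 1 / a t)"
    using a_pos by (intro continuous_intros a_continuous) (metis less_irrefl)
  then obtain B1 B2 B3 where B: "\<forall>t\<in>{T..\<tau> 0}. \<bar>H t\<bar> \<le> B1" "\<forall>t\<in>{T..\<tau> 0}. \<bar>a t\<bar> \<le> B2"
      "\<forall>t\<in>{T..\<tau> 0}. \<bar>1 / a t\<bar> \<le> B3"
    using bdd[OF H_continuous] bdd[OF a_continuous] bdd[of "\<lambda>t. 1 / a t"] by metis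
  show ?thesis
  proof (rule that)
    show "0 < 1 + \<bar>B1\<bar> + \<bar>B2\<bar> + \<bar>B3\<bar>"
      by linarith
    fix t assume "T \<le> t" "t \<le> \<tau> 0"
    then have "\<bar>H t\<bar> \<le> B1" "\<bar>a t\<bar> \<le> B2" "\<bar>1 / a t\<bar> \<le> B3"
      using B by auto
    then show "\<bar>H t\<bar> \<le> 1 + \<bar>B1\<bar> + \<bar>B2\<bar> + \<bar>B3\<bar> \<and> a t \<le> 1 + \<bar>B1\<bar> + \<bar>B2\<bar> + \<bar>B3\<bar> \<and>
        1 / a t \<le> 1 + \<bar>B1\<bar> + \<bar>B2\<bar> + \<bar>B3\<bar>"
      by linarith
  qed
qed

lemma \<tau>_le: "s \<in> past \<Longrightarrow> \<tau> s \<le> \<tau> 0"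
  using \<tau>_mono[OF _ zero] by (auto simp: past_def)

lemma H_bounded_below:
  obtains C where "0 \<le> C" "\<And>t. 0 < t \<Longrightarrow> t \<le> \<tau> 0 \<Longrightarrow> - C \<le> H t"
proof -
  obtain \<eta> where \<eta>: "0 < \<eta>" "\<And>t. 0 < t \<Longrightarrow> t < \<eta> \<Longrightarrow> 0 < deriv a t"
    using early_times[of 1 0, OF zero_less_one] by metis
  obtain C where C: "0 < C" "\<And>t. \<eta> \<le> t \<Longrightarrow> t \<le> \<tau> 0 \<Longrightarrow> \<bar>H t\<bar> \<le> C"
    using compact_bounds[OF \<eta>(1)] by metis
  show ?thesis
  proof (rule that[of C])
    fix t assume t: "0 < t" "t \<le> \<tau> 0"
    show "- C \<le> H t"
    proof (cases "t < \<eta>")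
      case True
      then have "0 < H t"
        using \<eta>(2)[OF t(1)] a_pos[OF dom_downward[OF t]] by (simp add: hubble_def)
      then show ?thesis
        using C(1) by linarith
    qed (use C(2)[of t] t in auto)
  qed (use C in auto)
qed

text \<open>Towards the past ln E loses at most C per unit of t, and the available amount of t is
  less than \<open>\<tau> 0\<close>. So E stays above a constant \<open>c\<close>, t' is at least
  \<open>c\<close> as well, and positivity of t limits the affine length to
  \<open>\<tau> 0 / c\<close>.\<close>

lemma past_bounded_below:
  assumes C: "0 \<le> C" and le: "\<And>s. s \<in> past \<Longrightarrow> - C \<le> H (\<tau> s) * \<sigma> s + \<epsilon> * drift s"
  shows "bdd_below past"
proof -
  define c where "c = E 0 * exp (- C * \<tau> 0)"
  have c: "0 < c"
    using E_pos[OF zero] by (simp add: c_def)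
  have E_ge: "c \<le> E s" if s: "s \<in> past" for s
  proof -
    have "C * \<tau> s - ln (E s) \<le> C * \<tau> 0 - ln (E 0)"
    proof (rule mono_from_derivative[where A = past and f = "\<lambda>s. C * \<tau> s - ln (E s)" and
          f' = "\<lambda>s. C * dt s - - (H (\<tau> s) * \<sigma> s + \<epsilon> * drift s) * dt s"])
      fix x assume x: "x \<in> past"
      show "((\<lambda>s. C * \<tau> s - ln (E s)) has_real_derivative
          C * dt x - - (H (\<tau> x) * \<sigma> x + \<epsilon> * drift x) * dt x) (at x)"
        by (intro DERIV_diff DERIV_cmult d\<tau> dlnE pastD(1)[OF x])
      have "0 \<le> (C + (H (\<tau> x) * \<sigma> x + \<epsilon> * drift x)) * dt x"
        using le[OF x] dt_ge(2)[OF pastD(1)[OF x]] by (intro mult_nonneg_nonneg) auto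
      then show "0 \<le> C * dt x - - (H (\<tau> x) * \<sigma> x + \<epsilon> * drift x) * dt x"
        by (simp only: distrib_right mult_minus_left diff_minus_eq_add)
    qed (use past_interval zero_past s pastD in auto)
    moreover have "0 \<le> C * \<tau> s"
      using C \<tau>_pos[OF pastD(1)[OF s]] by simp
    ultimately have "ln (E 0) - C * \<tau> 0 \<le> ln (E s)"
      by linarith
    then have "exp (ln (E 0) - C * \<tau> 0) \<le> exp (ln (E s))"
      by simp
    then show ?thesis
      using E_pos[OF zero] E_pos[OF pastD(1)[OF s]] by (simp add: c_def exp_diff exp_minus field_simps)
  qed
  show ?thesis
  proof (rule bdd_belowI)
    fix s assume s: "s \<in> past"
    have "\<tau> s - c * s \<le> \<tau> 0 - c * 0"
    proof (rule mono_from_derivative[where A = past and f = "\<lambda>s. \<tau> s - c * s" and f' = "\<lambda>s. dt s - c * 1"])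
      fix x assume x: "x \<in> past"
      show "((\<lambda>s. \<tau> s - c * s) has_real_derivative dt x - c * 1) (at x)"
        by (intro DERIV_diff DERIV_cmult d\<tau> DERIV_ident pastD(1)[OF x])
      show "0 \<le> dt x - c * 1"
        using E_ge[OF x] dt_ge(1)[OF pastD(1)[OF x]] by simp
    qed (use past_interval zero_past s pastD in auto)
    then have "- \<tau> 0 \<le> c * s"
      using \<tau>_pos[OF pastD(1)[OF s]] by simp
    then show "- \<tau> 0 / c \<le> s"
      using c by (simp add: field_simps)
  qed
qed

lemma u_le:
  assumes s: "s \<in> I" and C: "1 / a (\<tau> s) \<le> C"
  shows "u s \<le> 1 + C * \<rho> s"
proof (rule real_le_lsqrt)
  note Ds = D[OF s]
  have "\<rho> s * (1 / a (\<tau> s)) \<le> \<rho> s * C"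
    using C Ds by (intro mult_left_mono) auto
  then have "(\<rho> s / a (\<tau> s))\<^sup>2 \<le> (C * \<rho> s)\<^sup>2"
    using Ds by (intro power_mono) (auto simp: mult.commute)
  moreover have "\<kappa> (\<tau> s) (\<rho> s) \<le> 1 + (\<rho> s / a (\<tau> s))\<^sup>2"
    using M Ds by (simp add: kappa_def power_divide)
  moreover have C_pos: "0 < C"
    using C Ds(3) by (meson less_le_trans zero_less_divide_1_iff)
  then have "0 \<le> 2 * (C * \<rho> s)"
    using Ds by simp
  moreover have "(1 + C * \<rho> s)\<^sup>2 = 1 + (C * \<rho> s)\<^sup>2 + 2 * (C * \<rho> s)"
    by (simp add: power2_sum)
  ultimately show "\<kappa> (\<tau> s) (\<rho> s) \<le> (1 + C * \<rho> s)\<^sup>2"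
    by linarith
  show "0 \<le> 1 + C * \<rho> s"
    using C_pos Ds by simp
qed

text \<open>From below, r is bounded because \<kappa> > 0 excludes radii that are at most both M and
  a. From above, it is a Gronwall estimate for 1 + r in the variable t.\<close>

lemma \<rho>_bounds:
  assumes T: "0 < T" "\<And>s. s \<in> past \<Longrightarrow> T \<le> \<tau> s"
  obtains l R where "0 < l" "\<And>s. s \<in> past \<Longrightarrow> l \<le> \<rho> s \<and> \<rho> s \<le> R"
proof -
  obtain C where C: "0 < C" "\<And>t. T \<le> t \<Longrightarrow> t \<le> \<tau> 0 \<Longrightarrow> \<bar>H t\<bar> \<le> C \<and> a t \<le> C \<and> 1 / a t \<le> C"
    using compact_bounds[OF T(1)] by metis
  have Cs: "\<bar>H (\<tau> s)\<bar> \<le> C" "a (\<tau> s) \<le> C" "1 / a (\<tau> s) \<le> C" if "s \<in> past" for s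
    using C(2)[OF T(2)[OF that] \<tau>_le[OF that]] by auto
  have low: "min M (1 / C) \<le> \<rho> s" if s: "s \<in> past" for s
  proof (rule ccontr)
    assume n: "\<not> min M (1 / C) \<le> \<rho> s"
    note Ds = D[OF pastD(1)[OF s]]
    have "1 / C \<le> a (\<tau> s)"
      using Cs(3)[OF s] Ds C(1) by (simp add: field_simps)
    then have "(\<rho> s)\<^sup>2 / (a (\<tau> s))\<^sup>2 \<le> 1"
      using n Ds by (simp add: power_mono)
    moreover have "2 \<le> 2 * M / \<rho> s"
      using n Ds by (simp add: field_simps)
    ultimately have "\<kappa> (\<tau> s) (\<rho> s) \<le> 0"
      by (simp add: kappa_def)
    then show False
      using Ds by simp
  qed
  \<comment> \<open>|r H| \<le> C r and \<surd>\<kappa> \<le> 1 + C r add up to at most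
    \<open>B * (1 + r)\<close>.\<close>
  define B where "B = 2 * C + 1"
  have up: "ln (1 + \<rho> s) \<le> ln (1 + \<rho> 0) + B * \<tau> 0" if s: "s \<in> past" for s
  proof -
    have "ln (1 + \<rho> s) + B * \<tau> s \<le> ln (1 + \<rho> 0) + B * \<tau> 0"
    proof (rule mono_from_derivative[where A = past and f = "\<lambda>s. ln (1 + \<rho> s) + B * \<tau> s" and
          f' = "\<lambda>s. inverse (1 + \<rho> s) * (0 + E s * (\<rho> s * H (\<tau> s) + \<epsilon> * u s)) + B * dt s"])
      fix x assume x: "x \<in> past"
      note xI = pastD(1)[OF x] and Dx = D[OF pastD(1)[OF x]]
      show "((\<lambda>s. ln (1 + \<rho> s) + B * \<tau> s) has_real_derivative
          inverse (1 + \<rho> x) * (0 + E x * (\<rho> x * H (\<tau> x) + \<epsilon> * u x)) + B * dt x) (at x)"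
        by (intro DERIV_add DERIV_cmult d\<tau> d\<rho> DERIV_const DERIV_chain2[OF DERIV_ln] xI) (use Dx in auto)
      have "\<bar>\<rho> x * H (\<tau> x) + \<epsilon> * u x\<bar> \<le> \<rho> x * C + (1 + C * \<rho> x)"
      proof -
        have "\<bar>\<epsilon> * u x\<bar> \<le> 1 + C * \<rho> x"
          using u_le[OF xI Cs(3)[OF x]] eps Dx(5) by (auto simp: abs_mult)
        moreover have "\<bar>\<rho> x * H (\<tau> x)\<bar> \<le> \<rho> x * C"
          unfolding abs_mult using Cs(1)[OF x] Dx by (intro mult_mono) auto
        ultimately show ?thesis
          by linarith
      qed
      also have "\<dots> \<le> B * (1 + \<rho> x)"
        using C Dx by (simp add: B_def algebra_simps)
      finally have "- (B * (1 + \<rho> x)) \<le> \<rho> x * H (\<tau> x) + \<epsilon> * u x"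
        by linarith
      then have "E x * - (B * (1 + \<rho> x)) \<le> E x * (\<rho> x * H (\<tau> x) + \<epsilon> * u x)"
        using E_pos[OF xI] by (intro mult_left_mono) auto
      then have "inverse (1 + \<rho> x) * (E x * - (B * (1 + \<rho> x))) \<le>
          inverse (1 + \<rho> x) * (0 + E x * (\<rho> x * H (\<tau> x) + \<epsilon> * u x))"
        using Dx by (intro mult_left_mono) auto
      moreover have "inverse (1 + \<rho> x) * (E x * - (B * (1 + \<rho> x))) = - (B * E x)"
        using Dx by (simp add: field_simps)
      moreover have "B * E x \<le> B * dt x"
        using dt_ge(1)[OF xI] C by (intro mult_left_mono) (auto simp: B_def)
      ultimately show "0 \<le> inverse (1 + \<rho> x) * (0 + E x * (\<rho> x * H (\<tau> x) + \<epsilon> * u x)) + B * dt x"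
        by linarith
    qed (use past_interval zero_past s pastD in auto)
    moreover have "0 \<le> B * \<tau> s"
      using \<tau>_pos[OF pastD(1)[OF s]] C by (simp add: B_def)
    ultimately show ?thesis
      by linarith
  qed
  show ?thesis
  proof (rule that)
    show "0 < min M (1 / C)"
      using M C by simp
    fix s assume s: "s \<in> past"
    have "1 + \<rho> s \<le> exp (ln (1 + \<rho> 0) + B * \<tau> 0)"
      using up[OF s] D(4)[OF pastD(1)[OF s]] by (metis add_pos_pos exp_le_cancel_iff exp_ln zero_less_one)
    then show "min M (1 / C) \<le> \<rho> s \<and> \<rho> s \<le> exp (ln (1 + \<rho> 0) + B * \<tau> 0)"
      using low[OF s] by auto
  qed
qed

lemma drift_bounded:
  assumes T: "0 < T" "\<And>s. s \<in> past \<Longrightarrow> T \<le> \<tau> s"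
  obtains C where "0 \<le> C" "\<And>s. s \<in> past \<Longrightarrow> drift s \<le> C"
proof -
  obtain C where C: "0 < C" "\<And>t. T \<le> t \<Longrightarrow> t \<le> \<tau> 0 \<Longrightarrow> \<bar>H t\<bar> \<le> C \<and> a t \<le> C \<and> 1 / a t \<le> C"
    using compact_bounds[OF T(1)] by metis
  obtain l R where lR: "0 < l" "\<And>s. s \<in> past \<Longrightarrow> l \<le> \<rho> s \<and> \<rho> s \<le> R"
    using \<rho>_bounds[OF T] by metis
  \<comment> \<open>One comparison radius for \<open>gap_upper\<close> that serves the whole past of
    the ray: it lies beyond every radius attained, and from 2 M on \<surd>\<kappa> is at least r /
    a.\<close>
  define X where "X = max R (2 * M)"
  have X: "0 < X"
    using M by (simp add: X_def)
  define G where "G = C / X + 3 * M * C ^ 4 / l ^ 5 * sqrt (1 + (X * C)\<^sup>2)"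
  define K where "K = 2 * M / l\<^sup>2 + 2 * X * C\<^sup>2"
  have nn: "0 \<le> G" "0 \<le> K"
    using C M lR X by (simp_all add: G_def K_def)
  show ?thesis
  proof (rule that)
    show "0 \<le> G * K / 2"
      using nn by simp
    fix s assume s: "s \<in> past"
    note Ds = D[OF pastD(1)[OF s]]
    have Cs: "a (\<tau> s) \<le> C" "1 / a (\<tau> s) \<le> C" and ls: "l \<le> \<rho> s" "\<rho> s \<le> X"
      using C(2)[OF T(2)[OF s] \<tau>_le[OF s]] lR(2)[OF s] by (auto simp: X_def)
    have sq: "1 / (a (\<tau> s))\<^sup>2 \<le> C\<^sup>2"
      using power_mono[OF Cs(2), of 2] Ds by (simp add: power_divide)
    have "gp s \<le>
        a (\<tau> s) / X + 3 * M * (a (\<tau> s)) ^ 4 / l ^ 5 * sqrt (\<kappa> (\<tau> s) X)"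
      by (rule gap_upper[of M a "\<tau> s" l "\<rho> s" X, OF M Ds(3) lR(1)]) (use ls Ds in \<open>auto simp: X_def\<close>)
    also have "\<dots> \<le> G"
    proof -
      have "\<kappa> (\<tau> s) X \<le> 1 + X\<^sup>2 * (1 / (a (\<tau> s))\<^sup>2)"
        using M X by (simp add: kappa_def)
      also have "\<dots> \<le> 1 + (X * C)\<^sup>2"
        using mult_left_mono[OF sq, of "X\<^sup>2"] by (simp add: power_mult_distrib)
      finally have "sqrt (\<kappa> (\<tau> s) X) \<le> sqrt (1 + (X * C)\<^sup>2)"
        by simp
      moreover have "3 * M * (a (\<tau> s)) ^ 4 / l ^ 5 \<le> 3 * M * C ^ 4 / l ^ 5"
        using Cs Ds M lR by (intro divide_right_mono mult_left_mono power_mono) auto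
      moreover have "0 \<le> sqrt (\<kappa> (\<tau> s) X)"
        using kappa_pos_above[OF M Ds(3) Ds(4) Ds(5) ls(2)] by simp
      moreover have "0 \<le> 3 * M * C ^ 4 / l ^ 5"
        using C M lR by simp
      ultimately have "3 * M * (a (\<tau> s)) ^ 4 / l ^ 5 * sqrt (\<kappa> (\<tau> s) X) \<le>
          3 * M * C ^ 4 / l ^ 5 * sqrt (1 + (X * C)\<^sup>2)"
        by (intro mult_mono)
      moreover have "a (\<tau> s) / X \<le> C / X"
        using Cs X by (intro divide_right_mono) auto
      ultimately show ?thesis
        unfolding G_def by linarith
    qed
    finally have g: "gp s \<le> G" .
    have k: "dk s \<le> K"
    proof -
      have "2 * M / (\<rho> s)\<^sup>2 \<le> 2 * M / l\<^sup>2"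
        using ls lR M by (intro divide_left_mono power_mono) auto
      moreover have "2 * \<rho> s * (1 / (a (\<tau> s))\<^sup>2) \<le> 2 * X * C\<^sup>2"
        using ls sq Ds X by (intro mult_mono) auto
      ultimately show ?thesis
        by (simp add: dkappa_def K_def)
    qed
    have "gp s * dk s \<le> G * K"
      using g k nn dkappa_pos[of M a "\<tau> s" "\<rho> s", OF M Ds(3,4)] by (intro mult_mono) auto
    then show "drift s \<le> G * K / 2"
      by simp
  qed
qed

section \<open>Ingoing rays stay away from the Big Bang\<close>

lemma early_estimates:
  assumes s: "s \<in> I" and aM: "a (\<tau> s) < M"
  shows "a (\<tau> s) < \<rho> s" "M * (a (\<tau> s))\<^sup>2 < (\<rho> s) ^ 3" "1 / 2 \<le> \<sigma> s" "u s / \<rho> s \<le> 2 / a (\<tau> s)"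
proof -
  note Ds = D[OF s]
  show r: "a (\<tau> s) < \<rho> s" "M * (a (\<tau> s))\<^sup>2 < (\<rho> s) ^ 3"
    using near_singularity[OF M Ds(3) aM Ds(4,5)] by auto
  have "1 / 2 \<le> hor M a (\<tau> s) (\<rho> s)"
    using r(2) hor_denominator_pos[of M a "\<tau> s" "\<rho> s", OF M Ds(3,4)]
    by (simp add: hor_def field_simps)
  then show "1 / 2 \<le> \<sigma> s"
    using \<sigma>_bounds(3)[OF s] by linarith
  have "u s \<le> 2 * \<rho> s / a (\<tau> s)"
    by (rule sqrt_kappa_le_near_singularity[OF M Ds(3) aM Ds(4,5)])
  then show "u s / \<rho> s \<le> 2 / a (\<tau> s)"
    using Ds by (simp add: field_simps)
qed

text \<open>
  The variable \<open>Y = r\<^sup>3 / a\<^sup>2\<close> is scaled so that the horizon sits near \<open>Y = 2 M\<close> as \<open>a \<rightarrow> 0\<close>. Along an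
  ingoing ray \<open>Y\<close> stays bounded towards the past, and then \<open>\<surd>\<kappa>\<close> decreases at least like a multiple of
  \<open>ln a\<close>, so the ray leaves \<open>\<Omega>\<close> through \<open>\<kappa> = 0\<close> before \<open>t = 0\<close>.
\<close>
lemma ingoing_time_bounded_below:
  assumes ingoing: "\<epsilon> = -1"
  obtains T where "0 < T" "\<And>s. s \<in> past \<Longrightarrow> T \<le> \<tau> s"
proof -
  have "\<exists>T>0. \<forall>s\<in>past. T \<le> \<tau> s"
  proof (rule ccontr)
    assume "\<not> ?thesis"
    then have early: "\<exists>s\<in>past. \<tau> s < T" if "0 < T" for T
      using that by (meson not_le)
    \<comment> \<open>Since \<surd>\<kappa> / r \<le> 2 / a, the ingoing term in the derivative of
      ln Y costs at most 6 / a, to be paid by H / 2. This asks for H \<ge> 12 / a, that is, for a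
      derivative of a above 12.\<close>
    obtain \<eta> where \<eta>: "0 < \<eta>" "\<And>t. 0 < t \<Longrightarrow> t < \<eta> \<Longrightarrow> a t < M" "\<And>t. 0 < t \<Longrightarrow> t < \<eta> \<Longrightarrow> 12 < deriv a t"
      using early_times[of M 12, OF M] by metis
    obtain s1 where s1: "s1 \<in> past" "\<tau> s1 < \<eta>"
      using early[OF \<eta>(1)] by auto
    have t1: "0 < \<tau> s" "\<tau> s < \<eta>" if "s \<in> past" "s \<le> s1" for s
      using \<tau>_pos \<tau>_mono[OF pastD(1) pastD(1), of s s1] that s1 pastD by force+
    define Y where "Y s = (\<rho> s) ^ 3 / (a (\<tau> s))\<^sup>2" for s
    have Y_pos: "0 < Y s" if "s \<in> past" for s
      using D[OF pastD(1)[OF that]] by (simp add: Y_def)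
    define Y' where "Y' s = (3 * ((H (\<tau> s) + \<epsilon> * u s / \<rho> s) * \<sigma> s * dt s) - 2 * (H (\<tau> s) * dt s))" for s
    have lnY: "((\<lambda>s. ln (Y s)) has_real_derivative Y' s) (at s)" if s: "s \<in> past" for s
    proof -
      have "((\<lambda>s. 3 * ln (\<rho> s) - 2 * lna s) has_real_derivative Y' s) (at s)"
        unfolding Y'_def by (intro DERIV_diff DERIV_cmult dln\<rho> da\<tau> pastD(1)[OF s])
      moreover have "\<forall>\<^sub>F x in nhds s. ln (Y x) = 3 * ln (\<rho> x) - 2 * lna x"
      proof -
        have "isCont (\<lambda>x. a (\<tau> x)) s"
          using DERIV_isCont[OF DERIV_chain2[OF a_has_derivative d\<tau>]] D(1) pastD(1)[OF s] by blast
        then have "\<forall>\<^sub>F x in nhds s. 0 < a (\<tau> x)"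
          using D(3)[OF pastD(1)[OF s]] by (rule eventually_pos_if_isCont)
        moreover have "\<forall>\<^sub>F x in nhds s. 0 < \<rho> x"
          using DERIV_isCont[OF d\<rho>[OF pastD(1)[OF s]]] D(4)[OF pastD(1)[OF s]]
          by (rule eventually_pos_if_isCont)
        ultimately show ?thesis
          by eventually_elim (simp add: Y_def ln_div ln_realpow)
      qed
      ultimately show ?thesis
        by (simp add: DERIV_cong_ev[OF refl _ refl])
    qed
    \<comment> \<open>In terms of Y the horizon value \<open>hor\<close> is Y / (Y + M). From Y = 5
      M on it is at least 5 / 6, so that 3 \<sigma> - 2 \<ge> 1 / 2 and ln Y cannot increase towards
      the past.\<close>
    define B where "B = max (Y s1) (5 * M)"
    have B: "0 < B" "5 * M \<le> B"
      using M by (simp_all add: B_def)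
    have YB: "Y s \<le> B" if s: "s \<in> past" "s \<le> s1" for s
    proof -
      have sub: "x \<in> past \<and> x \<le> s1" if "x \<in> {s..s1}" for x
        using mem_is_interval_1_I[OF past_interval s(1) s1(1)] that by auto
      have "ln (Y s) \<le> ln B"
      proof (rule backward_barrier[OF s(2)])
        show "((\<lambda>s. ln (Y s)) has_real_derivative Y' x) (at x)" if "x \<in> {s..s1}" for x
          using lnY sub[OF that] by blast
        show "ln (Y s1) \<le> ln B"
          using Y_pos[OF s1(1)] B by (simp add: B_def)
        fix x assume x: "x \<in> {s..s1}" and le: "ln B \<le> ln (Y x)"
        have xp: "x \<in> past" "x \<le> s1"
          using sub[OF x] by auto
        note xI = pastD(1)[OF xp(1)] and Dx = D[OF pastD(1)[OF xp(1)]]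
        note est = early_estimates[OF xI \<eta>(2)[OF t1[OF xp]]]
        have "5 * M \<le> Y x"
          using le B Y_pos[OF xp(1)] by simp
        then have "5 * M * (a (\<tau> x))\<^sup>2 \<le> (\<rho> x) ^ 3"
          using Dx by (simp add: Y_def field_simps)
        then have "5 / 6 \<le> hor M a (\<tau> x) (\<rho> x)"
          using hor_denominator_pos[of M a "\<tau> x" "\<rho> x", OF M Dx(3,4)] by (simp add: hor_def field_simps)
        then have \<sigma>: "5 / 6 \<le> \<sigma> x" "\<sigma> x \<le> 1"
          using \<sigma>_bounds[OF xI] by auto
        have H: "12 / a (\<tau> x) \<le> H (\<tau> x)"
          using \<eta>(3)[OF t1[OF xp]] Dx by (simp add: hubble_def divide_right_mono)
        then have "0 \<le> H (\<tau> x)"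
          using Dx by (intro order_trans[OF _ H]) simp
        then have "(1 / 2) * H (\<tau> x) \<le> (3 * \<sigma> x - 2) * H (\<tau> x)"
          using \<sigma> by (intro mult_right_mono) auto
        moreover have "u x / \<rho> x * \<sigma> x \<le> 2 / a (\<tau> x) * 1"
          using est(4) \<sigma> Dx by (intro mult_mono) auto
        moreover have "6 * (2 / a (\<tau> x)) = 12 / a (\<tau> x)"
          by simp
        ultimately have "0 \<le> (3 * \<sigma> x - 2) * H (\<tau> x) - 3 * (u x / \<rho> x * \<sigma> x)"
          using H by linarith
        then have "0 \<le> ((3 * \<sigma> x - 2) * H (\<tau> x) - 3 * (u x / \<rho> x * \<sigma> x)) * dt x"
          using dt_ge(2)[OF xI] by (intro mult_nonneg_nonneg) auto
        also have "\<dots> = Y' x"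
          unfolding Y'_def ingoing by (simp add: algebra_simps)
        finally show "0 \<le> Y' x" .
      qed
      then show ?thesis
        using Y_pos[OF s(1)] B by simp
    qed
    obtain \<eta>2 where \<eta>2: "0 < \<eta>2" "\<And>t. 0 < t \<Longrightarrow> t < \<eta>2 \<Longrightarrow> 216 * B / M < deriv a t"
      using early_times[of 1 "216 * B / M", OF zero_less_one] by metis
    obtain s2' where s2': "s2' \<in> past" "\<tau> s2' < \<eta>2"
      using early[OF \<eta>2(1)] by auto
    define s2 where "s2 = min s1 s2'"
    have s2: "s2 \<in> past" "s2 \<le> s1" "s2 \<le> s2'"
      using s1 s2' by (auto simp: s2_def min_def)
    have t2: "\<tau> s < \<eta>2" if "s \<in> past" "s \<le> s2" for s
      using \<tau>_mono[OF pastD(1)[OF that(1)] pastD(1)[OF s2'(1)]] that s2 s2' by force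
    \<comment> \<open>\<open>gap_lower\<close> bounds the expansion term in \<open>du\<close> from
      below by M / (108 Y) times the derivative of a, hence by \<open>2 * c\<close> times it. One
      half absorbs the ingoing term, at least -1, by the choice of \<open>\<eta>2\<close>; the other
      half drives \<surd>\<kappa> down.\<close>
    define c where "c = M / (216 * B)"
    have c: "0 < c"
      using M B by (simp add: c_def)
    have mono: "u s - c * lna s \<le> u s2 - c * lna s2" if s: "s \<in> past" "s \<le> s2" for s
    proof (rule mono_from_derivative[where A = "past \<inter> {..s2}" and f = "\<lambda>s. u s - c * lna s" and
          f' = "\<lambda>s. dk s / 2 * (\<rho> s * H (\<tau> s) * gp s + \<epsilon> * \<sigma> s) * dt s
            - c * (H (\<tau> s) * dt s)"])
      fix x assume "x \<in> past \<inter> {..s2}"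
      then have x: "x \<in> past" "x \<le> s2" and x1: "x \<le> s1"
        using s2 by auto
      note xI = pastD(1)[OF x(1)] and Dx = D[OF pastD(1)[OF x(1)]]
      note tx = t1[OF x(1) x1]
      note aM = \<eta>(2)[OF tx]
      note est = early_estimates[OF xI aM]
      show "((\<lambda>s. u s - c * lna s) has_real_derivative
          dk x / 2 * (\<rho> x * H (\<tau> x) * gp x + \<epsilon> * \<sigma> x) * dt x
            - c * (H (\<tau> x) * dt x)) (at x)"
        by (intro DERIV_diff DERIV_cmult du da\<tau> xI)
      have da: "216 * B / M < deriv a (\<tau> x)"
        by (rule \<eta>2(2)[OF tx(1) t2[OF x]])
      moreover have "0 < 216 * B / M"
        using B M by simp
      ultimately have da_pos: "0 < deriv a (\<tau> x)"
        by linarith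
      then have H_pos: "0 < H (\<tau> x)"
        using Dx by (simp add: hubble_def)
      have cB: "c * deriv a (\<tau> x) \<ge> 1"
        using da M B by (simp add: c_def field_simps)
      have "2 * (c * deriv a (\<tau> x)) \<le> \<rho> x * H (\<tau> x) * gp x"
      proof -
        have "2 * c \<le> M / (108 * Y x)"
          unfolding c_def using YB[OF x(1) x1] Y_pos[OF x(1)] M B
          by (simp add: frac_le)
        then have "2 * c * deriv a (\<tau> x) \<le> M / (108 * Y x) * deriv a (\<tau> x)"
          using da_pos by (intro mult_right_mono) auto
        also have "\<dots> = \<rho> x * H (\<tau> x) * (M * (a (\<tau> x)) ^ 3 / (108 * (\<rho> x) ^ 4))"
          using Dx by (simp add: Y_def hubble_def field_simps eval_nat_numeral)
        also have "\<dots> \<le> \<rho> x * H (\<tau> x) * gp x"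
          using gap_lower[OF M Dx(3) aM Dx(4,5)] Dx H_pos by (intro mult_left_mono) auto
        finally show ?thesis
          by (simp add: mult.assoc)
      qed
      then have "c * deriv a (\<tau> x) \<le> \<rho> x * H (\<tau> x) * gp x + \<epsilon> * \<sigma> x"
        using cB \<sigma>_bounds(2)[OF xI] ingoing by simp
      moreover have "1 / a (\<tau> x) \<le> dk x / 2"
      proof -
        have "1 / a (\<tau> x) = a (\<tau> x) / (a (\<tau> x))\<^sup>2"
          using Dx by (simp add: power2_eq_square)
        also have "\<dots> \<le> \<rho> x / (a (\<tau> x))\<^sup>2"
          using est(1) Dx by (intro divide_right_mono) auto
        also have "\<dots> \<le> dk x / 2"
          using M Dx by (simp add: dkappa_def add_divide_distrib)
        finally show ?thesis .
      qed
      ultimately have "1 / a (\<tau> x) * (c * deriv a (\<tau> x)) \<le> dk x / 2 *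
          (\<rho> x * H (\<tau> x) * gp x + \<epsilon> * \<sigma> x)"
        using c da_pos Dx dkappa_pos[of M a "\<tau> x" "\<rho> x", OF M Dx(3,4)] by (intro mult_mono) auto
      then have "c * H (\<tau> x) * dt x \<le> dk x / 2 *
          (\<rho> x * H (\<tau> x) * gp x + \<epsilon> * \<sigma> x) * dt x"
        using dt_ge(2)[OF xI] by (intro mult_right_mono) (auto simp: hubble_def)
      then show "0 \<le> dk x / 2 *
          (\<rho> x * H (\<tau> x) * gp x + \<epsilon> * \<sigma> x) * dt x - c * (H (\<tau> x) * dt x)"
        by (simp only: mult.assoc diff_ge_0_iff_ge)
    qed (use s s2 past_downward[OF s2(1)] in auto)
    \<comment> \<open>The value of a at which the bound \<open>u s2 + c * (ln a - lna s2)\<close> on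
      \<surd>\<kappa> reaches 0.\<close>
    define \<delta> where "\<delta> = exp (lna s2 - u s2 / c)"
    have "0 < \<delta>"
      by (simp add: \<delta>_def)
    obtain \<eta>3 where \<eta>3: "0 < \<eta>3" "\<And>t. 0 < t \<Longrightarrow> t < \<eta>3 \<Longrightarrow> a t < \<delta>"
      using early_times[of \<delta> 0, OF \<open>0 < \<delta>\<close>] by metis
    obtain s3' where s3': "s3' \<in> past" "\<tau> s3' < \<eta>3"
      using early[OF \<eta>3(1)] by auto
    define s3 where "s3 = min s2 s3'"
    have s3: "s3 \<in> past" "s3 \<le> s2" "s3 \<le> s3'"
      using s2 s3' by (auto simp: s3_def min_def)
    have "\<tau> s3 < \<eta>3"
      using \<tau>_mono[OF pastD(1)[OF s3(1)] pastD(1)[OF s3'(1)] s3(3)] s3' by simp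
    then have "a (\<tau> s3) < \<delta>"
      using \<eta>3(2) \<tau>_pos pastD(1)[OF s3(1)] by blast
    then have "lna s3 < lna s2 - u s2 / c"
      using D(3)[OF pastD(1)[OF s3(1)]] unfolding \<delta>_def by (metis exp_less_cancel_iff exp_ln)
    then have "c * lna s3 < c * (lna s2 - u s2 / c)"
      using c by (rule mult_strict_left_mono)
    moreover have "c * (lna s2 - u s2 / c) = c * lna s2 - u s2"
      using c by (simp add: right_diff_distrib)
    ultimately have "u s3 < 0"
      using mono[OF s3(1,2)] by linarith
    then show False
      using \<sigma>_bounds(4)[OF pastD(1)[OF s3(1)]] by simp
  qed
  then show ?thesis
    using that by blast
qed

lemma H_\<sigma>_bounded_below:
  obtains C where "0 \<le> C" "\<And>s. s \<in> past \<Longrightarrow> - C \<le> H (\<tau> s) * \<sigma> s"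
proof -
  obtain C where C: "0 \<le> C" "\<And>t. 0 < t \<Longrightarrow> t \<le> \<tau> 0 \<Longrightarrow> - C \<le> H t"
    using H_bounded_below by metis
  show ?thesis
  proof (rule that[OF C(1)])
    fix s assume s: "s \<in> past"
    have "- C * 1 \<le> - C * \<sigma> s"
      using C(1) \<sigma>_bounds[OF pastD(1)[OF s]] by (simp add: mult_left_le)
    also have "\<dots> \<le> H (\<tau> s) * \<sigma> s"
      using C(2)[OF \<tau>_pos[OF pastD(1)[OF s]] \<tau>_le[OF s]] \<sigma>_bounds(1)[OF pastD(1)[OF s]]
      by (intro mult_right_mono) auto
    finally show "- C \<le> H (\<tau> s) * \<sigma> s"
      by simp
  qed
qed

lemma past_finite: "bdd_below past"
proof (cases "\<epsilon> = 1")
  case True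
  obtain C where C: "0 \<le> C" "\<And>s. s \<in> past \<Longrightarrow> - C \<le> H (\<tau> s) * \<sigma> s"
    using H_\<sigma>_bounded_below by metis
  show ?thesis
  proof (rule past_bounded_below[OF C(1)])
    fix s assume s: "s \<in> past"
    have "- C \<le> H (\<tau> s) * \<sigma> s"
      by (rule C(2)[OF s])
    then show "- C \<le> H (\<tau> s) * \<sigma> s + \<epsilon> * drift s"
      using True drift_nonneg[OF pastD(1)[OF s]] by simp
  qed
next
  case False
  then have ingoing: "\<epsilon> = -1"
    using eps by simp
  obtain T where T: "0 < T" "\<And>s. s \<in> past \<Longrightarrow> T \<le> \<tau> s"
    using ingoing_time_bounded_below[OF ingoing] by metis
  obtain C where C: "0 \<le> C" "\<And>s. s \<in> past \<Longrightarrow> - C \<le> H (\<tau> s) * \<sigma> s"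
    using H_\<sigma>_bounded_below by metis
  obtain C' where C': "0 \<le> C'" "\<And>s. s \<in> past \<Longrightarrow> drift s \<le> C'"
    using drift_bounded[OF T] by metis
  show ?thesis
  proof (rule past_bounded_below[of "C + C'"])
    fix s assume s: "s \<in> past"
    have "- C \<le> H (\<tau> s) * \<sigma> s"
      by (rule C(2)[OF s])
    then show "- (C + C') \<le> H (\<tau> s) * \<sigma> s + \<epsilon> * drift s"
      using ingoing C'(2)[OF s] by simp
  qed (use C C' in simp)
qed

end

section \<open>The limit of the ray at its past end\<close>

context null_curve
begin

text \<open>t decreases to a limit in any case. If that limit is positive,
  \<open>\<rho>_bounds\<close> and \<open>drift_bounded\<close> control r and ln E; convergence of
  ln E, not only of E, is what keeps the limit energy positive.\<close>

lemma past_limit: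
  assumes past: "past = {l<..0}" and "l < 0"
  obtains t' r' E' where "((\<lambda>s. (\<tau> s, \<rho> s)) \<longlongrightarrow> (t', r')) (at_right l)"
    and "t' = 0 \<and> r' = 0 \<or> (t' \<in> dom \<and> 0 < r' \<and> 0 \<le> \<kappa> t' r' \<and> 0 < E' \<and> (E \<longlongrightarrow> E') (at_right l))"
proof -
  have ev: "\<forall>\<^sub>F s in at_right l. s \<in> past \<and> s \<le> b" if "l < b" "b \<le> 0" for b
    unfolding past eventually_at_right_field using that by (intro exI[of _ b]) auto
  have ev0: "\<forall>\<^sub>F s in at_right l. s \<in> I"
    using ev[OF \<open>l < 0\<close> order_refl] by eventually_elim (simp add: pastD)
  define t' where "t' = Inf (\<tau> ` {l<..0})"
  have \<tau>_lim: "(\<tau> \<longlongrightarrow> t') (at_right l)"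
    unfolding t'_def
  proof (rule mono_tendsto_at_right[OF \<open>l < 0\<close>])
    show "\<tau> x \<le> \<tau> y" if "l < x" "x \<le> y" "y \<le> 0" for x y
      using that past by (intro \<tau>_mono pastD) auto
    show "0 \<le> \<tau> x" if "l < x" "x \<le> 0" for x
      using that past \<tau>_pos[of x] pastD(1)[of x] by auto
  qed
  have t'_le: "t' \<le> \<tau> s" if "s \<in> past" for s
    unfolding t'_def past[symmetric] using that \<tau>_pos pastD(1)
    by (intro cInf_lower) (auto intro!: bdd_belowI[of _ 0] less_imp_le)
  have "0 \<le> t'"
    unfolding t'_def past[symmetric] using zero_past \<tau>_pos pastD(1)
    by (intro cInf_greatest) (auto intro: less_imp_le)
  show ?thesis
  proof (cases "t' = 0")
    case True
    have \<tau>0: "filterlim \<tau> (at_right 0) (at_right l)"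
      unfolding filterlim_at
    proof
      show "\<forall>\<^sub>F s in at_right l. \<tau> s \<in> {0<..} \<and> \<tau> s \<noteq> 0"
        using ev0 by eventually_elim (use \<tau>_pos in force)
    qed (use \<tau>_lim True in simp)
    have a0: "((\<lambda>s. a (\<tau> s)) \<longlongrightarrow> 0) (at_right l)"
      by (rule filterlim_compose[OF a_lim \<tau>0])
    have "filterlim (\<lambda>s. a (\<tau> s)) (at_right 0) (at_right l)"
      unfolding filterlim_at
    proof
      show "\<forall>\<^sub>F s in at_right l. a (\<tau> s) \<in> {0<..} \<and> a (\<tau> s) \<noteq> 0"
        using ev0 by eventually_elim (use D(3) in force)
    qed (rule a0)
    then have lna: "filterlim (\<lambda>s. lna s) at_bot (at_right l)"
      by (rule filterlim_compose[OF ln_at_0])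
    \<comment> \<open>With the derivative of a above 4, H is at least twice the bound 2 / a on
      \<surd>\<kappa> / r, so half of H survives for either orientation. As \<sigma> \<ge> 1 / 2, ln
      r grows at least a quarter as fast as ln a: this is the exponent 1 / 4.\<close>
    obtain \<eta> where \<eta>: "0 < \<eta>" "\<And>t. 0 < t \<Longrightarrow> t < \<eta> \<Longrightarrow> a t < M" "\<And>t. 0 < t \<Longrightarrow> t < \<eta> \<Longrightarrow> 4 < deriv a t"
      using early_times[of M 4, OF M] by metis
    have "\<forall>\<^sub>F s in at_right l. \<tau> s < \<eta>"
      using \<tau>_lim True \<eta>(1) by (auto dest: order_tendstoD)
    from eventually_happens'[OF _ eventually_conj[OF this ev[of 0]]]
    obtain s1 where s1: "s1 \<in> past" "\<tau> s1 < \<eta>"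
      using \<open>l < 0\<close> by auto
    define K where "K = ln (\<rho> s1) - 1 / 4 * lna s1"
    have le: "\<rho> s \<le> exp (K + 1 / 4 * lna s)" if s: "s \<in> past" "s \<le> s1" for s
    proof -
      have "ln (\<rho> s) - 1 / 4 * lna s \<le> ln (\<rho> s1) - 1 / 4 * lna s1"
      proof (rule mono_from_derivative[where A = "past \<inter> {..s1}" and f = "\<lambda>s. ln (\<rho> s) - 1 / 4 * lna s" and
          f' = "\<lambda>s. (H (\<tau> s) + \<epsilon> * u s / \<rho> s) * \<sigma> s * dt s - 1 / 4 * (H (\<tau> s) * dt s)"])
        fix x assume "x \<in> past \<inter> {..s1}"
        then have x: "x \<in> past" "x \<le> s1"
          by auto
        note xI = pastD(1)[OF x(1)] and Dx = D[OF pastD(1)[OF x(1)]]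
        have tx: "0 < \<tau> x" "\<tau> x < \<eta>"
          using \<tau>_pos[OF xI] \<tau>_mono[OF xI pastD(1)[OF s1(1)] x(2)] s1 by auto
        note est = early_estimates[OF xI \<eta>(2)[OF tx]]
        show "((\<lambda>s. ln (\<rho> s) - 1 / 4 * lna s) has_real_derivative
            (H (\<tau> x) + \<epsilon> * u x / \<rho> x) * \<sigma> x * dt x - 1 / 4 * (H (\<tau> x) * dt x)) (at x)"
          by (intro DERIV_diff DERIV_cmult dln\<rho> da\<tau> xI)
        have H: "4 / a (\<tau> x) \<le> H (\<tau> x)"
          using \<eta>(3)[OF tx] Dx by (simp add: hubble_def divide_right_mono)
        have "- (2 / a (\<tau> x)) \<le> \<epsilon> * u x / \<rho> x"
          using est(4) eps \<sigma>_bounds(4)[OF xI] Dx by (auto intro: order_trans[of _ 0])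
        moreover have "2 * (2 / a (\<tau> x)) = 4 / a (\<tau> x)" "0 < 2 / a (\<tau> x)"
          using Dx by simp_all
        ultimately have low: "1 / 2 * H (\<tau> x) \<le> H (\<tau> x) + \<epsilon> * u x / \<rho> x" and H_pos: "0 < H (\<tau> x)"
          using H by linarith+
        have "1 / 4 * H (\<tau> x) = 1 / 2 * H (\<tau> x) * (1 / 2)"
          by simp
        also have "\<dots> \<le> (H (\<tau> x) + \<epsilon> * u x / \<rho> x) * \<sigma> x"
        proof (rule mult_mono[OF low est(3)])
          show "0 \<le> H (\<tau> x) + \<epsilon> * u x / \<rho> x"
            using low H_pos by linarith
        qed simp
        finally have "1 / 4 * H (\<tau> x) * dt x \<le> (H (\<tau> x) + \<epsilon> * u x / \<rho> x) * \<sigma> x * dt x"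
          using dt_ge(2)[OF xI] by (intro mult_right_mono) auto
        then show "0 \<le> (H (\<tau> x) + \<epsilon> * u x / \<rho> x) * \<sigma> x * dt x - 1 / 4 * (H (\<tau> x) * dt x)"
          by (simp only: mult.assoc diff_ge_0_iff_ge)
      qed (use s s1 past_downward[OF s1(1)] in auto)
      then have "ln (\<rho> s) \<le> K + 1 / 4 * lna s"
        by (simp add: K_def)
      then show ?thesis
        using D(4)[OF pastD(1)[OF s(1)]] by (metis exp_le_cancel_iff exp_ln)
    qed
    have "filterlim (\<lambda>s. 1 / 4 * lna s) at_bot (at_right l)"
      by (rule filterlim_tendsto_pos_mult_at_bot[OF tendsto_const _ lna]) simp
    then have "((\<lambda>s. exp (1 / 4 * lna s)) \<longlongrightarrow> 0) (at_right l)"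
      by (rule filterlim_compose[OF exp_at_bot])
    from tendsto_mult[OF tendsto_const[of "exp K"] this]
    have bound: "((\<lambda>s. exp (K + 1 / 4 * lna s)) \<longlongrightarrow> 0) (at_right l)"
      by (simp add: exp_add)
    have "(\<rho> \<longlongrightarrow> 0) (at_right l)"
    proof (rule tendsto_sandwich[OF _ _ tendsto_const bound])
      have "l < s1" "s1 \<le> 0"
        using s1(1) by (auto simp: past)
      from ev[OF this] show "\<forall>\<^sub>F s in at_right l. \<rho> s \<le> exp (K + 1 / 4 * lna s)"
        by eventually_elim (use le in blast)
      show "\<forall>\<^sub>F s in at_right l. 0 \<le> \<rho> s"
        using ev0 by eventually_elim (simp add: D(4) less_imp_le)
    qed
    \<comment> \<open>The third 0 is a placeholder for \<open>E'\<close>, on which the alternative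
      of the origin puts no condition.\<close>
    from that[of 0 0 0] tendsto_Pair[OF \<tau>_lim this] True show ?thesis
      by simp
  next
    case False
    then have T: "0 < t'" "\<And>s. s \<in> past \<Longrightarrow> t' \<le> \<tau> s"
      using \<open>0 \<le> t'\<close> t'_le by auto
    have t'dom: "t' \<in> dom"
      using dom_downward[OF T(1) T(2)[OF zero_past]] .
    obtain C where C: "0 < C" "\<And>t. t' \<le> t \<Longrightarrow> t \<le> \<tau> 0 \<Longrightarrow> \<bar>H t\<bar> \<le> C \<and> a t \<le> C \<and> 1 / a t \<le> C"
      using compact_bounds[OF T(1)] by metis
    have HC: "\<bar>H (\<tau> s)\<bar> \<le> C" "1 / a (\<tau> s) \<le> C" if "s \<in> past" for s
      using C(2)[OF T(2)[OF that] \<tau>_le[OF that]] by auto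
    obtain m R where lR: "0 < m" "\<And>s. s \<in> past \<Longrightarrow> m \<le> \<rho> s \<and> \<rho> s \<le> R"
      using \<rho>_bounds[OF T] by metis
    obtain G where G: "0 \<le> G" "\<And>s. s \<in> past \<Longrightarrow> drift s \<le> G"
      using drift_bounded[OF T] by metis
    have R: "0 < R"
      using lR(1) lR(2)[OF zero_past] by linarith
    have u_bound: "u s \<le> 1 + R * C" if s: "s \<in> past" for s
    proof -
      have "C * \<rho> s \<le> C * R"
        using lR(2)[OF s] C by simp
      then show ?thesis
        using u_le[OF pastD(1)[OF s] HC(2)[OF s]] by (simp add: mult.commute)
    qed
    obtain r' where r': "(\<rho> \<longlongrightarrow> r') (at_right l)"
    proof -
      have "\<exists>r'. (\<rho> \<longlongrightarrow> r') (at_right l)"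
      proof (rule tendsto_if_dominated_derivative[OF \<open>l < 0\<close> _ _ _ \<tau>_lim, folded past])
        fix s assume s: "s \<in> past"
        note sI = pastD(1)[OF s]
        show "(\<rho> has_real_derivative E s * (\<rho> s * H (\<tau> s) + \<epsilon> * u s)) (at s)"
          "(\<tau> has_real_derivative dt s) (at s)" "t' \<le> \<tau> s"
          using d\<rho>[OF sI] d\<tau>[OF sI] T(2)[OF s] by auto
        have "\<bar>\<rho> s * H (\<tau> s)\<bar> \<le> R * C"
          unfolding abs_mult using HC(1)[OF s] lR(1) lR(2)[OF s] R by (intro mult_mono) auto
        moreover have "\<bar>\<epsilon> * u s\<bar> \<le> 1 + R * C"
          using u_bound[OF s] eps \<sigma>_bounds(4)[OF sI] by (auto simp: abs_mult)
        ultimately have "\<bar>\<rho> s * H (\<tau> s) + \<epsilon> * u s\<bar> \<le> 1 + 2 * (R * C)"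
          by linarith
        then have "E s * \<bar>\<rho> s * H (\<tau> s) + \<epsilon> * u s\<bar> \<le> dt s * (1 + 2 * (R * C))"
          using dt_ge[OF sI] E_pos[OF sI] by (intro mult_mono) auto
        then show "\<bar>E s * (\<rho> s * H (\<tau> s) + \<epsilon> * u s)\<bar> \<le> (1 + 2 * (R * C)) * dt s"
          using E_pos[OF sI] by (simp add: abs_mult mult.commute)
      qed (use R C in auto)
      then show ?thesis
        using that by blast
    qed
    obtain e where e: "((\<lambda>s. ln (E s)) \<longlongrightarrow> e) (at_right l)"
    proof -
      have "\<exists>e. ((\<lambda>s. ln (E s)) \<longlongrightarrow> e) (at_right l)"
      proof (rule tendsto_if_dominated_derivative[OF \<open>l < 0\<close> _ _ _ \<tau>_lim, folded past])
        fix s assume s: "s \<in> past"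
        note sI = pastD(1)[OF s]
        show "((\<lambda>s. ln (E s)) has_real_derivative - (H (\<tau> s) * \<sigma> s + \<epsilon> * drift s) * dt s) (at s)"
          "(\<tau> has_real_derivative dt s) (at s)" "t' \<le> \<tau> s"
          using dlnE[OF sI] d\<tau>[OF sI] T(2)[OF s] by auto
        have "\<bar>H (\<tau> s) * \<sigma> s\<bar> \<le> C * 1"
          unfolding abs_mult using HC(1)[OF s] \<sigma>_bounds[OF sI] by (intro mult_mono) auto
        moreover have "\<bar>\<epsilon> * drift s\<bar> \<le> G"
          using G(2)[OF s] drift_nonneg[OF sI] eps unfolding abs_mult by auto
        ultimately have "\<bar>H (\<tau> s) * \<sigma> s + \<epsilon> * drift s\<bar> \<le> C + G"
          by linarith
        then have "\<bar>H (\<tau> s) * \<sigma> s + \<epsilon> * drift s\<bar> * dt s \<le> (C + G) * dt s"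
          using dt_ge(2)[OF sI] by (intro mult_right_mono) auto
        then show "\<bar>- (H (\<tau> s) * \<sigma> s + \<epsilon> * drift s) * dt s\<bar> \<le> (C + G) * dt s"
          unfolding abs_mult abs_minus using dt_ge(2)[OF sI] by (simp only: abs_of_pos)
      qed (use G C in auto)
      then show ?thesis
        using that by blast
    qed
    have E_lim: "(E \<longlongrightarrow> exp e) (at_right l)"
    proof (rule Lim_transform_eventually[OF tendsto_exp[OF e]])
      show "\<forall>\<^sub>F s in at_right l. exp (ln (E s)) = E s"
        using ev0 by eventually_elim (simp add: E_pos)
    qed
    have "0 < r'"
    proof -
      have "m \<le> r'"
        by (rule tendsto_lowerbound[OF r' eventually_mono[OF ev[OF \<open>l < 0\<close> order_refl]]]) (use lR in auto)
      then show ?thesis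
        using lR by simp
    qed
    have pair: "((\<lambda>s. (\<tau> s, \<rho> s)) \<longlongrightarrow> (t', r')) (at_right l)"
      by (rule tendsto_Pair[OF \<tau>_lim r'])
    have "isCont (\<lambda>z. \<kappa> (fst z) (snd z)) (t', r')"
      by (rule differentiable_imp_continuous_within[OF kappa_differentiable[OF t'dom \<open>0 < r'\<close>]])
    from isCont_tendsto_compose[OF this pair]
    have "((\<lambda>s. \<kappa> (\<tau> s) (\<rho> s)) \<longlongrightarrow> \<kappa> t' r') (at_right l)"
      by simp
    then have "0 \<le> \<kappa> t' r'"
      by (rule tendsto_lowerbound[OF _ eventually_mono[OF ev0]]) (simp_all add: D(5) less_imp_le)
    then show ?thesis
      using that[OF pair, of "exp e"] t'dom \<open>0 < r'\<close> E_lim by simp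
  qed
qed

end

section \<open>Extension beyond an interior limit point\<close>

context mcvittie
begin

text \<open>With t as independent variable the system is triangular. The equation for r does not
  contain E and is solved by Picard iteration; then E is the exponential of an integral, and the
  affine parameter is an integral of S / E, inverted at the end. The rectangle \<open>K\<close>
  extends only to the past of \<open>t'\<close>.\<close>

lemma null_curve_backward_extension:
  assumes inside: "(t', r') \<in> \<Omega>" and E': "0 < E'"
  obtains d \<tau> \<rho> E where "0 < d" "\<tau> l = t'" "\<rho> l = r'" "E l = E'"
    "continuous_on {l - d..l} \<tau>" "continuous_on {l - d..l} \<rho>" "continuous_on {l - d..l} E"
    "\<And>s. s \<in> {l - d<..<l} \<Longrightarrow> (\<tau> s, \<rho> s) \<in> \<Omega> \<and> 0 < E s \<and>
      (\<tau> has_real_derivative E s / S (\<tau> s) (\<rho> s)) (at s) \<and>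
      (\<rho> has_real_derivative rate_r \<epsilon> (\<tau> s) (\<rho> s) (E s)) (at s) \<and>
      (E has_real_derivative
        rate_E \<epsilon> (\<tau> s) (\<rho> s) (E s)) (at s)"
proof -
  obtain A B where AB: "open A" "open B" "(t', r') \<in> A \<times> B" "A \<times> B \<subseteq> \<Omega>"
    using open_prod_elim[OF open_\<Omega> inside] by auto
  obtain d1 where d1: "0 < d1" "cball t' d1 \<subseteq> A"
    using AB open_contains_cball by blast
  obtain d2 where d2: "0 < d2" "cball r' d2 \<subseteq> B"
    using AB open_contains_cball by blast
  define K where "K = {t' - d1..t'} \<times> {r' - d2..r' + d2}"
  have K: "z \<in> \<Omega>" if "z \<in> K" for z
  proof -
    have "fst z \<in> cball t' d1" "snd z \<in> cball r' d2"
      using that by (auto simp: K_def dist_real_def mem_Times_iff)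
    then show ?thesis
      using AB(4) d1(2) d2(2) by (metis mem_Times_iff subsetD)
  qed
  have KD: "t \<in> dom" "0 < a t" "0 < r" "0 < \<kappa> t r" "0 < S t r" if "(t, r) \<in> K" for t r
    using \<Omega>_D[OF K[OF that]] sigma_over_H_pos[OF M \<Omega>_D(3-5)[OF K[OF that]]] by auto
  have compactK: "compact K"
    unfolding K_def by (intro compact_Times) auto
  define f where "f t r = S t r * (r * H t + \<epsilon> * sqrt (\<kappa> t r))" for t r
  define f' where "f' t r = S t r * dlnS M a t r * (r * H t + \<epsilon> * sqrt (\<kappa> t r)) +
    (H t + \<epsilon> * (dkappa M a t r / (2 * sqrt (\<kappa> t r)))) * S t r" for t r
  define q where "q t r = (H t + \<epsilon> * sqrt (\<kappa> t r) * dlnS M a t r) * S t r" for t r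
  have SC: "continuous_on K (\<lambda>z. S (fst z) (snd z))"
    by (rule continuous_on_subset[OF S_continuous]) (use K in auto)
  have uC: "continuous_on K (\<lambda>z. sqrt (\<kappa> (fst z) (snd z)))"
    by (rule continuous_on_subset[OF sqrt_kappa_continuous]) (use K in auto)
  have HC: "continuous_on K (\<lambda>z. H (fst z))"
    by (rule continuous_on_compose2[OF H_continuous]) (use KD in \<open>auto intro!: continuous_intros\<close>)
  have aC: "continuous_on K (\<lambda>z. a (fst z))"
    by (rule continuous_on_compose2[OF a_continuous]) (use KD in \<open>auto intro!: continuous_intros\<close>)
  have ne: "snd z \<noteq> 0" "a (fst z) \<noteq> 0" "sqrt (\<kappa> (fst z) (snd z)) \<noteq> 0" "S (fst z) (snd z) \<noteq> 0" if "z \<in> K" for z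
    using KD[of "fst z" "snd z"] that by simp_all
  have kC: "continuous_on K (\<lambda>z. dkappa M a (fst z) (snd z))"
    unfolding dkappa_def using ne by (intro continuous_intros aC) auto
  have "continuous_on K (\<lambda>z. (dkappa M a (fst z) (snd z) / 2 - snd z / ((a (fst z))\<^sup>2 * S (fst z) (snd z))) /
      (sqrt (\<kappa> (fst z) (snd z)))\<^sup>2)"
    using ne by (intro continuous_intros aC SC uC kC) auto
  then have lC: "continuous_on K (\<lambda>z. dlnS M a (fst z) (snd z))"
    by (rule continuous_on_eq) (use KD in \<open>auto simp: dlnS_def less_imp_le\<close>)
  have fC: "continuous_on K (\<lambda>z. f (fst z) (snd z))"
    unfolding f_def by (intro continuous_intros SC HC uC)
  have f'C: "continuous_on K (\<lambda>z. f' (fst z) (snd z))"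
    unfolding f'_def using ne by (intro continuous_intros SC HC uC lC kC) auto
  have qC: "continuous_on K (\<lambda>z. q (fst z) (snd z))"
    unfolding q_def by (intro continuous_intros SC HC uC lC)
  obtain L where L: "\<And>z. z \<in> K \<Longrightarrow> \<bar>f' (fst z) (snd z)\<bar> \<le> L"
    using compact_imp_bounded[OF compact_continuous_image[OF f'C compactK]] by (auto simp: bounded_iff)
  have L0: "0 \<le> L"
    using L[of "(t', r')"] d1 d2 by (auto simp: K_def intro: order_trans[OF abs_ge_zero])
  have fder: "(f t has_real_derivative f' t r) (at r)" if "(t, r) \<in> K" for t r
  proof -
    note D = \<Omega>_D[OF K[OF that]]
    show ?thesis
      unfolding f_def f'_def
      by (rule DERIV_cong[OF DERIV_mult[OF sigma_over_H_has_derivative_r[OF M D(3-5)]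
        DERIV_add[OF DERIV_cmult_right[OF DERIV_ident] DERIV_cmult[OF sqrt_kappa_has_derivative[OF M D(3-5)]]]]])
        simp
  qed
  \<comment> \<open>Clamping r to the rectangle is 1-Lipschitz and turns the Lipschitz bound on
    \<open>K\<close> into a global one.\<close>
  define cl where "cl x = max (r' - d2) (min (r' + d2) x)" for x
  have cl: "cl x \<in> {r' - d2..r' + d2}" "\<bar>cl x - cl y\<bar> \<le> \<bar>x - y\<bar>" for x y
    using d2 by (auto simp: cl_def)
  define c where "c = max (t' - d1) (t' - 1 / (2 * (L + 1)))"
  have c: "t' - d1 \<le> c" "c < t'" "L * (t' - c) < 1"
  proof -
    show "t' - d1 \<le> c" "c < t'"
      using d1 L0 by (auto simp: c_def)
    have "L * (t' - c) \<le> L * (1 / (2 * (L + 1)))"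
      using L0 by (intro mult_left_mono) (auto simp: c_def)
    also have "\<dots> < 1"
      using L0 by (simp add: field_simps)
    finally show "L * (t' - c) < 1" .
  qed
  have clK: "(t, cl x) \<in> K" if "t \<in> {c..t'}" for t x
    using that c cl by (auto simp: K_def)
  obtain R where R: "R t' = r'"
    "\<And>t. t \<in> {c..t'} \<Longrightarrow> (R has_real_derivative f t (cl (R t))) (at t within {c..t'})"
  proof (rule picard_terminal_value[of c t' "\<lambda>t x. f t (cl x)" L r'])
    have "continuous_on ({c..t'} \<times> UNIV) (\<lambda>z. f (fst (fst z, cl (snd z))) (snd (fst z, cl (snd z))))"
      by (rule continuous_on_compose2[OF fC])
        (use clK in \<open>auto simp: cl_def intro!: continuous_intros\<close>)
    then show "continuous_on ({c..t'} \<times> UNIV) (\<lambda>(t, x). f t (cl x))"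
      by (simp add: case_prod_unfold)
    fix t x y assume t: "t \<in> {c..t'}"
    have "norm (f t (cl x) - f t (cl y)) \<le> L * norm (cl x - cl y)"
    proof (rule field_differentiable_bound[of "{r' - d2..r' + d2}"])
      fix z assume "z \<in> {r' - d2..r' + d2}"
      then have z: "(t, z) \<in> K"
        using t c by (auto simp: K_def)
      show "(f t has_field_derivative f' t z) (at z within {r' - d2..r' + d2})"
        by (rule has_field_derivative_at_within[OF fder[OF z]])
      show "norm (f' t z) \<le> L"
        using L[OF z] by simp
    qed (use cl in auto)
    also have "\<dots> \<le> L * \<bar>x - y\<bar>"
      using cl(2) L0 by (intro mult_left_mono) auto
    finally show "\<bar>f t (cl x) - f t (cl y)\<bar> \<le> L * \<bar>x - y\<bar>"
      by simp
  qed (use c L0 in auto)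
  have RC: "continuous_on {c..t'} R"
    by (rule DERIV_continuous_on[OF R(2)])
  \<comment> \<open>By continuity the solution stays in the rectangle for a shorter time, and there
    the clamp is the identity.\<close>
  obtain c' where c': "c \<le> c'" "c' < t'" "\<And>t. t \<in> {c'..t'} \<Longrightarrow> (t, R t) \<in> K \<and> cl (R t) = R t"
  proof -
    have "t' \<in> {c..t'}"
      using c by simp
    then obtain e where e: "0 < e" "\<And>t. t \<in> {c..t'} \<Longrightarrow> dist t t' < e \<Longrightarrow> dist (R t) (R t') < d2"
      using RC d2(1) unfolding continuous_on_iff by blast
    show ?thesis
    proof (rule that[of "max c (t' - e / 2)"])
      fix t assume t: "t \<in> {max c (t' - e / 2)..t'}"
      then have "\<bar>R t - r'\<bar> < d2"
        using e(2)[of t] e(1) R(1) by (auto simp: dist_real_def)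
      then show "(t, R t) \<in> K \<and> cl (R t) = R t"
        using t c by (auto simp: K_def cl_def abs_less_iff)
    qed (use c e in auto)
  qed
  have sub: "{c'..t'} \<subseteq> {c..t'}"
    using c' by auto
  have dR: "(R has_real_derivative f t (R t)) (at t within {c'..t'})" if "t \<in> {c'..t'}" for t
    using DERIV_subset[OF R(2) sub, of t] c'(3)[OF that] that sub by auto
  have comp: "continuous_on {c'..t'} (\<lambda>t. G (fst (t, R t)) (snd (t, R t)))"
    if "continuous_on K (\<lambda>z. G (fst z) (snd z))" for G :: "real \<Rightarrow> real \<Rightarrow> real"
    by (rule continuous_on_compose2[OF that])
      (use c' continuous_on_subset[OF RC sub] in \<open>auto intro!: continuous_intros\<close>)
  \<comment> \<open>E as a function of t: the energy equation divided by t' is linear, with rate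
    \<open>- q\<close>.\<close>
  define F where "F t = E' * exp (integral {t..t'} (\<lambda>t. q t (R t)))" for t
  have F_pos: "0 < F t" for t
    using E' by (simp add: F_def)
  have dF: "(F has_real_derivative - q t (R t) * F t) (at t within {c'..t'})" if "t \<in> {c'..t'}" for t
    unfolding F_def
    by (rule DERIV_cong[OF DERIV_cmult[OF DERIV_chain2[OF DERIV_exp integral_has_real_derivative']]])
      (use comp[OF qC] that in auto)
  \<comment> \<open>ds/dt along the solution; integrated in \<open>\<phi>\<close>, normalised so
    that \<open>t'\<close> corresponds to the parameter \<open>l\<close>.\<close>
  define w where "w t = S t (R t) / F t" for t
  have w_pos: "0 < w t" if "t \<in> {c'..t'}" for t
    using KD(5)[of t "R t"] c'(3)[OF that] F_pos[of t] by (simp add: w_def)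
  have wC: "continuous_on {c'..t'} w"
    unfolding w_def using comp[OF SC] DERIV_continuous_on[OF dF] F_pos
    by (intro continuous_intros) (auto simp: less_imp_neq[symmetric])
  define \<phi> where "\<phi> t = l - integral {t..t'} w" for t
  have d\<phi>: "(\<phi> has_real_derivative w t) (at t within {c'..t'})" if "t \<in> {c'..t'}" for t
    unfolding \<phi>_def
    by (rule DERIV_cong[OF DERIV_diff[OF DERIV_const integral_has_real_derivative'[OF wC that]]]) simp
  obtain g where g: "\<phi> c' < \<phi> t'" "g (\<phi> t') = t'" "continuous_on {\<phi> c'..\<phi> t'} g"
      "\<And>s. s \<in> {\<phi> c'<..<\<phi> t'} \<Longrightarrow> g s \<in> {c'<..<t'}"
      "\<And>s. s \<in> {\<phi> c'<..<\<phi> t'} \<Longrightarrow> (g has_real_derivative 1 / w (g s)) (at s)"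
    using increasing_inverse[OF c'(2) d\<phi> w_pos] by metis
  have \<phi>l: "\<phi> t' = l"
    by (simp add: \<phi>_def)
  have gC: "g ` {\<phi> c'..l} \<subseteq> {c'..t'}"
  proof -
    have "g ` closure {\<phi> c'<..<l} \<subseteq> {c'..t'}"
      by (rule image_closure_subset) (use g(1,3,4) in \<open>auto simp: \<phi>l less_imp_le\<close>)
    then show ?thesis
      using g(1) by (simp add: \<phi>l)
  qed
  show ?thesis
  proof (rule that[of "l - \<phi> c'" g "\<lambda>s. R (g s)" "\<lambda>s. F (g s)"])
    show "0 < l - \<phi> c'" "g l = t'" "R (g l) = r'" "F (g l) = E'"
      using g(1,2) R(1) by (simp_all add: \<phi>l F_def)
    show "continuous_on {l - (l - \<phi> c')..l} g"
      using g(3) by (simp add: \<phi>l)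
    then show "continuous_on {l - (l - \<phi> c')..l} (\<lambda>s. R (g s))" "continuous_on {l - (l - \<phi> c')..l} (\<lambda>s. F (g s))"
      using gC by (auto intro!: continuous_on_compose2[OF continuous_on_subset[OF RC sub]]
          continuous_on_compose2[OF DERIV_continuous_on[OF dF]])
    fix s assume "s \<in> {l - (l - \<phi> c')<..<l}"
    then have s: "s \<in> {\<phi> c'<..<\<phi> t'}"
      by (simp add: \<phi>l)
    have gs: "g s \<in> {c'<..<t'}"
      by (rule g(4)[OF s])
    then have gs': "g s \<in> {c'..t'}"
      by auto
    have Ks: "(g s, R (g s)) \<in> K"
      using c'(3)[OF gs'] by blast
    note S_pos = KD(5)[OF Ks]
    have dg: "(g has_real_derivative F (g s) / S (g s) (R (g s))) (at s)"
      using g(5)[OF s] by (simp add: w_def)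
    have "(R has_real_derivative f (g s) (R (g s))) (at (g s))" "(F has_real_derivative - q (g s) (R (g s)) * F (g s)) (at (g s))"
      using dR[OF gs'] dF[OF gs'] gs by (simp_all add: at_within_Icc_at)
    note DERIV_cong[OF DERIV_chain2[OF this(1) dg]] DERIV_cong[OF DERIV_chain2[OF this(2) dg]]
    then have "((\<lambda>s. R (g s)) has_real_derivative rate_r \<epsilon> (g s) (R (g s)) (F (g s))) (at s)"
      "((\<lambda>s. F (g s)) has_real_derivative rate_E \<epsilon> (g s) (R (g s)) (F (g s))) (at s)"
      using S_pos by (simp_all add: f_def q_def power2_eq_square algebra_simps)
    then show "(g s, R (g s)) \<in> \<Omega> \<and> 0 < F (g s) \<and>
      (g has_real_derivative F (g s) / S (g s) (R (g s))) (at s) \<and>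
      ((\<lambda>s. R (g s)) has_real_derivative rate_r \<epsilon> (g s) (R (g s)) (F (g s))) (at s) \<and>
      ((\<lambda>s. F (g s)) has_real_derivative rate_E \<epsilon> (g s) (R (g s)) (F (g s))) (at s)"
      using K[OF Ks] F_pos dg by blast
  qed
qed

end

section \<open>Vector components and gluing of two solution pieces\<close>

lemma has_vector_derivative_vec_iff:
  fixes f :: "real \<Rightarrow> real^'n"
  shows "(f has_vector_derivative f') (at s) \<longleftrightarrow>
    (\<forall>i. ((\<lambda>s. f s $ i) has_real_derivative f' $ i) (at s))"
proof -
  have "(f has_vector_derivative f') (at s) \<longleftrightarrow>
      (\<forall>i. ((\<lambda>s. f s \<bullet> axis i 1) has_derivative (\<lambda>h. (h *\<^sub>R f') \<bullet> axis i 1)) (at s))"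
    unfolding has_vector_derivative_def
    by (subst has_derivative_componentwise_within) (auto simp: Basis_vec_def)
  also have "\<dots> \<longleftrightarrow> (\<forall>i. ((\<lambda>s. f s $ i) has_real_derivative f' $ i) (at s))"
    by (simp add: inner_axis has_field_derivative_def mult_commute_abs)
  finally show ?thesis .
qed

definition vec4 :: "real \<Rightarrow> real \<Rightarrow> real \<Rightarrow> real \<Rightarrow> real^4" where
  "vec4 p q y z = (\<chi> i. if i = 1 then p else if i = 2 then q else if i = 3 then y else z)"

lemma vec4_nth [simp]:
  "vec4 p q y z $ 1 = p" "vec4 p q y z $ 2 = q" "vec4 p q y z $ 3 = y" "vec4 p q y z $ 4 = z"
  by (simp_all add: vec4_def)

lemma tendsto_glue:
  fixes f g :: "real \<Rightarrow> 'a::topological_space"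
  assumes "(f \<longlongrightarrow> f l) (at_left l)" "(g \<longlongrightarrow> f l) (at_right l)"
  shows "((\<lambda>s. if s \<le> l then f s else g s) \<longlongrightarrow> f l) (at l)"
  unfolding filterlim_at_split
proof
  show "((\<lambda>s. if s \<le> l then f s else g s) \<longlongrightarrow> f l) (at_left l)"
    by (rule Lim_transform_eventually[OF assms(1)]) (auto simp: eventually_at_filter)
  show "((\<lambda>s. if s \<le> l then f s else g s) \<longlongrightarrow> f l) (at_right l)"
    by (rule Lim_transform_eventually[OF assms(2)]) (auto simp: eventually_at_filter)
qed

text \<open>\<open>X\<close> is the right-hand side evaluated along the glued curve. Away from
  \<open>l\<close> one of the pieces applies; at \<open>l\<close> continuity of the curve and of
  \<open>X\<close> suffices, by \<open>has_real_derivative_if_tendsto\<close>.\<close>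

lemma has_real_derivative_glue:
  fixes f g X :: "real \<Rightarrow> real" and l :: real
  defines "h \<equiv> \<lambda>s. if s \<le> l then f s else g s"
  assumes d: "0 < d"
    and f: "\<And>s. s \<in> {l - d<..<l} \<Longrightarrow> (f has_real_derivative X s) (at s)"
    and g: "\<And>s. s \<in> A \<Longrightarrow> (g has_real_derivative X s) (at s)"
    and A: "\<And>s. s \<in> A \<Longrightarrow> l < s" "{l<..0} \<subseteq> A" "l < 0"
    and cont: "isCont h l" "(X \<longlongrightarrow> X l) (at l)"
    and s: "s \<in> {l - d<..l} \<union> A"
  shows "(h has_real_derivative X s) (at s)"
proof -
  have left: "(h has_real_derivative X s) (at s)" if "s \<in> {l - d<..<l}" for s
  proof (rule has_field_derivative_transform_within_open[OF f[OF that], of "{..<l}"])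
    show "f x = h x" if "x \<in> {..<l}" for x
      using that by (simp add: h_def)
  qed (use that in auto)
  have right: "(h has_real_derivative X s) (at s)" if "s \<in> A" for s
  proof (rule has_field_derivative_transform_within_open[OF g[OF that], of "{l<..}"])
    show "g x = h x" if "x \<in> {l<..}" for x
      using that by (simp add: h_def)
  qed (use A(1)[OF that] in auto)
  have "(h has_real_derivative X l) (at l)"
  proof (rule has_real_derivative_if_tendsto[OF cont(1) _ cont(2)])
    have "\<forall>\<^sub>F y in at l. y \<in> {l - d<..<0} - {l}"
      using eventually_at_in_open[of "{l - d<..<0}" l] d A(3) by simp
    then show "\<forall>\<^sub>F y in at l. (h has_real_derivative X y) (at y)"
    proof eventually_elim
      case (elim y)
      then show ?case
        using left[of y] right[of y] subsetD[OF A(2), of y] by (cases "y < l") auto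
    qed
  qed
  then show ?thesis
    using s left right by (cases "s = l") auto
qed

section \<open>Radial null geodesics and their first-order system\<close>

context mcvittie
begin

text \<open>Completing the square in r' diagonalises the radial part of the metric. The condition is
  left squared; the sign is extracted as the orientation of the ray.\<close>

lemma null_vector_iff:
  assumes "(x $ 1, x $ 2) \<in> \<Omega>" "v $ 3 = 0" "v $ 4 = 0"
  shows "v \<bullet> (mcvittie_metric M a x *v v) = 0 \<longleftrightarrow>
    (v $ 2 - H (x $ 1) * S (x $ 1) (x $ 2) * x $ 2 * v $ 1)\<^sup>2 =
      (v $ 1 * S (x $ 1) (x $ 2) * sqrt (\<kappa> (x $ 1) (x $ 2)))\<^sup>2"
proof -
  define t r p q where "t = x $ 1" "r = x $ 2" "p = v $ 1" "q = v $ 2"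
  note defs = this
  note D = \<Omega>_D[OF assms(1), folded defs]
  have "v \<bullet> (mcvittie_metric M a x *v v) = gtt t r * p\<^sup>2 + 2 * gtr t r * p * q + grr t r * q\<^sup>2"
    using assms(2,3) by (simp add: inner_vec_def matrix_vector_mult_def sum_4 metric_entries defs
        power2_eq_square algebra_simps)
  also have "\<dots> = ((q - H t * S t r * r * p)\<^sup>2 - (p * S t r)\<^sup>2 * \<kappa> t r) / \<kappa> t r"
    using D by (simp add: gtt_def gtr_def grr_def sigma_def field_simps power2_eq_square)
  finally show ?thesis
    using D by (simp add: defs power_mult_distrib)
qed

text \<open>The null condition yields a sign at each parameter. It is continuous on a connected
  interval and takes only two values, so it is constant: a ray is outgoing throughout or ingoing
  throughout.\<close>

lemma RNG_imp_null_curve: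
  assumes RNG: "RNG M tf a I \<gamma>" and zero: "0 \<in> I"
    and lims: "(a \<longlongrightarrow> 0) (at_right 0)" "filterlim (deriv a) at_top (at_right 0)"
  obtains \<epsilon> E \<theta> \<phi> where "null_curve M tf a I (\<lambda>s. \<gamma> s $ 1) (\<lambda>s. \<gamma> s $ 2) E \<epsilon>"
    and "0 < \<theta>" "\<theta> < pi" "\<And>s. s \<in> I \<Longrightarrow> \<gamma> s $ 3 = \<theta> \<and> \<gamma> s $ 4 = \<phi>"
proof -
  have I: "open I" "is_interval I"
    and inside: "\<And>s. s \<in> I \<Longrightarrow> (\<gamma> s $ 1, \<gamma> s $ 2) \<in> \<Omega>"
    using RNG by (auto simp: RNG_def Omega_eq)
  obtain \<theta> \<phi> where angles: "0 < \<theta>" "\<theta> < pi" "\<And>s. s \<in> I \<Longrightarrow> \<gamma> s $ 3 = \<theta> \<and> \<gamma> s $ 4 = \<phi>"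
    using RNG unfolding RNG_def by blast
  obtain v where geo: "affine_geodesic (mcvittie_metric M a) I \<gamma> v"
    and v: "\<And>s. s \<in> I \<Longrightarrow> v s \<bullet> (mcvittie_metric M a (\<gamma> s) *v v s) = 0 \<and> 0 < v s $ 1"
    using RNG unfolding RNG_def by blast
  define acc where "acc s = geodesic_acc (mcvittie_metric M a) (\<gamma> s) (v s)" for s
  have d\<gamma>: "((\<lambda>s. \<gamma> s $ i) has_real_derivative v s $ i) (at s)"
    and dv: "((\<lambda>s. v s $ i) has_real_derivative acc s $ i) (at s)" if "s \<in> I" for s i
    using geo that unfolding affine_geodesic_def acc_def[symmetric] has_vector_derivative_vec_iff by blast+
  have nhds: "\<forall>\<^sub>F s' in nhds s. s' \<in> I" if "s \<in> I" for s
    using eventually_nhds_in_open[OF I(1) that] .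
  have const: "D = 0" if "(f has_real_derivative D) (at s)" "s \<in> I" "\<And>s. s \<in> I \<Longrightarrow> f s = c" for f D s and c :: real
    by (rule DERIV_unique_eventually[OF that(1) DERIV_const[of c] eventually_mono[OF nhds[OF that(2)] that(3)]])
  have v34: "v s $ 3 = 0" "v s $ 4 = 0" if "s \<in> I" for s
    using const[OF d\<gamma>[OF that] that] angles(3) by blast+
  have acc34: "acc s $ 3 = 0" "acc s $ 4 = 0" if "s \<in> I" for s
    using const[OF dv[OF that] that] v34 by blast+
  define t r where "t = (\<lambda>s. \<gamma> s $ 1)" "r = (\<lambda>s. \<gamma> s $ 2)"
  note tr = this
  define w where "w s = v s $ 1 * S (t s) (r s) * sqrt (\<kappa> (t s) (r s))" for s
  \<comment> \<open>The quotient of the two sides of the null condition before squaring; dividing is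
    possible because t' > 0 and \<kappa> > 0.\<close>
  define orient where "orient s = (v s $ 2 - H (t s) * S (t s) (r s) * r s * v s $ 1) / w s" for s
  have w: "0 < w s" if "s \<in> I" for s
    using v[OF that] \<Omega>_D(5)[OF inside[OF that]] sigma_over_H_pos[OF M \<Omega>_D(3-5)[OF inside[OF that]]]
    by (simp add: w_def tr)
  have orient: "orient s = 1 \<or> orient s = -1" if "s \<in> I" for s
  proof -
    have "(v s $ 2 - H (t s) * S (t s) (r s) * r s * v s $ 1)\<^sup>2 = (w s)\<^sup>2"
      using null_vector_iff[OF inside[OF that] v34[OF that]] v[OF that] by (simp add: w_def tr)
    then have "(orient s)\<^sup>2 = 1"
      using w[OF that] by (simp add: orient_def power_divide)
    then show ?thesis
      by (simp add: power2_eq_1_iff)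
  qed
  have "orient constant_on I"
  proof (rule continuous_finite_range_constant)
    show "connected I"
      using I(2) by (simp add: is_interval_connected_1)
    have contv: "continuous_on I (\<lambda>s. v s $ i)" for i
      by (rule DERIV_continuous_on[OF has_field_derivative_at_within[OF dv]])
    have cont\<gamma>: "continuous_on I (\<lambda>s. \<gamma> s $ i)" for i
      by (rule DERIV_continuous_on[OF has_field_derivative_at_within[OF d\<gamma>]])
    have "continuous_on I (\<lambda>s. (t s, r s))"
      unfolding tr by (intro continuous_intros cont\<gamma>)
    then have cont: "continuous_on I (\<lambda>s. G (t s) (r s))" if "continuous_on \<Omega> (\<lambda>z. G (fst z) (snd z))"
      for G :: "real \<Rightarrow> real \<Rightarrow> real"
      using continuous_on_compose2[OF that, of I "\<lambda>s. (t s, r s)"] inside by (auto simp: tr)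
    have contH: "continuous_on I (\<lambda>s. H (t s))"
      unfolding tr by (rule continuous_on_compose2[OF H_continuous cont\<gamma>]) (use inside \<Omega>_D(1) in blast)
    have contr: "continuous_on I (\<lambda>s. r s)"
      unfolding tr by (rule cont\<gamma>)
    have "continuous_on I (\<lambda>s. (v s $ 2 - H (t s) * S (t s) (r s) * r s * v s $ 1) /
        (v s $ 1 * S (t s) (r s) * sqrt (\<kappa> (t s) (r s))))"
      by (intro continuous_on_divide continuous_on_diff continuous_on_mult contv contH contr
          cont[OF S_continuous] cont[OF sqrt_kappa_continuous])
        (use less_imp_neq[OF w, symmetric, unfolded w_def] in blast)
    then show "continuous_on I orient"
      unfolding orient_def[abs_def] w_def .
    show "finite (orient ` I)"
      by (rule finite_subset[of _ "{1, -1}"]) (use orient in auto)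
  qed
  then obtain \<epsilon> where \<epsilon>: "\<And>s. s \<in> I \<Longrightarrow> orient s = \<epsilon>"
    by (auto simp: constant_on_def)
  then have eps: "\<epsilon> = 1 \<or> \<epsilon> = -1"
    using orient[OF zero] zero by auto
  have v2: "v s $ 2 = v s $ 1 * S (t s) (r s) * (r s * H (t s) + \<epsilon> * sqrt (\<kappa> (t s) (r s)))" if "s \<in> I" for s
  proof -
    have "v s $ 2 - H (t s) * S (t s) (r s) * r s * v s $ 1 = \<epsilon> * w s"
      using \<epsilon>[OF that] w[OF that] by (auto simp: orient_def)
    then show ?thesis
      by (simp add: w_def algebra_simps)
  qed
  define E where "E s = S (t s) (r s) * v s $ 1" for s
  have "null_curve M tf a I t r E \<epsilon>"
  proof unfold_locales
    fix s assume s: "s \<in> I"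
    have S_pos: "0 < S (t s) (r s)"
      using sigma_over_H_pos[OF M \<Omega>_D(3-5)[OF inside[OF s]]] by (simp add: tr)
    show "(t s, r s) \<in> \<Omega>"
      using inside[OF s] by (simp add: tr)
    show "0 < E s"
      using v[OF s] S_pos by (simp add: E_def)
    show "(t has_real_derivative E s / S (t s) (r s)) (at s)"
      using d\<gamma>[OF s, of 1] S_pos by (simp add: tr E_def)
    show "(r has_real_derivative rate_r \<epsilon> (t s) (r s) (E s)) (at s)"
      using d\<gamma>[OF s, of 2] v2[OF s] by (simp add: tr E_def mult_ac)
    have "acc s = geodesic_acc (mcvittie_metric M a) (\<gamma> s) (v s) \<longleftrightarrow>
      ((\<lambda>s. S (t s) (r s) * v s $ 1) has_real_derivative
      rate_E \<epsilon> (t s) (r s) (S (t s) (r s) * v s $ 1)) (at s)"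
    proof (rule null_geodesic_iff)
      show "\<forall>\<^sub>F s' in nhds s. (t has_real_derivative v s' $ 1) (at s') \<and>
        (r has_real_derivative v s' $ 2) (at s') \<and> (t s', r s') \<in> \<Omega> \<and>
        v s' $ 2 = v s' $ 1 * S (t s') (r s') * (r s' * H (t s') + \<epsilon> * sqrt (\<kappa> (t s') (r s')))"
        using nhds[OF s]
      proof eventually_elim
        case (elim s')
        then show ?case
          using d\<gamma>[OF elim, of 1] d\<gamma>[OF elim, of 2] inside[OF elim] v2[OF elim] unfolding tr by blast
      qed
    qed (use eps v[OF s] dv[OF s] angles angles(3)[OF s] v34[OF s] acc34[OF s] in \<open>auto simp: tr\<close>)
    then show "(E has_real_derivative
        rate_E \<epsilon> (t s) (r s) (E s)) (at s)"
      unfolding E_def[abs_def] acc_def by simp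
  qed (use I zero eps lims in auto)
  then show ?thesis
    using that angles unfolding tr by blast
qed

text \<open>The second derivatives have to be produced first: the velocities are differentiable
  because E is and because S, \<surd>\<kappa> and H are. Their values need not be known, since
  \<open>null_geodesic_iff\<close> identifies them from the equation for E.\<close>

lemma RNG_if_null_curve:
  assumes I: "open I" "is_interval I" "I \<noteq> {}"
    and angles: "0 < \<theta>" "\<theta> < pi" and eps: "\<epsilon> = 1 \<or> \<epsilon> = -1"
    and inside: "\<And>s. s \<in> I \<Longrightarrow> (\<tau> s, \<rho> s) \<in> \<Omega>"
    and E_pos: "\<And>s. s \<in> I \<Longrightarrow> 0 < E s"
    and d\<tau>: "\<And>s. s \<in> I \<Longrightarrow> (\<tau> has_real_derivative E s / S (\<tau> s) (\<rho> s)) (at s)"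
    and d\<rho>: "\<And>s. s \<in> I \<Longrightarrow> (\<rho> has_real_derivative
      rate_r \<epsilon> (\<tau> s) (\<rho> s) (E s)) (at s)"
    and dE: "\<And>s. s \<in> I \<Longrightarrow> (E has_real_derivative
      rate_E \<epsilon> (\<tau> s) (\<rho> s) (E s)) (at s)"
  shows "RNG M tf a I (\<lambda>s. vec4 (\<tau> s) (\<rho> s) \<theta> \<phi>)"
proof -
  define p where "p s = E s / S (\<tau> s) (\<rho> s)" for s
  define q where "q s = rate_r \<epsilon> (\<tau> s) (\<rho> s) (E s)" for s
  have S_pos: "0 < S (\<tau> s) (\<rho> s)" if "s \<in> I" for s
    using sigma_over_H_pos[OF M \<Omega>_D(3-5)[OF inside[OF that]]] .
  have q_eq: "q s = p s * S (\<tau> s) (\<rho> s) * (\<rho> s * H (\<tau> s) + \<epsilon> * sqrt (\<kappa> (\<tau> s) (\<rho> s)))" if "s \<in> I" for s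
    using S_pos[OF that] by (simp add: q_def p_def)
  have geo: "affine_geodesic (mcvittie_metric M a) I (\<lambda>s. vec4 (\<tau> s) (\<rho> s) \<theta> \<phi>) (\<lambda>s. vec4 (p s) (q s) 0 0)"
    unfolding affine_geodesic_def
  proof (intro ballI conjI)
    fix s assume s: "s \<in> I"
    have ds: "\<tau> differentiable (at s)" "\<rho> differentiable (at s)" "E differentiable (at s)"
      using d\<tau>[OF s] d\<rho>[OF s] dE[OF s] real_differentiable_def by blast+
    have comp: "(\<lambda>s. G (\<tau> s) (\<rho> s)) differentiable (at s)"
      if "(\<lambda>z. G (fst z) (snd z)) differentiable (at (\<tau> s, \<rho> s))" for G :: "real \<Rightarrow> real \<Rightarrow> real"
      using differentiable_chain_at[OF differentiable_Pair[OF ds(1,2)] that] by (simp add: o_def)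
    note D = \<Omega>_D[OF inside[OF s]]
    have "(\<lambda>s. H (\<tau> s)) differentiable (at s)"
      using differentiable_chain_at[OF ds(1) H_differentiable[OF D(1)]] by (simp add: o_def)
    then have "p differentiable (at s)" "q differentiable (at s)"
      unfolding p_def[abs_def] q_def[abs_def] using S_pos[OF s]
      by (intro differentiable_divide differentiable_mult differentiable_add differentiable_const ds
          comp[OF S_differentiable] comp[OF sqrt_kappa_differentiable] inside[OF s]; simp)+
    then obtain p' q' where dpq: "(p has_real_derivative p') (at s)" "(q has_real_derivative q') (at s)"
      by (auto simp: real_differentiable_def)
    have "vec4 p' q' 0 0 = geodesic_acc (mcvittie_metric M a) (vec4 (\<tau> s) (\<rho> s) \<theta> \<phi>) (vec4 (p s) (q s) 0 0) \<longleftrightarrow>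
      ((\<lambda>s. S (\<tau> s) (\<rho> s) * p s) has_real_derivative
      rate_E \<epsilon> (\<tau> s) (\<rho> s) (S (\<tau> s) (\<rho> s) * p s)) (at s)"
    proof (rule null_geodesic_iff[OF _ _ _ dpq])
      show "\<forall>\<^sub>F s' in nhds s. (\<tau> has_real_derivative p s') (at s') \<and>
        (\<rho> has_real_derivative q s') (at s') \<and> (\<tau> s', \<rho> s') \<in> \<Omega> \<and>
        q s' = p s' * S (\<tau> s') (\<rho> s') * (\<rho> s' * H (\<tau> s') + \<epsilon> * sqrt (\<kappa> (\<tau> s') (\<rho> s')))"
        using eventually_nhds_in_open[OF I(1) s]
      proof eventually_elim
        case (elim s')
        then show ?case
          using d\<tau>[OF elim] d\<rho>[OF elim] inside[OF elim] q_eq[OF elim] unfolding p_def[symmetric] q_def[symmetric] by blast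
      qed
      show "0 < p s"
        using E_pos[OF s] S_pos[OF s] by (simp add: p_def)
    qed (use eps angles in auto)
    moreover have "((\<lambda>s. S (\<tau> s) (\<rho> s) * p s) has_real_derivative
      rate_E \<epsilon> (\<tau> s) (\<rho> s) (S (\<tau> s) (\<rho> s) * p s)) (at s)"
    proof -
      have Sp: "S (\<tau> s) (\<rho> s) * p s = E s" if "s \<in> I" for s
        using S_pos[OF that] by (simp add: p_def)
      show ?thesis
        unfolding Sp[OF s]
        by (rule has_field_derivative_transform_within_open[OF dE[OF s] I(1) s]) (simp add: Sp)
    qed
    ultimately have acc: "vec4 p' q' 0 0 = geodesic_acc (mcvittie_metric M a) (vec4 (\<tau> s) (\<rho> s) \<theta> \<phi>) (vec4 (p s) (q s) 0 0)"
      by blast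
    show "((\<lambda>s. vec4 (\<tau> s) (\<rho> s) \<theta> \<phi>) has_vector_derivative vec4 (p s) (q s) 0 0) (at s)"
      unfolding has_vector_derivative_vec_iff forall_4
      using d\<tau>[OF s] d\<rho>[OF s] by (simp add: p_def q_def)
    show "((\<lambda>s. vec4 (p s) (q s) 0 0) has_vector_derivative geodesic_acc (mcvittie_metric M a) (vec4 (\<tau> s) (\<rho> s) \<theta> \<phi>) (vec4 (p s) (q s) 0 0)) (at s)"
      unfolding acc[symmetric] has_vector_derivative_vec_iff forall_4 using dpq by simp
  qed
  have null: "vec4 (p s) (q s) 0 0 \<bullet> (mcvittie_metric M a (vec4 (\<tau> s) (\<rho> s) \<theta> \<phi>) *v vec4 (p s) (q s) 0 0) = 0"
    if s: "s \<in> I" for s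
  proof -
    have "q s - H (\<tau> s) * S (\<tau> s) (\<rho> s) * \<rho> s * p s = \<epsilon> * (p s * S (\<tau> s) (\<rho> s) * sqrt (\<kappa> (\<tau> s) (\<rho> s)))"
      unfolding q_eq[OF s] by (simp add: algebra_simps)
    then have "(q s - H (\<tau> s) * S (\<tau> s) (\<rho> s) * \<rho> s * p s)\<^sup>2 = (p s * S (\<tau> s) (\<rho> s) * sqrt (\<kappa> (\<tau> s) (\<rho> s)))\<^sup>2"
      using eps by auto
    then show ?thesis
      using null_vector_iff[of "vec4 (\<tau> s) (\<rho> s) \<theta> \<phi>" "vec4 (p s) (q s) 0 0"] inside[OF s] by simp
  qed
  have "0 < p s" if "s \<in> I" for s
    using E_pos[OF that] S_pos[OF that] by (simp add: p_def)
  then show ?thesis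
    unfolding RNG_def Omega_eq
    using I angles geo null inside
    by (intro conjI exI[of _ \<theta>] exI[of _ \<phi>] exI[of _ "\<lambda>s. vec4 (p s) (q s) 0 0"]) auto
qed

lemma isCont_compose_Omega:
  fixes G :: "real \<Rightarrow> real \<Rightarrow> real"
  assumes "continuous_on \<Omega> (\<lambda>z. G (fst z) (snd z))" "(f l, g l) \<in> \<Omega>" "isCont f l" "isCont g l"
  shows "isCont (\<lambda>s. G (f s) (g s)) l"
proof -
  have "isCont (\<lambda>z. G (fst z) (snd z)) (f l, g l)"
    using assms(1,2) continuous_on_eq_continuous_at[OF open_\<Omega>] by blast
  from isCont_o2[OF isCont_Pair[OF assms(3,4)] this] show ?thesis
    by simp
qed

end

context null_curve
begin

text \<open>The Picard solution to the left of \<open>l\<close> takes over the limits of t, r and E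
  and the same \<open>\<epsilon>\<close>, so all three right-hand sides match at \<open>l\<close>
  and the union solves the first-order system there as well.\<close>

lemma RNG_extension:
  assumes I: "open I" and l: "l < 0" "{l<..0} \<subseteq> I" "\<And>s. s \<in> I \<Longrightarrow> l < s"
    and lim: "((\<lambda>s. (\<tau> s, \<rho> s)) \<longlongrightarrow> (t', r')) (at_right l)" "(E \<longlongrightarrow> E') (at_right l)"
    and limit: "(t', r') \<in> \<Omega>" "0 < E'" and angles: "0 < \<theta>" "\<theta> < pi"
  obtains J \<eta> where "RNG M tf a J \<eta>" "I \<subset> J" "\<And>s. s \<in> I \<Longrightarrow> \<eta> s = vec4 (\<tau> s) (\<rho> s) \<theta> \<phi>"
proof -
  obtain d \<tau>' \<rho>' F where d: "0 < d" and at_l: "\<tau>' l = t'" "\<rho>' l = r'" "F l = E'"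
    and cont: "continuous_on {l - d..l} \<tau>'" "continuous_on {l - d..l} \<rho>'" "continuous_on {l - d..l} F"
    and ode: "\<And>s. s \<in> {l - d<..<l} \<Longrightarrow> (\<tau>' s, \<rho>' s) \<in> \<Omega> \<and> 0 < F s \<and>
      (\<tau>' has_real_derivative F s / S (\<tau>' s) (\<rho>' s)) (at s) \<and>
      (\<rho>' has_real_derivative rate_r \<epsilon> (\<tau>' s) (\<rho>' s) (F s)) (at s) \<and>
      (F has_real_derivative
        rate_E \<epsilon> (\<tau>' s) (\<rho>' s) (F s)) (at s)"
    using null_curve_backward_extension[OF limit, of l \<epsilon>] by blast
  define T where "T s = (if s \<le> l then \<tau>' s else \<tau> s)" for s
  define P where "P s = (if s \<le> l then \<rho>' s else \<rho> s)" for s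
  define N where "N s = (if s \<le> l then F s else E s)" for s
  have T_eq: "T = (\<lambda>s. if s \<le> l then \<tau>' s else \<tau> s)"
    and P_eq: "P = (\<lambda>s. if s \<le> l then \<rho>' s else \<rho> s)"
    and N_eq: "N = (\<lambda>s. if s \<le> l then F s else E s)"
    by (auto simp: T_def P_def N_def)
  have left: "(f \<longlongrightarrow> f l) (at_left l)" if "continuous_on {l - d..l} f" for f :: "real \<Rightarrow> real"
    using that d by (auto simp: continuous_on_def at_within_Icc_at_left dest!: bspec[of _ _ l])
  have right: "(\<tau> \<longlongrightarrow> \<tau>' l) (at_right l)" "(\<rho> \<longlongrightarrow> \<rho>' l) (at_right l)" "(E \<longlongrightarrow> F l) (at_right l)"
    using tendsto_fst[OF lim(1)] tendsto_snd[OF lim(1)] lim(2) by (simp_all add: at_l)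
  have isC: "isCont T l" "isCont P l" "isCont N l"
    using tendsto_glue[OF left[OF cont(1)] right(1)] tendsto_glue[OF left[OF cont(2)] right(2)]
      tendsto_glue[OF left[OF cont(3)] right(3)]
    by (simp_all add: isCont_def T_def[abs_def] P_def[abs_def] N_def[abs_def])
  have Tl: "T l = t'" "P l = r'" "N l = E'"
    by (simp_all add: T_def P_def N_def at_l)
  then have inl: "(T l, P l) \<in> \<Omega>"
    using limit by simp
  note Dl = \<Omega>_D[OF inl]
  have S_l: "0 < S (T l) (P l)"
    by (rule sigma_over_H_pos[OF M Dl(3-5)])
  note contS = isCont_compose_Omega[OF S_continuous inl isC(1,2)]
    and contu = isCont_compose_Omega[OF sqrt_kappa_continuous inl isC(1,2)]
  have contH: "isCont (\<lambda>s. H (T s)) l" and conta: "isCont (\<lambda>s. a (T s)) l"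
    using isCont_o2[OF isC(1)] H_continuous a_continuous Dl(1) continuous_on_eq_continuous_at[OF open_dom]
    by blast+
  define J where "J = {l - d<..l} \<union> I"
  have X1: "isCont (\<lambda>s. N s / S (T s) (P s)) l"
    using S_l by (intro continuous_intros isC contS) auto
  have X2: "isCont (\<lambda>s. rate_r \<epsilon> (T s) (P s) (N s)) l"
    by (intro continuous_intros isC contS contu contH)
  have contk: "isCont (\<lambda>s. \<kappa> (T s) (P s)) l"
    unfolding kappa_def using Dl by (intro continuous_intros isC conta) auto
  have "isCont (\<lambda>s. dlnS M a (T s) (P s)) l"
    unfolding dlnS_def dkappa_def using Dl S_l
    by (intro continuous_intros isC conta contS contk) auto
  then have X3: "isCont (\<lambda>s. rate_E \<epsilon> (T s) (P s) (N s)) l"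
    by (intro continuous_intros isC contu contH)
  have "RNG M tf a J (\<lambda>s. vec4 (T s) (P s) \<theta> \<phi>)"
  proof (rule RNG_if_null_curve[OF _ _ _ angles eps])
    \<comment> \<open>As a union of two overlapping open intervals, J is visibly open and
      connected.\<close>
    have J_eq: "J = {l - d<..<0} \<union> I"
    proof -
      have "x \<in> {l - d<..l} \<union> {l<..0} \<longleftrightarrow> x \<in> {l - d<..<0} \<union> {0}" for x
        using l(1) d by auto
      moreover have "J = {l - d<..l} \<union> {l<..0} \<union> I" "{0} \<union> I = I"
        using l(2) zero by (auto simp: J_def)
      ultimately show ?thesis
        by blast
    qed
    show "open J"
      unfolding J_eq using I by auto
    have "l / 2 \<in> {l - d<..<0}" "l / 2 \<in> I"
      using l(1) d subsetD[OF l(2), of "l / 2"] by auto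
    then have ne: "{l - d<..<0} \<inter> I \<noteq> {}"
      by blast
    show "is_interval J"
      unfolding J_eq is_interval_connected_1 using interval
      by (intro connected_Un ne) (simp_all add: is_interval_connected_1)
    show "J \<noteq> {}"
      using zero by (auto simp: J_def)
    fix s assume s: "s \<in> J"
    then consider "s \<in> {l - d<..<l}" | "s = l" | "s \<in> I"
      by (cases s l rule: linorder_cases) (auto simp: J_def)
    then have "(T s, P s) \<in> \<Omega> \<and> 0 < N s"
    proof cases
      case 1
      then show ?thesis
        using ode[OF 1] by (simp add: T_def P_def N_def)
    next
      case 2
      then show ?thesis
        using inl Tl limit by simp
    next
      case 3
      then show ?thesis
        using inside[OF 3] E_pos[OF 3] l(3)[OF 3] by (simp add: T_def P_def N_def)
    qed
    then show "(T s, P s) \<in> \<Omega>" "0 < N s"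
      by auto
    have "((\<lambda>s. if s \<le> l then \<tau>' s else \<tau> s) has_real_derivative N s / S (T s) (P s)) (at s)"
    proof (rule has_real_derivative_glue[where A = I and d = d and X = "\<lambda>s. N s / S (T s) (P s)"])
      show "(\<tau>' has_real_derivative N s / S (T s) (P s)) (at s)" if "s \<in> {l - d<..<l}" for s
        using ode[OF that] that by (simp add: T_def P_def N_def)
      show "(\<tau> has_real_derivative N s / S (T s) (P s)) (at s)" if "s \<in> I" for s
        using d\<tau>[OF that] l(3)[OF that] by (simp add: T_def P_def N_def)
      show "isCont (\<lambda>s. if s \<le> l then \<tau>' s else \<tau> s) l"
        using isC(1) unfolding T_eq .
      show "((\<lambda>s. N s / S (T s) (P s)) \<longlongrightarrow> N l / S (T l) (P l)) (at l)"
        using X1 unfolding isCont_def .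
      show "s \<in> {l - d<..l} \<union> I"
        using s unfolding J_def .
    qed (use d l in auto)
    then show "(T has_real_derivative N s / S (T s) (P s)) (at s)"
      unfolding T_eq[symmetric] .
    have "((\<lambda>s. if s \<le> l then \<rho>' s else \<rho> s) has_real_derivative rate_r \<epsilon> (T s) (P s) (N s)) (at s)"
    proof (rule has_real_derivative_glue[where A = I and d = d and X = "\<lambda>s. rate_r \<epsilon> (T s) (P s) (N s)"])
      show "(\<rho>' has_real_derivative rate_r \<epsilon> (T s) (P s) (N s)) (at s)" if "s \<in> {l - d<..<l}" for s
        using ode[OF that] that by (simp add: T_def P_def N_def)
      show "(\<rho> has_real_derivative rate_r \<epsilon> (T s) (P s) (N s)) (at s)" if "s \<in> I" for s
        using d\<rho>[OF that] l(3)[OF that] by (simp add: T_def P_def N_def)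
      show "isCont (\<lambda>s. if s \<le> l then \<rho>' s else \<rho> s) l"
        using isC(2) unfolding P_eq .
      show "((\<lambda>s. rate_r \<epsilon> (T s) (P s) (N s)) \<longlongrightarrow> rate_r \<epsilon> (T l) (P l) (N l)) (at l)"
        using X2 unfolding isCont_def .
      show "s \<in> {l - d<..l} \<union> I"
        using s unfolding J_def .
    qed (use d l in auto)
    then show "(P has_real_derivative rate_r \<epsilon> (T s) (P s) (N s)) (at s)"
      unfolding P_eq[symmetric] .
    have "((\<lambda>s. if s \<le> l then F s else E s) has_real_derivative rate_E \<epsilon> (T s) (P s) (N s)) (at s)"
    proof (rule has_real_derivative_glue[where A = I and d = d and X = "\<lambda>s. rate_E \<epsilon> (T s) (P s) (N s)"])
      show "(F has_real_derivative rate_E \<epsilon> (T s) (P s) (N s)) (at s)" if "s \<in> {l - d<..<l}" for s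
        using ode[OF that] that by (simp add: T_def P_def N_def)
      show "(E has_real_derivative rate_E \<epsilon> (T s) (P s) (N s)) (at s)" if "s \<in> I" for s
        using dE[OF that] l(3)[OF that] by (simp add: T_def P_def N_def)
      show "isCont (\<lambda>s. if s \<le> l then F s else E s) l"
        using isC(3) unfolding N_eq .
      show "((\<lambda>s. rate_E \<epsilon> (T s) (P s) (N s)) \<longlongrightarrow> rate_E \<epsilon> (T l) (P l) (N l)) (at l)"
        using X3 unfolding isCont_def .
      show "s \<in> {l - d<..l} \<union> I"
        using s unfolding J_def .
    qed (use d l in auto)
    then show "(N has_real_derivative rate_E \<epsilon> (T s) (P s) (N s)) (at s)"
      unfolding N_eq[symmetric] .
  qed
  moreover have "I \<subset> J"
  proof -
    have "l \<notin> I"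
      using l(3) by blast
    moreover have "l \<in> J" "I \<subseteq> J"
      using d by (simp_all add: J_def)
    ultimately show ?thesis
      by blast
  qed
  moreover have "vec4 (T s) (P s) \<theta> \<phi> = vec4 (\<tau> s) (\<rho> s) \<theta> \<phi>" if "s \<in> I" for s
    using l(3)[OF that] by (simp add: T_def P_def)
  ultimately show ?thesis
    using that by blast
qed

end

section \<open>The past end point of a maximal radial null geodesic\<close>

theorem proposition6p2:
  fixes M \<Lambda> t0 r0 :: real and tf :: ereal and a :: "real \<Rightarrow> real"
    and I :: "real set" and \<gamma> :: "real \<Rightarrow> real^4"
  assumes "0 < M" and "0 < tf"
    and "initially_expanding_big_bang \<Lambda> tf a"
    and "(t0, r0) \<in> Omega M tf a" and "r1 M a t0 < r0"
    and "maximal_RNG M tf a I \<gamma>"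
    and "0 \<in> I" and "tr_part (\<gamma> 0) = (t0, r0)"
  shows "\<exists>s_star<0. {s_star<..<0} \<subseteq> I \<and>
    (\<forall>s\<in>{s_star<..<0}. tr_part (\<gamma> s) \<in> Omega M tf a) \<and>
    (\<exists>p \<in> origin_set \<union> boundary_kappa_zero M tf a.
       ((\<lambda>s. tr_part (\<gamma> s)) \<longlongrightarrow> p) (at_right s_star))"
proof -
  note bb = assms(3)[unfolded initially_expanding_big_bang_def C2_on_def]
  interpret mcvittie M tf a
    by unfold_locales (use assms(1) bb in auto)
  have RNG: "RNG M tf a I \<gamma>"
    using assms(6) by (simp add: maximal_RNG_def)
  have a_lim: "(a \<longlongrightarrow> 0) (at_right 0)" and aH_lim: "filterlim (\<lambda>t. a t * H t) at_top (at_right 0)"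
    using bb by blast+
  have "\<forall>\<^sub>F t in at_right 0. t \<in> dom"
  proof -
    have "t0 \<in> dom"
      using assms(4) by (simp add: Omega_def)
    then have t0: "0 < t0" "ereal t0 < tf"
      by (simp_all add: time_domain_def)
    have "t \<in> dom" if "0 < t" "t < t0" for t
      using that t0(2) less_trans[of "ereal t" "ereal t0" tf] by (simp add: time_domain_def)
    with t0(1) show ?thesis
      unfolding eventually_at_right_field by blast
  qed
  then have "\<forall>\<^sub>F t in at_right 0. a t * H t = deriv a t"
    by eventually_elim (simp add: deriv_a_eq)
  from filterlim_cong[OF refl refl this, of at_top] aH_lim
  have da_lim: "filterlim (deriv a) at_top (at_right 0)"
    by simp
  obtain \<epsilon> E \<theta> \<phi> where nc: "null_curve M tf a I (\<lambda>s. \<gamma> s $ 1) (\<lambda>s. \<gamma> s $ 2) E \<epsilon>"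
    and angles: "0 < \<theta>" "\<theta> < pi" "\<And>s. s \<in> I \<Longrightarrow> \<gamma> s $ 3 = \<theta> \<and> \<gamma> s $ 4 = \<phi>"
    by (rule RNG_imp_null_curve[OF RNG assms(7) a_lim da_lim]) blast
  interpret null_curve M tf a I "\<lambda>s. \<gamma> s $ 1" "\<lambda>s. \<gamma> s $ 2" E \<epsilon>
    by (rule nc)
  have openI: "open I"
    using RNG by (simp add: RNG_def)
  \<comment> \<open>The left end of \<open>I\<close>, a genuine infimum by
    \<open>past_finite\<close>. Openness of \<open>I\<close> excludes \<open>l\<close> itself, so
    the ray fills the parameters just above \<open>l\<close>.\<close>
  define l where "l = Inf past"
  have lower: "l \<le> s" if "s \<in> past" for s
    unfolding l_def by (rule cInf_lower[OF that past_finite])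
  have l_notin: "l \<notin> I"
  proof
    assume "l \<in> I"
    then obtain e where e: "0 < e" "cball l e \<subseteq> I"
      using openI open_contains_cball by blast
    then have "l - e \<in> I"
      by (auto simp: subset_iff dist_real_def)
    moreover have "l \<le> 0"
      using lower[OF zero_past] .
    ultimately have "l - e \<in> past"
      using e by (simp add: past_def)
    then show False
      using lower e by force
  qed
  have l0: "l < 0"
    using lower[OF zero_past] l_notin zero by (cases "l = 0") auto
  have above: "l < s" if "s \<in> I" for s
    using lower[of s] l_notin that l0 by (cases "s \<le> 0"; cases "s = l") (auto simp: past_def)
  have past: "past = {l<..0}"
  proof
    show "past \<subseteq> {l<..0}"
      using above by (auto simp: past_def)
    show "{l<..0} \<subseteq> past"
    proof
      fix s assume s: "s \<in> {l<..0}"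
      then obtain s' where "s' \<in> past" "s' < s"
        using cInf_lessD[of past s] zero_past by (auto simp: l_def)
      then show "s \<in> past"
        using mem_is_interval_1_I[OF past_interval _ zero_past, of s' s] s by auto
    qed
  qed
  have sub: "{l<..0} \<subseteq> I"
    using past by (auto simp: past_def)
  obtain t' r' E' where lim: "((\<lambda>s. (\<gamma> s $ 1, \<gamma> s $ 2)) \<longlongrightarrow> (t', r')) (at_right l)"
    and cases: "t' = 0 \<and> r' = 0 \<or> (t' \<in> dom \<and> 0 < r' \<and> 0 \<le> \<kappa> t' r' \<and> 0 < E' \<and> (E \<longlongrightarrow> E') (at_right l))"
    by (rule past_limit[OF past l0]) blast
  have "(t', r') \<in> origin_set \<union> boundary_kappa_zero M tf a"
  proof (rule ccontr)
    assume n: "\<not> ?thesis"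
    then have t': "t' \<in> dom" "0 < r'" "0 \<le> \<kappa> t' r'" "0 < E'" "(E \<longlongrightarrow> E') (at_right l)"
      using cases by (auto simp: origin_set_def)
    have "\<kappa> t' r' \<noteq> 0"
      using n kappa_sign(2)[of M a t' r', OF M a_pos[OF t'(1)] t'(2)] t'(1)
      by (auto simp: boundary_kappa_zero_def)
    then have inside': "(t', r') \<in> \<Omega>"
      using t' by (simp add: \<Omega>_def)
    obtain J \<eta> where ext: "RNG M tf a J \<eta>" "I \<subset> J" "\<And>s. s \<in> I \<Longrightarrow> \<eta> s = vec4 (\<gamma> s $ 1) (\<gamma> s $ 2) \<theta> \<phi>"
      using RNG_extension[where \<phi> = \<phi>, OF openI l0 sub above lim t'(5) inside' t'(4) angles(1,2)] by metis
    have "\<eta> s = \<gamma> s" if "s \<in> I" for s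
      using ext(3)[OF that] angles(3)[OF that] by (simp add: vec_eq_iff forall_4)
    then show False
      using assms(6) ext(1,2) unfolding maximal_RNG_def by blast
  qed
  moreover have "tr_part (\<gamma> s) \<in> Omega M tf a" if "s \<in> {l<..<0}" for s
  proof -
    have "\<forall>s\<in>I. tr_part (\<gamma> s) \<in> Omega M tf a"
      using RNG by (simp add: RNG_def)
    moreover have "s \<in> I"
      using sub that by auto
    ultimately show ?thesis
      by blast
  qed
  ultimately show ?thesis
    using l0 sub lim by (intro exI[of _ l]) auto
qed

end
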